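(* (Representation Theorem) Let $\mathfrak M$ be a finite De Morgan algebra and $\alpha$ an ordinal. Every locally finite $\mathfrak M\text{-}\mathrm{CA}_\alpha$ is isomorphic to a subalgebra of a product of regular $\mathfrak M\text{-}\mathrm{CSA}_\alpha$'s, and hence is representable.
   Context: **De Morgan algebra.** $\mathfrak M=\langle M,+,\cdot,-,0,1\rangle$ is a finite De Morgan algebra: $+$ and $\cdot$ are commutative, associative, each distributes over the other, $x+0=x$, $x\cdot 1=x$, $x\cdot(x+y)=x=x+(x\cdot y)$, $-(x+y)=-x\cdot -y$, $-(x\cdot y)=-x+-y$, $--x=x$. $M$ is ordered by $x\le y$ iff $x\cdot y=x$. Whenever $\sup A$ is written, $A$ ranges over nonempty subsets of $M$, and $\sup A$ is the $+$-sum of the elements of $A$. **$\mathfrak M$-cylindric algebra.** Let $\alpha$ be an ordinal. An $\mathfrak M\text{-}\mathrm{CA}_\alpha$ ($\mathfrak M$-cylindric algebra of dimension $\alpha$) is $\mathfrak A=\langle A,+,\cdot,-,u_p,c_\kappa,d_{\kappa\lambda},\delta_p\rangle_{\kappa,\lambda<\alpha,\,p\in M}$ with $+,\cdot$ binary operations on $A$, $-,c_\kappa,\delta_p$ unary operations on $A$, and $u_p,d_{\kappa\lambda}\in A$, satisfying for all $a,b,c\in A$, $p,q\in M$, $\kappa,\lambda,\mu<\alpha$ (finite $\sum,\prod$ are iterated $+,\cdot$; an empty sum is $u_0$): (1)–(3) $+$ and $\cdot$ are commutative, associative and each distributes over the other; (4) $a+u_0=a$, $a\cdot u_1=a$; (5)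 $\delta_pa+-\delta_pa=u_1$, $\delta_pa\cdot-\delta_pa=u_0$; (6) $c_\kappa u_0=u_0$; (7) $a+c_\kappa a=c_\kappa a$; (8) $c_\kappa(a\cdot c_\kappa b)=c_\kappa a\cdot c_\kappa b$; (9) $c_\kappa c_\lambda a=c_\lambda c_\kappa a$; (10) $d_{\lambda\mu}=c_\kappa(d_{\lambda\kappa}\cdot d_{\kappa\mu})$; (11) $d_{\kappa\kappa}=u_1$; (12) $c_\kappa(d_{\kappa\lambda}\cdot\delta_1a)\cdot c_\kappa(d_{\kappa\lambda}\cdot-\delta_1a)=u_0$ if $\kappa\ne\lambda$; (13) $\delta_1(\delta_1a+\delta_1b)=\delta_1a+\delta_1b$; (14) $\delta_1(\delta_1a\cdot\delta_1b)=\delta_1a\cdot\delta_1b$; (15) $\delta_1-\delta_1a=-\delta_1a$; (16) $\delta_1c_\kappa\delta_1a=c_\kappa\delta_1a$; (17) $\delta_1d_{\kappa\lambda}=d_{\kappa\lambda}$; (18) $\delta_0d_{\kappa\lambda}=-d_{\kappa\lambda}$; (19) $\delta_pd_{\kappa\lambda}=u_0$ if $p\ne0,1$; (20) $\delta_p(-a)=\delta_{-p}a$; (21) $\delta_pu_p=u_1$; (22) $\delta_pu_q=u_0$ if $p\neq q$; (23) $\delta_pa\cdot\delta_qa=u_0$ if $p\ne q$; (24) $\sum_{p\in M}\delta_pa=u_1$; (25) $\delta_p(a+b)=\sum_{q+r=p}\delta_qa\cdot\delta_rb$; (26) $\delta_p(a\cdot b)=\sum_{q\cdot r=p}\delta_qa\cdot\delta_rb$;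 (27) $\delta_1\delta_qa=\delta_qa$; (28) $\delta_p\delta_qa=u_0$ if $p\neq0,1$; (29) $\delta_0\delta_qa=-\delta_qa$; (30) if $\delta_pa=\delta_pb$ for all $p\in M$, then $a=b$; (31) $\delta_pc_\kappa a=\big(\sum_{\sup A=p}\prod_{q\in A}c_\kappa\delta_qa\big)\cdot-\big(\sum_{\sup A>p}\prod_{q\in A}c_\kappa\delta_qa\big)$. **Dimension sets.** For $a$ in an $\mathfrak M\text{-}\mathrm{CA}_\alpha$ $\mathfrak A$, $\dim_{\mathfrak A}a=\bigcup_{p\in M}\{\kappa<\alpha:c_\kappa\delta_pa\ne\delta_pa\}$ (the same formula is used for the algebras of the same type defined below). $\mathfrak A$ is locally finite if $\dim_{\mathfrak A}a$ is finite for every $a$ in its universe. **Cylindric set algebras.** For a set $U$, the full cylindric set algebra of dimension $\alpha$ with base $U$ has universe $\mathcal P(U^\alpha)$, the set-theoretic Boolean operations, $C_\kappa X=\{s\in U^\alpha: s\binom{\kappa}{x}\in X\text{ for some }x\in U\}$, where $s\binom{\kappa}{x}$ takes value $x$ at $\kappa$ and agrees with $s$ elsewhere, and $D_{\kappa\lambda}=\{s\in U^\alpha: s_\kappa=s_\lambda\}$. A $\mathrm{CSA}_\alpha$ with base $U$ is a subalgebra of it. **The algebra $\mathfrak M(\mathfrak B)$.** For a cylindric algebra $\mathfrak B=\langle B,+,\cdot,-,0,1,c_\kappa,d_{\kappa\lambda}\rangle_{\kappa,\lambda<\alpha}$ of dimension $\alpha$ (in particular a $\mathrm{CSA}_\alpha$),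 the universe of $\mathfrak M(\mathfrak B)$ is the set of functions $x:M\to B$ (write $x^p=x(p)$) with $x^p\cdot x^q=0$ for $p\ne q$ and $\sum_{p\in M}x^p=1$; its operations are $(x+y)^p=\sum_{q+r=p}x^q\cdot y^r$; $(x\cdot y)^p=\sum_{q\cdot r=p}x^q\cdot y^r$; $(-x)^p=x^{-p}$; $(u_q)^p=1$ if $p=q$, else $0$; $(c_\kappa x)^p=(\sum_{\sup A=p}\prod_{q\in A}c_\kappa x^q)\cdot-(\sum_{\sup A>p}\prod_{q\in A}c_\kappa x^q)$; $(d_{\kappa\lambda})^p=d_{\kappa\lambda},\,-d_{\kappa\lambda},\,0$ according as $p=1$, $p=0$, $p\neq0,1$; $(\delta_qx)^p=x^q,\,-x^q,\,0$ according as $p=1$, $p=0$, $p\ne0,1$. **$\mathfrak M$-cylindric set algebras.** An $\mathfrak M\text{-}\mathrm{CSA}_\alpha$ with base $U$ is a subalgebra of $\mathfrak M(\mathfrak B)$ for some $\mathrm{CSA}_\alpha$ $\mathfrak B$ with base $U$. A set $X\subseteq U^\alpha$ depends on $\Gamma\subseteq\alpha$ if for all $s,t\in U^\alpha$ that agree on $\Gamma$, $s\in X$ iff $t\in X$; a member $L$ of an $\mathfrak M\text{-}\mathrm{CSA}_\alpha$ depends on $\Gamma$ if every $L^p$ ($p\in M$) does. An $\mathfrak M\text{-}\mathrm{CSA}_\alpha$ is regular if every member depends on its dimension set. An $\mathfrak M\text{-}\mathrm{CA}_\alpha$ is representable if it is isomorphic to a subdirect product of $\mathfrak M\text{-}\mathrm{CSA}_\alpha$'s.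 *)

theory Defs
  imports "HOL-Algebra.FiniteProduct"
begin

hide_const (open) Order.top Lattice.sup Lattice.inf

text \<open>
  De Morgan algebras: the operations written \<open>+\<close>, \<open>\<cdot>\<close>, \<open>0\<close>, \<open>1\<close> in the literature are
  \<^term>\<open>sup\<close>, \<^term>\<open>inf\<close>, \<^term>\<open>bot\<close>, \<^term>\<open>top\<close>; the order is the lattice order.
  The one-element algebra is allowed.
\<close>

class de_morgan_algebra = distrib_lattice + bounded_lattice + uminus +
  assumes uminus_sup: "- (sup x y) = inf (- x) (- y)"
    and uminus_inf: "- (inf x y) = sup (- x) (- y)"
    and uminus_uminus: "- (- x) = x"

text \<open>
  An ordinal \<open>\<alpha>\<close> is a well-order \<^typ>\<open>'i rel\<close>; \<open>\<kappa> < \<alpha>\<close> is \<open>\<kappa> \<in> Field \<alpha>\<close>.  Operations of the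
  algebras below are total functions; only their values on the carrier, and at indices in
  \<open>Field \<alpha>\<close>, matter.

  Iterated binary operation with neutral element \<open>e\<close> (the value for the empty index set).
\<close>

definition iter_op :: "'a set \<Rightarrow> ('a \<Rightarrow> 'a \<Rightarrow> 'a) \<Rightarrow> 'a \<Rightarrow> ('k \<Rightarrow> 'a) \<Rightarrow> 'k set \<Rightarrow> 'a" where
  "iter_op X f e g S = finprod \<lparr>carrier = X, monoid.mult = f, one = e\<rparr> g S"


section \<open>\<open>M\<close>-cylindric algebras\<close>

record ('a, 'i, 'm) mcyl_algebra = "'a partial_object" +
  mplus :: "'a \<Rightarrow> 'a \<Rightarrow> 'a" (infixl "\<boxplus>\<index>" 65)
  mtimes :: "'a \<Rightarrow> 'a \<Rightarrow> 'a" (infixl "\<boxdot>\<index>" 70)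
  mneg :: "'a \<Rightarrow> 'a" ("\<sim>\<index> _" [81] 80)
  mconst :: "'m \<Rightarrow> 'a" ("\<u>\<index>")
  mcyl :: "'i \<Rightarrow> 'a \<Rightarrow> 'a" ("\<c>\<index>")
  mdiag :: "'i \<Rightarrow> 'i \<Rightarrow> 'a" ("\<d>\<index>")
  mdelta :: "'m \<Rightarrow> 'a \<Rightarrow> 'a" ("\<delta>\<index>")

definition msum :: "('a, 'i, 'm::de_morgan_algebra) mcyl_algebra \<Rightarrow> ('k \<Rightarrow> 'a) \<Rightarrow> 'k set \<Rightarrow> 'a" where
  "msum A f S = iter_op (carrier A) (mplus A) (mconst A bot) f S"

definition mprod :: "('a, 'i, 'm::de_morgan_algebra) mcyl_algebra \<Rightarrow> ('k \<Rightarrow> 'a) \<Rightarrow> 'k set \<Rightarrow> 'a" where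
  "mprod A f S = iter_op (carrier A) (mtimes A) (mconst A top) f S"

text \<open>All axioms except the one relating three diagonal elements.\<close>

locale m_ca_core =
  fixes \<alpha> :: "'i rel"
    and A :: "('a, 'i, 'm::{de_morgan_algebra, finite}) mcyl_algebra" (structure)
  assumes plus_closed: "\<lbrakk>a \<in> carrier A; b \<in> carrier A\<rbrakk> \<Longrightarrow> a \<boxplus> b \<in> carrier A"
    and times_closed: "\<lbrakk>a \<in> carrier A; b \<in> carrier A\<rbrakk> \<Longrightarrow> a \<boxdot> b \<in> carrier A"
    and neg_closed: "a \<in> carrier A \<Longrightarrow> \<sim> a \<in> carrier A"
    and const_closed: "\<u> p \<in> carrier A"
    and cyl_closed: "\<lbrakk>\<kappa> \<in> Field \<alpha>; a \<in> carrier A\<rbrakk> \<Longrightarrow> \<c> \<kappa> a \<in> carrier A"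
    and diag_closed: "\<lbrakk>\<kappa> \<in> Field \<alpha>; \<mu> \<in> Field \<alpha>\<rbrakk> \<Longrightarrow> \<d> \<kappa> \<mu> \<in> carrier A"
    and delta_closed: "a \<in> carrier A \<Longrightarrow> \<delta> p a \<in> carrier A"
    and plus_comm: "\<lbrakk>a \<in> carrier A; b \<in> carrier A\<rbrakk> \<Longrightarrow> a \<boxplus> b = b \<boxplus> a"
    and times_comm: "\<lbrakk>a \<in> carrier A; b \<in> carrier A\<rbrakk> \<Longrightarrow> a \<boxdot> b = b \<boxdot> a"
    and plus_assoc: "\<lbrakk>a \<in> carrier A; b \<in> carrier A; c \<in> carrier A\<rbrakk>
      \<Longrightarrow> (a \<boxplus> b) \<boxplus> c = a \<boxplus> (b \<boxplus> c)"
    and times_assoc: "\<lbrakk>a \<in> carrier A; b \<in> carrier A; c \<in> carrier A\<rbrakk>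
      \<Longrightarrow> (a \<boxdot> b) \<boxdot> c = a \<boxdot> (b \<boxdot> c)"
    and times_plus_distrib: "\<lbrakk>a \<in> carrier A; b \<in> carrier A; c \<in> carrier A\<rbrakk>
      \<Longrightarrow> a \<boxdot> (b \<boxplus> c) = (a \<boxdot> b) \<boxplus> (a \<boxdot> c)"
    and plus_times_distrib: "\<lbrakk>a \<in> carrier A; b \<in> carrier A; c \<in> carrier A\<rbrakk>
      \<Longrightarrow> a \<boxplus> (b \<boxdot> c) = (a \<boxplus> b) \<boxdot> (a \<boxplus> c)"
    and plus_zero: "a \<in> carrier A \<Longrightarrow> a \<boxplus> \<u> bot = a"
    and times_one: "a \<in> carrier A \<Longrightarrow> a \<boxdot> \<u> top = a"
    and delta_compl_plus: "a \<in> carrier A \<Longrightarrow> \<delta> p a \<boxplus> \<sim> (\<delta> p a) = \<u> top"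
    and delta_compl_times: "a \<in> carrier A \<Longrightarrow> \<delta> p a \<boxdot> \<sim> (\<delta> p a) = \<u> bot"
    and cyl_zero: "\<kappa> \<in> Field \<alpha> \<Longrightarrow> \<c> \<kappa> (\<u> bot) = \<u> bot"
    and cyl_increasing: "\<lbrakk>\<kappa> \<in> Field \<alpha>; a \<in> carrier A\<rbrakk> \<Longrightarrow> a \<boxplus> \<c> \<kappa> a = \<c> \<kappa> a"
    and cyl_times_cyl: "\<lbrakk>\<kappa> \<in> Field \<alpha>; a \<in> carrier A; b \<in> carrier A\<rbrakk>
      \<Longrightarrow> \<c> \<kappa> (a \<boxdot> \<c> \<kappa> b) = \<c> \<kappa> a \<boxdot> \<c> \<kappa> b"
    and cyl_comm: "\<lbrakk>\<kappa> \<in> Field \<alpha>; \<mu> \<in> Field \<alpha>; a \<in> carrier A\<rbrakk>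
      \<Longrightarrow> \<c> \<kappa> (\<c> \<mu> a) = \<c> \<mu> (\<c> \<kappa> a)"
    and diag_refl: "\<kappa> \<in> Field \<alpha> \<Longrightarrow> \<d> \<kappa> \<kappa> = \<u> top"
    and cyl_diag_compl: "\<lbrakk>\<kappa> \<in> Field \<alpha>; \<mu> \<in> Field \<alpha>; \<kappa> \<noteq> \<mu>; a \<in> carrier A\<rbrakk>
      \<Longrightarrow> \<c> \<kappa> (\<d> \<kappa> \<mu> \<boxdot> \<delta> top a) \<boxdot> \<c> \<kappa> (\<d> \<kappa> \<mu> \<boxdot> \<sim> (\<delta> top a)) = \<u> bot"
    and delta_top_plus: "\<lbrakk>a \<in> carrier A; b \<in> carrier A\<rbrakk>
      \<Longrightarrow> \<delta> top (\<delta> top a \<boxplus> \<delta> top b) = \<delta> top a \<boxplus> \<delta> top b"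
    and delta_top_times: "\<lbrakk>a \<in> carrier A; b \<in> carrier A\<rbrakk>
      \<Longrightarrow> \<delta> top (\<delta> top a \<boxdot> \<delta> top b) = \<delta> top a \<boxdot> \<delta> top b"
    and delta_top_neg: "a \<in> carrier A \<Longrightarrow> \<delta> top (\<sim> (\<delta> top a)) = \<sim> (\<delta> top a)"
    and delta_top_cyl: "\<lbrakk>\<kappa> \<in> Field \<alpha>; a \<in> carrier A\<rbrakk>
      \<Longrightarrow> \<delta> top (\<c> \<kappa> (\<delta> top a)) = \<c> \<kappa> (\<delta> top a)"
    and delta_top_diag: "\<lbrakk>\<kappa> \<in> Field \<alpha>; \<mu> \<in> Field \<alpha>\<rbrakk> \<Longrightarrow> \<delta> top (\<d> \<kappa> \<mu>) = \<d> \<kappa> \<mu>"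
    and delta_bot_diag: "\<lbrakk>\<kappa> \<in> Field \<alpha>; \<mu> \<in> Field \<alpha>\<rbrakk> \<Longrightarrow> \<delta> bot (\<d> \<kappa> \<mu>) = \<sim> (\<d> \<kappa> \<mu>)"
    and delta_other_diag: "\<lbrakk>\<kappa> \<in> Field \<alpha>; \<mu> \<in> Field \<alpha>; p \<noteq> bot; p \<noteq> top\<rbrakk>
      \<Longrightarrow> \<delta> p (\<d> \<kappa> \<mu>) = \<u> bot"
    and delta_neg: "a \<in> carrier A \<Longrightarrow> \<delta> p (\<sim> a) = \<delta> (- p) a"
    and delta_const_same: "\<delta> p (\<u> p) = \<u> top"
    and delta_const_other: "p \<noteq> q \<Longrightarrow> \<delta> p (\<u> q) = \<u> bot"
    and delta_disjoint: "\<lbrakk>a \<in> carrier A; p \<noteq> q\<rbrakk> \<Longrightarrow> \<delta> p a \<boxdot> \<delta> q a = \<u> bot"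
    and delta_sum: "a \<in> carrier A \<Longrightarrow> msum A (\<lambda>p. \<delta> p a) UNIV = \<u> top"
    and delta_plus: "\<lbrakk>a \<in> carrier A; b \<in> carrier A\<rbrakk>
      \<Longrightarrow> \<delta> p (a \<boxplus> b) = msum A (\<lambda>(q, r). \<delta> q a \<boxdot> \<delta> r b) {(q, r). sup q r = p}"
    and delta_times: "\<lbrakk>a \<in> carrier A; b \<in> carrier A\<rbrakk>
      \<Longrightarrow> \<delta> p (a \<boxdot> b) = msum A (\<lambda>(q, r). \<delta> q a \<boxdot> \<delta> r b) {(q, r). inf q r = p}"
    and delta_top_delta: "a \<in> carrier A \<Longrightarrow> \<delta> top (\<delta> q a) = \<delta> q a"
    and delta_other_delta: "\<lbrakk>a \<in> carrier A; p \<noteq> bot; p \<noteq> top\<rbrakk> \<Longrightarrow> \<delta> p (\<delta> q a) = \<u> bot"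
    and delta_bot_delta: "a \<in> carrier A \<Longrightarrow> \<delta> bot (\<delta> q a) = \<sim> (\<delta> q a)"
    and delta_eqI: "\<lbrakk>a \<in> carrier A; b \<in> carrier A; \<And>p. \<delta> p a = \<delta> p b\<rbrakk> \<Longrightarrow> a = b"
    and delta_cyl: "\<lbrakk>\<kappa> \<in> Field \<alpha>; a \<in> carrier A\<rbrakk> \<Longrightarrow> \<delta> p (\<c> \<kappa> a) =
      msum A (\<lambda>P. mprod A (\<lambda>q. \<c> \<kappa> (\<delta> q a)) P) {P. P \<noteq> {} \<and> Sup_fin P = p} \<boxdot>
      \<sim> (msum A (\<lambda>P. mprod A (\<lambda>q. \<c> \<kappa> (\<delta> q a)) P) {P. P \<noteq> {} \<and> p < Sup_fin P})"

text \<open>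
  The diagonal axiom occurs in two forms.  Here it is required for all \<open>\<kappa>\<close>, \<open>\<mu>\<close>, \<open>\<nu>\<close>.  When
  \<open>Field \<alpha>\<close> has at least two elements, the cases \<open>\<kappa> = \<mu>\<close> and \<open>\<kappa> = \<nu>\<close> then force every \<open>d \<mu> \<nu>\<close> to
  be \<open>u 1\<close> and every \<open>c \<kappa>\<close> to be the identity, so that the set algebras below are models only if
  the base has at most one element.
\<close>

locale m_ca = m_ca_core +
  assumes diag_cyl: "\<lbrakk>\<kappa> \<in> Field \<alpha>; \<mu> \<in> Field \<alpha>; \<nu> \<in> Field \<alpha>\<rbrakk>
    \<Longrightarrow> \<d> \<mu> \<nu> = \<c> \<kappa> (\<d> \<mu> \<kappa> \<boxdot> \<d> \<kappa> \<nu>)"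

text \<open>
  The customary form for cylindric algebras, which the set algebras below satisfy.  With this
  form, and the two-element De Morgan algebra, the models are the cylindric algebras in the usual
  sense; those of finite dimension at least 2 are all locally finite but not all representable.
\<close>

locale m_ca_distinct = m_ca_core +
  assumes diag_cyl_distinct: "\<lbrakk>\<kappa> \<in> Field \<alpha>; \<mu> \<in> Field \<alpha>; \<nu> \<in> Field \<alpha>; \<kappa> \<noteq> \<mu>; \<kappa> \<noteq> \<nu>\<rbrakk>
    \<Longrightarrow> \<d> \<mu> \<nu> = \<c> \<kappa> (\<d> \<mu> \<kappa> \<boxdot> \<d> \<kappa> \<nu>)"

definition dim_set :: "'i rel \<Rightarrow> ('a, 'i, 'm) mcyl_algebra \<Rightarrow> 'a \<Rightarrow> 'i set" where
  "dim_set \<alpha> A a = (\<Union>p. {\<kappa> \<in> Field \<alpha>. mcyl A \<kappa> (mdelta A p a) \<noteq> mdelta A p a})"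

definition locally_finite :: "'i rel \<Rightarrow> ('a, 'i, 'm) mcyl_algebra \<Rightarrow> bool" where
  "locally_finite \<alpha> A \<longleftrightarrow> (\<forall>a \<in> carrier A. finite (dim_set \<alpha> A a))"


section \<open>Subalgebras, isomorphisms, products\<close>

definition m_subalgebra ::
  "'i rel \<Rightarrow> ('a, 'i, 'm) mcyl_algebra \<Rightarrow> ('a, 'i, 'm) mcyl_algebra \<Rightarrow> bool" where
  "m_subalgebra \<alpha> S A \<longleftrightarrow>
     S = A\<lparr>carrier := carrier S\<rparr> \<and> carrier S \<subseteq> carrier A \<and>
     (\<forall>a \<in> carrier S. \<forall>b \<in> carrier S. mplus A a b \<in> carrier S \<and> mtimes A a b \<in> carrier S) \<and>
     (\<forall>a \<in> carrier S. mneg A a \<in> carrier S) \<and>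
     (\<forall>p. mconst A p \<in> carrier S) \<and>
     (\<forall>\<kappa> \<in> Field \<alpha>. \<forall>a \<in> carrier S. mcyl A \<kappa> a \<in> carrier S) \<and>
     (\<forall>\<kappa> \<in> Field \<alpha>. \<forall>\<mu> \<in> Field \<alpha>. mdiag A \<kappa> \<mu> \<in> carrier S) \<and>
     (\<forall>p. \<forall>a \<in> carrier S. mdelta A p a \<in> carrier S)"

definition m_iso ::
  "'i rel \<Rightarrow> ('a, 'i, 'm) mcyl_algebra \<Rightarrow> ('b, 'i, 'm) mcyl_algebra \<Rightarrow> ('a \<Rightarrow> 'b) \<Rightarrow> bool" where
  "m_iso \<alpha> A B h \<longleftrightarrow>
     bij_betw h (carrier A) (carrier B) \<and>
     (\<forall>a \<in> carrier A. \<forall>b \<in> carrier A. h (mplus A a b) = mplus B (h a) (h b) \<and>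
                                     h (mtimes A a b) = mtimes B (h a) (h b)) \<and>
     (\<forall>a \<in> carrier A. h (mneg A a) = mneg B (h a)) \<and>
     (\<forall>p. h (mconst A p) = mconst B p) \<and>
     (\<forall>\<kappa> \<in> Field \<alpha>. \<forall>a \<in> carrier A. h (mcyl A \<kappa> a) = mcyl B \<kappa> (h a)) \<and>
     (\<forall>\<kappa> \<in> Field \<alpha>. \<forall>\<mu> \<in> Field \<alpha>. h (mdiag A \<kappa> \<mu>) = mdiag B \<kappa> \<mu>) \<and>
     (\<forall>p. \<forall>a \<in> carrier A. h (mdelta A p a) = mdelta B p (h a))"

definition m_isomorphic ::
  "'i rel \<Rightarrow> ('a, 'i, 'm) mcyl_algebra \<Rightarrow> ('b, 'i, 'm) mcyl_algebra \<Rightarrow> bool" where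
  "m_isomorphic \<alpha> A B \<longleftrightarrow> (\<exists>h. m_iso \<alpha> A B h)"

definition m_product ::
  "'j set \<Rightarrow> ('j \<Rightarrow> ('a, 'i, 'm) mcyl_algebra) \<Rightarrow> ('j \<Rightarrow> 'a, 'i, 'm) mcyl_algebra" where
  "m_product J C =
     \<lparr>carrier = (\<Pi>\<^sub>E j\<in>J. carrier (C j)),
      mplus = (\<lambda>x y. \<lambda>j\<in>J. mplus (C j) (x j) (y j)),
      mtimes = (\<lambda>x y. \<lambda>j\<in>J. mtimes (C j) (x j) (y j)),
      mneg = (\<lambda>x. \<lambda>j\<in>J. mneg (C j) (x j)),
      mconst = (\<lambda>p. \<lambda>j\<in>J. mconst (C j) p),
      mcyl = (\<lambda>\<kappa> x. \<lambda>j\<in>J. mcyl (C j) \<kappa> (x j)),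
      mdiag = (\<lambda>\<kappa> \<mu>. \<lambda>j\<in>J. mdiag (C j) \<kappa> \<mu>),
      mdelta = (\<lambda>p x. \<lambda>j\<in>J. mdelta (C j) p (x j))\<rparr>"

definition m_subdirect_product ::
  "'i rel \<Rightarrow> 'j set \<Rightarrow> ('j \<Rightarrow> ('a, 'i, 'm) mcyl_algebra) \<Rightarrow> ('j \<Rightarrow> 'a, 'i, 'm) mcyl_algebra \<Rightarrow> bool"
where
  "m_subdirect_product \<alpha> J C S \<longleftrightarrow>
     m_subalgebra \<alpha> S (m_product J C) \<and> (\<forall>j \<in> J. (\<lambda>x. x j) ` carrier S = carrier (C j))"


section \<open>Cylindric set algebras\<close>

record ('b, 'i) cyl_algebra = "'b partial_object" +
  cplus :: "'b \<Rightarrow> 'b \<Rightarrow> 'b"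
  ctimes :: "'b \<Rightarrow> 'b \<Rightarrow> 'b"
  cneg :: "'b \<Rightarrow> 'b"
  czero :: 'b
  cone :: 'b
  ccyl :: "'i \<Rightarrow> 'b \<Rightarrow> 'b"
  cdiag :: "'i \<Rightarrow> 'i \<Rightarrow> 'b"

abbreviation seqs :: "'i rel \<Rightarrow> 'u set \<Rightarrow> ('i \<Rightarrow> 'u) set" where
  "seqs \<alpha> U \<equiv> (\<Pi>\<^sub>E \<kappa>\<in>Field \<alpha>. U)"

definition full_csa :: "'i rel \<Rightarrow> 'u set \<Rightarrow> (('i \<Rightarrow> 'u) set, 'i) cyl_algebra" where
  "full_csa \<alpha> U =
     \<lparr>carrier = Pow (seqs \<alpha> U),
      cplus = (\<union>),
      ctimes = (\<inter>),
      cneg = (\<lambda>X. seqs \<alpha> U - X),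
      czero = {},
      cone = seqs \<alpha> U,
      ccyl = (\<lambda>\<kappa> X. {s \<in> seqs \<alpha> U. \<exists>x \<in> U. s(\<kappa> := x) \<in> X}),
      cdiag = (\<lambda>\<kappa> \<mu>. {s \<in> seqs \<alpha> U. s \<kappa> = s \<mu>})\<rparr>"

definition csa :: "'i rel \<Rightarrow> 'u set \<Rightarrow> (('i \<Rightarrow> 'u) set, 'i) cyl_algebra \<Rightarrow> bool" where
  "csa \<alpha> U B \<longleftrightarrow>
     B = (full_csa \<alpha> U)\<lparr>carrier := carrier B\<rparr> \<and> carrier B \<subseteq> carrier (full_csa \<alpha> U) \<and>
     (\<forall>X \<in> carrier B. \<forall>Y \<in> carrier B. cplus B X Y \<in> carrier B \<and> ctimes B X Y \<in> carrier B) \<and>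
     (\<forall>X \<in> carrier B. cneg B X \<in> carrier B) \<and>
     czero B \<in> carrier B \<and> cone B \<in> carrier B \<and>
     (\<forall>\<kappa> \<in> Field \<alpha>. \<forall>X \<in> carrier B. ccyl B \<kappa> X \<in> carrier B) \<and>
     (\<forall>\<kappa> \<in> Field \<alpha>. \<forall>\<mu> \<in> Field \<alpha>. cdiag B \<kappa> \<mu> \<in> carrier B)"

definition csum :: "('b, 'i) cyl_algebra \<Rightarrow> ('k \<Rightarrow> 'b) \<Rightarrow> 'k set \<Rightarrow> 'b" where
  "csum B f S = iter_op (carrier B) (cplus B) (czero B) f S"

definition cprod :: "('b, 'i) cyl_algebra \<Rightarrow> ('k \<Rightarrow> 'b) \<Rightarrow> 'k set \<Rightarrow> 'b" where
  "cprod B f S = iter_op (carrier B) (ctimes B) (cone B) f S"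


section \<open>The algebra \<open>M(B)\<close> and \<open>M\<close>-cylindric set algebras\<close>

definition m_of :: "('b, 'i) cyl_algebra \<Rightarrow> ('m::{de_morgan_algebra, finite} \<Rightarrow> 'b, 'i, 'm) mcyl_algebra"
where
  "m_of B =
     \<lparr>carrier = {x. (\<forall>p. x p \<in> carrier B) \<and> (\<forall>p q. p \<noteq> q \<longrightarrow> ctimes B (x p) (x q) = czero B) \<and>
                    csum B x UNIV = cone B},
      mplus = (\<lambda>x y p. csum B (\<lambda>(q, r). ctimes B (x q) (y r)) {(q, r). sup q r = p}),
      mtimes = (\<lambda>x y p. csum B (\<lambda>(q, r). ctimes B (x q) (y r)) {(q, r). inf q r = p}),
      mneg = (\<lambda>x p. x (- p)),
      mconst = (\<lambda>q p. if p = q then cone B else czero B),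
      mcyl = (\<lambda>\<kappa> x p. ctimes B
        (csum B (\<lambda>P. cprod B (\<lambda>q. ccyl B \<kappa> (x q)) P) {P. P \<noteq> {} \<and> Sup_fin P = p})
        (cneg B (csum B (\<lambda>P. cprod B (\<lambda>q. ccyl B \<kappa> (x q)) P) {P. P \<noteq> {} \<and> p < Sup_fin P}))),
      mdiag = (\<lambda>\<kappa> \<mu> p. if p = top then cdiag B \<kappa> \<mu> else
                          if p = bot then cneg B (cdiag B \<kappa> \<mu>) else czero B),
      mdelta = (\<lambda>q x p. if p = top then x q else if p = bot then cneg B (x q) else czero B)\<rparr>"

definition m_csa ::
  "'i rel \<Rightarrow> 'u set \<Rightarrow> ('m::{de_morgan_algebra, finite} \<Rightarrow> ('i \<Rightarrow> 'u) set, 'i, 'm) mcyl_algebra \<Rightarrow> bool"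
where
  "m_csa \<alpha> U C \<longleftrightarrow> (\<exists>B. csa \<alpha> U B \<and> m_subalgebra \<alpha> C (m_of B))"

definition depends_on :: "'i rel \<Rightarrow> 'u set \<Rightarrow> ('i \<Rightarrow> 'u) set \<Rightarrow> 'i set \<Rightarrow> bool" where
  "depends_on \<alpha> U X \<Gamma> \<longleftrightarrow>
     (\<forall>s \<in> seqs \<alpha> U. \<forall>t \<in> seqs \<alpha> U. (\<forall>\<kappa> \<in> \<Gamma>. s \<kappa> = t \<kappa>) \<longrightarrow> (s \<in> X \<longleftrightarrow> t \<in> X))"

definition regular_m_csa ::
  "'i rel \<Rightarrow> 'u set \<Rightarrow> ('m::{de_morgan_algebra, finite} \<Rightarrow> ('i \<Rightarrow> 'u) set, 'i, 'm) mcyl_algebra \<Rightarrow> bool"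
where
  "regular_m_csa \<alpha> U C \<longleftrightarrow>
     m_csa \<alpha> U C \<and> (\<forall>L \<in> carrier C. \<forall>p. depends_on \<alpha> U (L p) (dim_set \<alpha> C L))"


section \<open>Representability\<close>

text \<open>
  HOL cannot quantify existentially over types, so the index set of the product and the bases of
  its factors are subsets of fixed types.  These lose no generality.  If an algebra \<open>A\<close> is a
  subdirect product at all, then one factor for each pair of distinct elements separates the
  points of \<open>A\<close>.  Let \<open>\<theta>\<close> be the maximum of \<open>\<omega>\<close>, \<open>|\<alpha>|\<close> and \<open>|A|\<close>.  In each factor the base can be cut
  down to at most \<open>2\<^sup>\<theta>\<close> points: close a set of points that separates the required pairs under
  witnesses for the cylindrifications at all sequences of length \<open>\<alpha>\<close>, which is possible since
  \<open>(2\<^sup>\<theta>)\<^sup>\<theta> = 2\<^sup>\<theta>\<close>, and restrict all sets to sequences over the new base.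
\<close>

type_synonym ('a, 'i) base_point = "('i + 'a + nat) set"

type_synonym ('a, 'i, 'm) set_valued =
  "('m \<Rightarrow> ('i \<Rightarrow> ('a, 'i) base_point) set, 'i, 'm) mcyl_algebra"

definition embeds_in_product_of_regular ::
  "'i rel \<Rightarrow> ('a, 'i, 'm::{de_morgan_algebra, finite}) mcyl_algebra \<Rightarrow> bool" where
  "embeds_in_product_of_regular \<alpha> A \<longleftrightarrow>
     (\<exists>(J :: ('a \<times> 'a) set) (C :: 'a \<times> 'a \<Rightarrow> ('a, 'i, 'm) set_valued) S.
        (\<forall>j \<in> J. \<exists>U. regular_m_csa \<alpha> U (C j)) \<and>
        m_subalgebra \<alpha> S (m_product J C) \<and> m_isomorphic \<alpha> A S)"

definition representable ::
  "'i rel \<Rightarrow> ('a, 'i, 'm::{de_morgan_algebra, finite}) mcyl_algebra \<Rightarrow> bool" where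
  "representable \<alpha> A \<longleftrightarrow>
     (\<exists>(J :: ('a \<times> 'a) set) (C :: 'a \<times> 'a \<Rightarrow> ('a, 'i, 'm) set_valued) S.
        (\<forall>j \<in> J. \<exists>U. m_csa \<alpha> U (C j)) \<and>
        m_subdirect_product \<alpha> J C S \<and> m_isomorphic \<alpha> A S)"

end

theory Submission
  imports Defs
begin

text \<open>
  An element \<open>a\<close> of an \<open>M\<close>-cylindric algebra is determined by the family of the elements \<open>\<delta> p a\<close>.
  These are Boolean: the fixed points of \<open>\<delta> top\<close> form a Boolean algebra, closed under the
  cylindrifications and containing the diagonals.  The axioms compute \<open>\<delta> p\<close> of a compound element
  from the \<open>\<delta> q\<close> of its parts by the same formulas that define the operations of \<open>m_of\<close>.  Therefore
  every homomorphism \<open>g\<close> from the Boolean elements to a full cylindric set algebra yields a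
  homomorphism \<open>a \<mapsto> (p \<mapsto> g (\<delta> p a))\<close> into an \<open>M\<close>-cylindric set algebra (lemma \<open>m_hom_spectrum\<close>).  If the
  sets \<open>g b\<close> depend on the finite dimension sets of the \<open>b\<close>, its image is regular
  (\<open>regular_hom_image\<close>).  It remains to find, for each nonzero Boolean element \<open>x\<close>, such a \<open>g\<close> with
  \<open>g x \<noteq> {}\<close>; then one factor for each pair of distinct elements gives an embedding into a product.

  By Stone duality the Boolean elements become a field of sets with abstract cylindrifications and
  diagonals.  If the diagonal axiom holds without restriction, then either the dimension is one, and
  the base is a class of Stone points that no closed set tells apart, or the cylindrifications and
  diagonals are trivial and the base is a single point.

  The substance is the infinite-dimensional case with the restricted diagonal axiom, a version of
  Henkin's completeness proof.  An infinite dimension alone need not provide enough indices to serve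
  as witnesses for all elements, so one adds names: for every set \<open>b\<close>, index \<open>\<kappa>\<close> and assignment \<open>f\<close>
  of names to the dimension set of \<open>b\<close> there is a new name that is to witness \<open>cyl \<kappa> b\<close> under \<open>f\<close>.
  Names have no meaning in the algebra, but finitely many of them can be interpreted by distinct
  indices away from any finite set of indices in use, and then, thanks to local finiteness,
  simultaneous substitution of indices for indices behaves well (\<open>Sub_insert\<close>,
  \<open>Sub_Compl_Int\<close>, \<open>cyl_Sub\<close>).  Finitely many witness conditions can be granted at once
  (\<open>requests_consistent\<close>), so there is an ultrafilter on the pairs of an interpretation and a point
  that grants all of them (\<open>limit_exists\<close>).  Truth along this ultrafilter commutes with complements,
  intersections, diagonals and cylindrifications, and the names modulo equality in the limit form
  the base (\<open>limit_representation\<close>).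
\<close>

section \<open>Boolean algebras on a carrier set and their Stone spaces\<close>

locale boolean_algebra_on =
  fixes X :: "'a set"
    and join :: "'a \<Rightarrow> 'a \<Rightarrow> 'a" (infixl "\<curlyvee>" 65)
    and meet :: "'a \<Rightarrow> 'a \<Rightarrow> 'a" (infixl "\<curlywedge>" 70)
    and compl :: "'a \<Rightarrow> 'a" and zero one :: 'a
  assumes join_closed: "a \<in> X \<Longrightarrow> b \<in> X \<Longrightarrow> a \<curlyvee> b \<in> X"
    and meet_closed: "a \<in> X \<Longrightarrow> b \<in> X \<Longrightarrow> a \<curlywedge> b \<in> X"
    and compl_closed: "a \<in> X \<Longrightarrow> compl a \<in> X"
    and zero_closed: "zero \<in> X" and one_closed: "one \<in> X"
    and join_comm: "a \<in> X \<Longrightarrow> b \<in> X \<Longrightarrow> a \<curlyvee> b = b \<curlyvee> a"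
    and meet_comm: "a \<in> X \<Longrightarrow> b \<in> X \<Longrightarrow> a \<curlywedge> b = b \<curlywedge> a"
    and join_assoc: "a \<in> X \<Longrightarrow> b \<in> X \<Longrightarrow> c \<in> X \<Longrightarrow> (a \<curlyvee> b) \<curlyvee> c = a \<curlyvee> (b \<curlyvee> c)"
    and meet_assoc: "a \<in> X \<Longrightarrow> b \<in> X \<Longrightarrow> c \<in> X \<Longrightarrow> (a \<curlywedge> b) \<curlywedge> c = a \<curlywedge> (b \<curlywedge> c)"
    and meet_join_distrib:
      "a \<in> X \<Longrightarrow> b \<in> X \<Longrightarrow> c \<in> X \<Longrightarrow> a \<curlywedge> (b \<curlyvee> c) = (a \<curlywedge> b) \<curlyvee> (a \<curlywedge> c)"
    and join_meet_distrib:
      "a \<in> X \<Longrightarrow> b \<in> X \<Longrightarrow> c \<in> X \<Longrightarrow> a \<curlyvee> (b \<curlywedge> c) = (a \<curlyvee> b) \<curlywedge> (a \<curlyvee> c)"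
    and join_zero: "a \<in> X \<Longrightarrow> a \<curlyvee> zero = a"
    and meet_one: "a \<in> X \<Longrightarrow> a \<curlywedge> one = a"
    and join_compl: "a \<in> X \<Longrightarrow> a \<curlyvee> compl a = one"
    and meet_compl: "a \<in> X \<Longrightarrow> a \<curlywedge> compl a = zero"
begin

lemmas closed = join_closed meet_closed compl_closed zero_closed one_closed

lemma meet_zero: "a \<in> X \<Longrightarrow> a \<curlywedge> zero = zero"
  by (metis closed join_comm join_zero meet_compl meet_join_distrib)

lemma join_one: "a \<in> X \<Longrightarrow> a \<curlyvee> one = one"
  by (metis closed meet_comm meet_one join_compl join_meet_distrib)

lemma meet_idem: "a \<in> X \<Longrightarrow> a \<curlywedge> a = a"
  by (metis closed join_compl join_zero meet_compl meet_join_distrib meet_one)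

lemma join_meet_absorb: "a \<in> X \<Longrightarrow> b \<in> X \<Longrightarrow> a \<curlyvee> (a \<curlywedge> b) = a"
  by (metis closed join_comm join_one meet_join_distrib meet_one)

definition proper_filter :: "'a set \<Rightarrow> bool" where
  "proper_filter F \<longleftrightarrow> F \<subseteq> X \<and> one \<in> F \<and> zero \<notin> F \<and>
     (\<forall>a \<in> F. \<forall>b \<in> F. a \<curlywedge> b \<in> F) \<and> (\<forall>a \<in> F. \<forall>b \<in> X. a \<curlyvee> b \<in> F)"

definition ultrafilter :: "'a set \<Rightarrow> bool" where
  "ultrafilter F \<longleftrightarrow> proper_filter F \<and> (\<forall>a \<in> X. a \<in> F \<or> compl a \<in> F)"

text \<open>
  The new filter consists of the elements above some \<open>f \<curlywedge> a\<close>.  It is proper because \<open>f \<curlywedge> a = zero\<close>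
  would put \<open>compl a\<close> above \<open>f\<close>.
\<close>

lemma proper_filter_adjoin:
  assumes F: "proper_filter F" and a: "a \<in> X" "compl a \<notin> F"
  shows "proper_filter {x \<in> X. \<exists>f \<in> F. x \<curlyvee> (f \<curlywedge> a) = x}" (is "proper_filter ?G")
proof -
  have FX: "f \<in> X" if "f \<in> F" for f using F that by (auto simp: proper_filter_def)
  have "zero \<notin> ?G"
  proof
    assume "zero \<in> ?G"
    then obtain f where f: "f \<in> F" "zero \<curlyvee> (f \<curlywedge> a) = zero" by auto
    then have fa: "f \<curlywedge> a = zero" by (metis FX a(1) closed join_comm join_zero)
    have "f \<curlyvee> compl a = (compl a \<curlyvee> f) \<curlywedge> (compl a \<curlyvee> a)"
      by (metis FX a(1) closed f(1) join_comm join_compl meet_one)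
    also have "\<dots> = compl a \<curlyvee> (f \<curlywedge> a)" by (metis FX a(1) closed f(1) join_meet_distrib)
    also have "\<dots> = compl a" by (simp add: fa join_zero closed a)
    finally show False using F f(1) a closed unfolding proper_filter_def by metis
  qed
  moreover have "x \<curlywedge> y \<in> ?G" if xy: "x \<in> ?G" "y \<in> ?G" for x y
  proof -
    obtain f g where fg: "f \<in> F" "g \<in> F" "x \<curlyvee> (f \<curlywedge> a) = x" "y \<curlyvee> (g \<curlywedge> a) = y"
      using xy by auto
    have X: "x \<in> X" "y \<in> X" "f \<in> X" "g \<in> X" using xy fg FX by auto
    define u v where "u = f \<curlywedge> a" and "v = g \<curlywedge> a"
    have uv: "u \<in> X" "v \<in> X" "x \<curlyvee> u = x" "y \<curlyvee> v = y" using X a fg closed by (auto simp: u_def v_def)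
    have "(f \<curlywedge> g) \<curlywedge> a = u \<curlywedge> v"
      unfolding u_def v_def by (metis X a(1) closed meet_assoc meet_comm meet_idem)
    moreover have "x \<curlyvee> (u \<curlywedge> v) = x"
      by (metis X(1) uv join_meet_distrib join_meet_absorb join_closed join_comm meet_comm
          join_assoc meet_closed)
    moreover have "y \<curlyvee> (u \<curlywedge> v) = y"
      by (metis X(2) uv join_meet_distrib join_meet_absorb join_closed join_comm meet_comm
          join_assoc meet_closed)
    ultimately have "(x \<curlywedge> y) \<curlyvee> ((f \<curlywedge> g) \<curlywedge> a) = x \<curlywedge> y"
      by (metis X(1,2) uv(1,2) closed join_comm join_meet_distrib)
    moreover have "f \<curlywedge> g \<in> F" using F fg by (auto simp: proper_filter_def)
    ultimately show ?thesis using X closed by auto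
  qed
  moreover have "x \<curlyvee> y \<in> ?G" if xy: "x \<in> ?G" "y \<in> X" for x y
  proof -
    obtain f where f: "f \<in> F" "x \<curlyvee> (f \<curlywedge> a) = x" using xy by auto
    then have "(x \<curlyvee> y) \<curlyvee> (f \<curlywedge> a) = x \<curlyvee> y"
      by (metis (mono_tags, lifting) FX a(1) closed join_assoc join_comm mem_Collect_eq xy)
    then show ?thesis using xy f closed by auto
  qed
  moreover have "one \<in> ?G"
    using F a by (auto simp: proper_filter_def closed intro!: bexI[of _ one])
      (metis closed join_comm join_one)
  ultimately show ?thesis by (auto simp: proper_filter_def)
qed

lemma adjoin_supset:
  assumes F: "proper_filter F" and a: "a \<in> X"
  shows "insert a F \<subseteq> {x \<in> X. \<exists>f \<in> F. x \<curlyvee> (f \<curlywedge> a) = x}"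
proof -
  have "f \<curlyvee> (f \<curlywedge> a) = f" "f \<in> X" if "f \<in> F" for f
    using F that a by (auto simp: proper_filter_def join_meet_absorb)
  moreover have "a \<curlyvee> (one \<curlywedge> a) = a"
    by (metis a join_meet_absorb meet_comm one_closed)
  ultimately show ?thesis using F a by (auto simp: proper_filter_def)
qed

text \<open>
  A maximal proper filter decides every element, for otherwise the element could be adjoined.
\<close>

lemma ultrafilter_extension:
  assumes "proper_filter G"
  shows "\<exists>F. ultrafilter F \<and> G \<subseteq> F"
proof -
  let ?A = "{F. proper_filter F \<and> G \<subseteq> F}"
  have "\<exists>M \<in> ?A. \<forall>F \<in> ?A. M \<subseteq> F \<longrightarrow> F = M"
  proof (rule subset_Zorn_nonempty)
    show "?A \<noteq> {}" using assms by blast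
    fix C assume C: "C \<noteq> {}" "subset.chain ?A C"
    have pf: "proper_filter F" "G \<subseteq> F" if "F \<in> C" for F using C that by (auto simp: subset.chain_def)
    have "a \<curlywedge> b \<in> \<Union>C" if ab: "a \<in> \<Union>C" "b \<in> \<Union>C" for a b
    proof -
      obtain F F' where F: "F \<in> C" "a \<in> F" "F' \<in> C" "b \<in> F'" using ab by blast
      then have "F \<subseteq> F' \<or> F' \<subseteq> F" using C by (meson subset.chain_def subset_chain_def)
      then obtain H where "H \<in> C" "a \<in> H" "b \<in> H" using F by blast
      then show ?thesis using pf unfolding proper_filter_def by blast
    qed
    then have "proper_filter (\<Union>C)"
      using C(1) pf unfolding proper_filter_def by (intro conjI) blast+
    then show "\<Union>C \<in> ?A" using C(1) pf by blast
  qed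
  then obtain M where M: "proper_filter M" "G \<subseteq> M"
    and max: "\<And>F. proper_filter F \<Longrightarrow> G \<subseteq> F \<Longrightarrow> M \<subseteq> F \<Longrightarrow> F = M" by auto
  have "a \<in> M \<or> compl a \<in> M" if "a \<in> X" for a
  proof (rule ccontr)
    assume undecided: "\<not> ?thesis"
    let ?M' = "{x \<in> X. \<exists>f \<in> M. x \<curlyvee> (f \<curlywedge> a) = x}"
    have "insert a M \<subseteq> ?M'" using adjoin_supset[OF M(1) that] .
    moreover have "proper_filter ?M'"
      using proper_filter_adjoin[OF M(1) that] undecided by simp
    ultimately have "?M' = M" using max[of ?M'] M(2) by (meson insert_subset subset_trans)
    then show False using \<open>insert a M \<subseteq> ?M'\<close> undecided by (metis insert_subset)
  qed
  then show ?thesis using M by (auto simp: ultrafilter_def)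
qed

context
  fixes F assumes F: "ultrafilter F"
begin

lemma ultrafilter_meet: "a \<in> X \<Longrightarrow> b \<in> X \<Longrightarrow> a \<curlywedge> b \<in> F \<longleftrightarrow> a \<in> F \<and> b \<in> F"
proof -
  assume ab: "a \<in> X" "b \<in> X"
  have up: "x \<curlyvee> y \<in> F" if "x \<in> F" "y \<in> X" for x y
    using F that by (simp add: ultrafilter_def proper_filter_def)
  have "(a \<curlywedge> b) \<curlyvee> a = a" "(a \<curlywedge> b) \<curlyvee> b = b"
    using ab join_meet_absorb[of a b] join_meet_absorb[of b a]
    by (simp_all add: join_comm meet_comm closed)
  then have "a \<in> F \<and> b \<in> F" if "a \<curlywedge> b \<in> F" using up that ab by metis
  then show ?thesis using F by (auto simp: ultrafilter_def proper_filter_def)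
qed

lemma ultrafilter_compl: "a \<in> X \<Longrightarrow> compl a \<in> F \<longleftrightarrow> a \<notin> F"
proof -
  assume a: "a \<in> X"
  have "zero \<notin> F" using F by (simp add: ultrafilter_def proper_filter_def)
  then have "\<not> (a \<in> F \<and> compl a \<in> F)"
    using ultrafilter_meet[of a "compl a"] a by (simp add: closed meet_compl)
  then show ?thesis using F a by (auto simp: ultrafilter_def)
qed

lemma ultrafilter_join: "a \<in> X \<Longrightarrow> b \<in> X \<Longrightarrow> a \<curlyvee> b \<in> F \<longleftrightarrow> a \<in> F \<or> b \<in> F"
proof -
  assume ab: "a \<in> X" "b \<in> X"
  have "compl a \<curlywedge> (a \<curlyvee> b) = compl a \<curlywedge> b"
    by (metis ab closed join_comm join_zero meet_comm meet_compl meet_join_distrib)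
  then have "b \<in> F" if "a \<curlyvee> b \<in> F" "a \<notin> F"
    using that ab ultrafilter_meet ultrafilter_compl closed by metis
  then show ?thesis using F ab join_comm unfolding ultrafilter_def proper_filter_def by metis
qed

end

text \<open>
  Stone duality, with the complement taken in the whole type of sets of elements, so that
  Boolean reasoning in the image is plain set theory: sets that are not ultrafilters stand for one
  arbitrary ultrafilter.  Compactness makes every filter of the image meet in a point.
\<close>

lemma stone_representation:
  assumes "zero \<noteq> one"
  shows "\<exists>st :: 'a \<Rightarrow> 'a set set. inj_on st X \<and>
    (\<forall>a \<in> X. \<forall>b \<in> X. st (a \<curlyvee> b) = st a \<union> st b \<and> st (a \<curlywedge> b) = st a \<inter> st b) \<and>
    (\<forall>a \<in> X. st (compl a) = - st a) \<and> st zero = {} \<and> st one = UNIV \<and>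
    (\<forall>K \<subseteq> st ` X. (\<forall>T \<subseteq> K. finite T \<longrightarrow> \<Inter>T \<noteq> {}) \<longrightarrow> \<Inter>K \<noteq> {})"
proof -
  have "proper_filter {one}" "proper_filter {one}"
    using assms by (auto simp: proper_filter_def closed meet_one join_one join_comm[of one])
  then obtain F0 where F0: "ultrafilter F0" using ultrafilter_extension by blast
  define pt where "pt F = (if ultrafilter F then F else F0)" for F
  define st where "st a = {F. a \<in> pt F}" for a
  have pt: "ultrafilter (pt F)" for F using F0 by (simp add: pt_def)
  have join: "st (a \<curlyvee> b) = st a \<union> st b" and meet: "st (a \<curlywedge> b) = st a \<inter> st b"
    and cmp: "st (compl a) = - st a" if "a \<in> X" "b \<in> X" for a b
    using pt that by (auto simp: st_def ultrafilter_join ultrafilter_meet ultrafilter_compl)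
  have "zero \<notin> F" "one \<in> F" if "ultrafilter F" for F
    using that by (auto simp: ultrafilter_def proper_filter_def)
  then have zero: "st zero = {}" and one: "st one = UNIV" using pt by (auto simp: st_def)
  have nonempty: "st a \<noteq> {}" if a: "a \<in> X" "a \<noteq> zero" for a
  proof -
    have "one \<noteq> compl a"
      using a by (metis compl_closed meet_compl meet_one)
    then have "compl a \<notin> {one}" by simp
    then have "proper_filter {x \<in> X. \<exists>f \<in> {one}. x \<curlyvee> (f \<curlywedge> a) = x}"
      using \<open>proper_filter {one}\<close> a proper_filter_adjoin by blast
    then obtain F where F: "ultrafilter F" "{x \<in> X. \<exists>f \<in> {one}. x \<curlyvee> (f \<curlywedge> a) = x} \<subseteq> F"
      using ultrafilter_extension by blast
    then have "a \<in> F" using adjoin_supset[OF \<open>proper_filter {one}\<close> a(1)] by blast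
    then show ?thesis using F(1) by (auto simp: st_def pt_def)
  qed
  have "inj_on st X"
  proof
    fix a b assume ab: "a \<in> X" "b \<in> X" "st a = st b"
    then have "st (a \<curlywedge> compl b) = {}" "st (b \<curlywedge> compl a) = {}"
      using meet cmp closed by auto
    then have z: "a \<curlywedge> compl b = zero" "b \<curlywedge> compl a = zero"
      using nonempty ab closed by metis+
    have "a = a \<curlywedge> (b \<curlyvee> compl b)" using ab by (simp add: join_compl meet_one)
    also have "\<dots> = b \<curlywedge> (a \<curlyvee> compl a)"
      using ab z by (simp add: meet_join_distrib closed join_zero meet_comm)
    finally show "a = b" using ab by (simp add: join_compl meet_one)
  qed
  moreover have "\<Inter>K \<noteq> {}" if K: "K \<subseteq> st ` X" and fip: "\<And>T. T \<subseteq> K \<Longrightarrow> finite T \<Longrightarrow> \<Inter>T \<noteq> {}" for K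
  proof -
    let ?G = "{a \<in> X. \<exists>T \<subseteq> K. finite T \<and> \<Inter>T \<subseteq> st a}"
    have "a \<curlywedge> b \<in> ?G" if ab: "a \<in> ?G" "b \<in> ?G" for a b
    proof -
      obtain S where S: "S \<subseteq> K" "finite S" "\<Inter>S \<subseteq> st a" using ab(1) by auto
      obtain T where T: "T \<subseteq> K" "finite T" "\<Inter>T \<subseteq> st b" using ab(2) by auto
      have "S \<union> T \<subseteq> K" "finite (S \<union> T)" "\<Inter>(S \<union> T) \<subseteq> st (a \<curlywedge> b)"
        using S T ab meet by auto
      then show ?thesis using ab closed by blast
    qed
    moreover have "a \<curlyvee> b \<in> ?G" if ab: "a \<in> ?G" "b \<in> X" for a b
    proof -
      obtain S where S: "S \<subseteq> K" "finite S" "\<Inter>S \<subseteq> st a" using ab(1) by auto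
      then have "\<Inter>S \<subseteq> st (a \<curlyvee> b)" using ab join by auto
      then show ?thesis using S ab closed by blast
    qed
    moreover have "one \<in> ?G" using one closed by auto
    moreover have "zero \<notin> ?G" using zero fip by auto
    ultimately have "proper_filter ?G" by (simp add: proper_filter_def)
    then obtain F where F: "ultrafilter F" "?G \<subseteq> F" using ultrafilter_extension by blast
    have "F \<in> k" if k: "k \<in> K" for k
    proof -
      obtain a where a: "a \<in> X" "k = st a" using K k by blast
      then have "a \<in> ?G" using k by (auto intro!: exI[of _ "{k}"])
      then show ?thesis using F a by (auto simp: st_def pt_def)
    qed
    then show ?thesis by blast
  qed
  ultimately show ?thesis
    using join meet cmp zero one by (intro exI[of _ st] conjI ballI allI impI) auto
qed

end

text \<open>Limits in infinite dimension are taken along ultrafilters of a power set.\<close>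

lemma powerset_boolean_algebra: "boolean_algebra_on UNIV (\<union>) (\<inter>) uminus {} UNIV"
  by unfold_locales auto

section \<open>Cylindric fields of sets\<close>

text \<open>
  The Boolean elements of an algebra form, via their Stone space, a field of sets that carries
  abstract cylindrifications and diagonals.  The last axiom says that \<open>b \<mapsto> cyl \<kappa> (diag \<kappa> \<mu> \<inter> b)\<close>, the
  substitution of \<open>\<mu>\<close> for \<open>\<kappa>\<close>, does not send a set and its complement to overlapping sets.
\<close>

locale cylindric_field =
  fixes \<alpha> :: "'i rel" and B :: "'p set set"
    and cyl :: "'i \<Rightarrow> 'p set \<Rightarrow> 'p set" and diag :: "'i \<Rightarrow> 'i \<Rightarrow> 'p set"
  assumes UNIV_in: "UNIV \<in> B"
    and Int_in: "a \<in> B \<Longrightarrow> b \<in> B \<Longrightarrow> a \<inter> b \<in> B"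
    and Compl_in: "a \<in> B \<Longrightarrow> - a \<in> B"
    and cyl_in: "\<kappa> \<in> Field \<alpha> \<Longrightarrow> a \<in> B \<Longrightarrow> cyl \<kappa> a \<in> B"
    and diag_in: "\<kappa> \<in> Field \<alpha> \<Longrightarrow> \<mu> \<in> Field \<alpha> \<Longrightarrow> diag \<kappa> \<mu> \<in> B"
    and cyl_empty: "\<kappa> \<in> Field \<alpha> \<Longrightarrow> cyl \<kappa> {} = {}"
    and cyl_increasing: "\<kappa> \<in> Field \<alpha> \<Longrightarrow> a \<in> B \<Longrightarrow> a \<subseteq> cyl \<kappa> a"
    and cyl_Int_cyl: "\<kappa> \<in> Field \<alpha> \<Longrightarrow> a \<in> B \<Longrightarrow> b \<in> B \<Longrightarrow> cyl \<kappa> (a \<inter> cyl \<kappa> b) = cyl \<kappa> a \<inter> cyl \<kappa> b"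
    and cyl_comm: "\<kappa> \<in> Field \<alpha> \<Longrightarrow> \<mu> \<in> Field \<alpha> \<Longrightarrow> a \<in> B \<Longrightarrow> cyl \<kappa> (cyl \<mu> a) = cyl \<mu> (cyl \<kappa> a)"
    and diag_refl: "\<kappa> \<in> Field \<alpha> \<Longrightarrow> diag \<kappa> \<kappa> = UNIV"
    and cyl_diag_Compl: "\<kappa> \<in> Field \<alpha> \<Longrightarrow> \<mu> \<in> Field \<alpha> \<Longrightarrow> \<kappa> \<noteq> \<mu> \<Longrightarrow> a \<in> B \<Longrightarrow>
      cyl \<kappa> (diag \<kappa> \<mu> \<inter> a) \<inter> cyl \<kappa> (diag \<kappa> \<mu> \<inter> - a) = {}"
begin

definition dims :: "'p set \<Rightarrow> 'i set" where
  "dims b = {\<kappa> \<in> Field \<alpha>. cyl \<kappa> b \<noteq> b}"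

lemma dims_subset: "dims b \<subseteq> Field \<alpha>"
  by (auto simp: dims_def)

lemma empty_in: "{} \<in> B"
  using Compl_in[OF UNIV_in] by simp

lemma Un_in: "a \<in> B \<Longrightarrow> b \<in> B \<Longrightarrow> a \<union> b \<in> B"
  using Compl_in[OF Int_in[OF Compl_in Compl_in], of a b] by simp

lemmas in_B = UNIV_in Int_in Compl_in cyl_in diag_in empty_in Un_in

lemma cyl_UNIV: "\<kappa> \<in> Field \<alpha> \<Longrightarrow> cyl \<kappa> UNIV = UNIV"
  using cyl_increasing[OF _ UNIV_in] by blast

lemma cyl_idem: "\<kappa> \<in> Field \<alpha> \<Longrightarrow> a \<in> B \<Longrightarrow> cyl \<kappa> (cyl \<kappa> a) = cyl \<kappa> a"
  using cyl_Int_cyl[OF _ UNIV_in, of \<kappa> a] by (simp add: cyl_UNIV)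

lemma cyl_Int_closed: "\<kappa> \<in> Field \<alpha> \<Longrightarrow> a \<in> B \<Longrightarrow> b \<in> B \<Longrightarrow> cyl \<kappa> b = b \<Longrightarrow> cyl \<kappa> (a \<inter> b) = cyl \<kappa> a \<inter> b"
  using cyl_Int_cyl[of \<kappa> a b] by simp

lemma cyl_mono: "\<kappa> \<in> Field \<alpha> \<Longrightarrow> a \<in> B \<Longrightarrow> b \<in> B \<Longrightarrow> a \<subseteq> b \<Longrightarrow> cyl \<kappa> a \<subseteq> cyl \<kappa> b"
  using cyl_Int_cyl[of \<kappa> a b] cyl_increasing[of \<kappa> b] by (metis inf.absorb1 inf.orderI subset_trans)

lemma closed_Compl: "\<kappa> \<in> Field \<alpha> \<Longrightarrow> b \<in> B \<Longrightarrow> cyl \<kappa> b = b \<Longrightarrow> cyl \<kappa> (- b) = - b"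
  using cyl_Int_closed[of \<kappa> "- b" b] cyl_increasing[of \<kappa> "- b"] by (auto simp: cyl_empty in_B)

lemma closed_Un:
  assumes "\<kappa> \<in> Field \<alpha>" "a \<in> B" "b \<in> B" "cyl \<kappa> a = a" "cyl \<kappa> b = b"
  shows "cyl \<kappa> (a \<union> b) = a \<union> b"
proof -
  have "cyl \<kappa> (- a \<inter> - b) = - a \<inter> - b"
    using assms by (simp add: cyl_Int_closed closed_Compl in_B)
  then show ?thesis
    using closed_Compl[of \<kappa> "- a \<inter> - b"] assms by (simp add: in_B)
qed

lemma cyl_Un:
  assumes "\<kappa> \<in> Field \<alpha>" "a \<in> B" "b \<in> B"
  shows "cyl \<kappa> (a \<union> b) = cyl \<kappa> a \<union> cyl \<kappa> b"
proof
  have "a \<subseteq> cyl \<kappa> a" "b \<subseteq> cyl \<kappa> b" using assms by (simp_all add: cyl_increasing)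
  then have "cyl \<kappa> (a \<union> b) \<subseteq> cyl \<kappa> (cyl \<kappa> a \<union> cyl \<kappa> b)"
    using assms by (intro cyl_mono in_B) auto
  then show "cyl \<kappa> (a \<union> b) \<subseteq> cyl \<kappa> a \<union> cyl \<kappa> b"
    using assms by (simp add: closed_Un cyl_idem in_B)
  show "cyl \<kappa> a \<union> cyl \<kappa> b \<subseteq> cyl \<kappa> (a \<union> b)"
    using assms cyl_mono[of \<kappa> a "a \<union> b"] cyl_mono[of \<kappa> b "a \<union> b"] by (auto simp: in_B)
qed

lemma dims_Compl: "b \<in> B \<Longrightarrow> dims (- b) = dims b"
  using closed_Compl[of _ b] closed_Compl[of _ "- b"] in_B by (auto simp: dims_def)

lemma dims_Int: "a \<in> B \<Longrightarrow> b \<in> B \<Longrightarrow> dims (a \<inter> b) \<subseteq> dims a \<union> dims b"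
  by (auto simp: dims_def cyl_Int_closed)

lemma dims_cyl: "\<kappa> \<in> Field \<alpha> \<Longrightarrow> b \<in> B \<Longrightarrow> dims (cyl \<kappa> b) \<subseteq> dims b - {\<kappa>}"
  by (auto simp: dims_def cyl_idem cyl_comm[of _ \<kappa>])

subsection \<open>Simultaneous cylindrification and substitution\<close>

text \<open>
  Cylindrification along a set of indices is defined as a closure, so that it does not depend on
  an enumeration of the set.
\<close>

definition Cyl :: "'i set \<Rightarrow> 'p set \<Rightarrow> 'p set" where
  "Cyl \<Gamma> b = \<Inter>{x \<in> B. b \<subseteq> x \<and> (\<forall>\<kappa> \<in> \<Gamma>. cyl \<kappa> x = x)}"

lemma Cyl_empty: "b \<in> B \<Longrightarrow> Cyl {} b = b"
  by (auto simp: Cyl_def)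

lemma Cyl_insert_aux:
  assumes "finite \<Gamma>" "\<Gamma> \<subseteq> Field \<alpha>" "b \<in> B"
  shows "Cyl \<Gamma> b \<in> B \<and> b \<subseteq> Cyl \<Gamma> b \<and> (\<forall>\<kappa> \<in> \<Gamma>. cyl \<kappa> (Cyl \<Gamma> b) = Cyl \<Gamma> b) \<and>
    (\<forall>\<kappa> \<in> Field \<alpha>. Cyl (insert \<kappa> \<Gamma>) b = cyl \<kappa> (Cyl \<Gamma> b))"
proof -
  have step: "Cyl (insert \<kappa> \<Delta>) b = cyl \<kappa> (Cyl \<Delta> b)" "cyl \<kappa> (Cyl \<Delta> b) \<in> B"
      "b \<subseteq> cyl \<kappa> (Cyl \<Delta> b)" "\<forall>\<mu> \<in> insert \<kappa> \<Delta>. cyl \<mu> (cyl \<kappa> (Cyl \<Delta> b)) = cyl \<kappa> (Cyl \<Delta> b)"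
    if IH: "Cyl \<Delta> b \<in> B" "b \<subseteq> Cyl \<Delta> b" "\<forall>\<kappa> \<in> \<Delta>. cyl \<kappa> (Cyl \<Delta> b) = Cyl \<Delta> b"
      and \<Delta>: "\<Delta> \<subseteq> Field \<alpha>" "\<kappa> \<in> Field \<alpha>" for \<Delta> \<kappa>
  proof -
    let ?c = "cyl \<kappa> (Cyl \<Delta> b)"
    show c: "?c \<in> B" and bc: "b \<subseteq> ?c" using IH \<Delta> cyl_increasing[of \<kappa> "Cyl \<Delta> b"] by (auto simp: cyl_in)
    show cl: "\<forall>\<mu> \<in> insert \<kappa> \<Delta>. cyl \<mu> ?c = ?c"
    proof
      fix \<mu> assume "\<mu> \<in> insert \<kappa> \<Delta>"
      then show "cyl \<mu> ?c = ?c"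
        using IH \<Delta> cyl_comm[of \<mu> \<kappa> "Cyl \<Delta> b"] cyl_idem by auto
    qed
    have "?c \<subseteq> x" if x: "x \<in> B" "b \<subseteq> x" "\<forall>\<mu> \<in> insert \<kappa> \<Delta>. cyl \<mu> x = x" for x
    proof -
      have "Cyl \<Delta> b \<subseteq> x" using x by (auto simp: Cyl_def)
      then show ?thesis using cyl_mono[of \<kappa> "Cyl \<Delta> b" x] x IH \<Delta> by auto
    qed
    then show "Cyl (insert \<kappa> \<Delta>) b = ?c" using c bc cl unfolding Cyl_def[of "insert \<kappa> \<Delta>"] by blast
  qed
  have "Cyl \<Gamma> b \<in> B \<and> b \<subseteq> Cyl \<Gamma> b \<and> (\<forall>\<kappa> \<in> \<Gamma>. cyl \<kappa> (Cyl \<Gamma> b) = Cyl \<Gamma> b)"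
    using assms(1,2)
  proof (induction rule: finite_induct)
    case empty
    then show ?case using assms(3) by (simp add: Cyl_empty)
  next
    case (insert \<kappa> \<Delta>)
    then show ?case using step[of \<Delta> \<kappa>] by simp
  qed
  then show ?thesis using step[of \<Gamma>] assms by blast
qed

lemma Cyl_in: "finite \<Gamma> \<Longrightarrow> \<Gamma> \<subseteq> Field \<alpha> \<Longrightarrow> b \<in> B \<Longrightarrow> Cyl \<Gamma> b \<in> B"
  and Cyl_increasing: "finite \<Gamma> \<Longrightarrow> \<Gamma> \<subseteq> Field \<alpha> \<Longrightarrow> b \<in> B \<Longrightarrow> b \<subseteq> Cyl \<Gamma> b"
  and Cyl_closed: "finite \<Gamma> \<Longrightarrow> \<Gamma> \<subseteq> Field \<alpha> \<Longrightarrow> b \<in> B \<Longrightarrow> \<kappa> \<in> \<Gamma> \<Longrightarrow> cyl \<kappa> (Cyl \<Gamma> b) = Cyl \<Gamma> b"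
  and Cyl_insert: "finite \<Gamma> \<Longrightarrow> \<Gamma> \<subseteq> Field \<alpha> \<Longrightarrow> b \<in> B \<Longrightarrow> \<kappa> \<in> Field \<alpha> \<Longrightarrow>
    Cyl (insert \<kappa> \<Gamma>) b = cyl \<kappa> (Cyl \<Gamma> b)"
  by (simp_all add: Cyl_insert_aux)

lemma Cyl_cyl_comm:
  assumes "finite \<Gamma>" "\<Gamma> \<subseteq> Field \<alpha>" "\<kappa> \<in> Field \<alpha>" "b \<in> B"
  shows "Cyl \<Gamma> (cyl \<kappa> b) = cyl \<kappa> (Cyl \<Gamma> b)"
  using assms(1,2)
proof (induction rule: finite_induct)
  case (insert \<mu> \<Gamma>)
  then have "cyl \<mu> (cyl \<kappa> (Cyl \<Gamma> b)) = cyl \<kappa> (cyl \<mu> (Cyl \<Gamma> b))"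
    using assms by (simp add: Cyl_in cyl_comm)
  then show ?case using insert assms by (simp add: Cyl_insert cyl_in)
qed (use assms in \<open>simp add: Cyl_empty cyl_in\<close>)

lemma Cyl_Int_closed:
  assumes "finite \<Gamma>" "\<Gamma> \<subseteq> Field \<alpha>" "x \<in> B" "b \<in> B" "\<And>\<kappa>. \<kappa> \<in> \<Gamma> \<Longrightarrow> cyl \<kappa> x = x"
  shows "Cyl \<Gamma> (x \<inter> b) = x \<inter> Cyl \<Gamma> b"
  using assms(1,2,5)
proof (induction rule: finite_induct)
  case (insert \<mu> \<Gamma>)
  then have "cyl \<mu> (x \<inter> Cyl \<Gamma> b) = x \<inter> cyl \<mu> (Cyl \<Gamma> b)"
    using assms(3,4) cyl_Int_closed[of \<mu> "Cyl \<Gamma> b" x] by (simp add: Cyl_in Int_commute)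
  then show ?case using insert assms(3,4) by (simp add: Cyl_insert in_B)
qed (use assms in \<open>simp add: Cyl_empty in_B\<close>)

subsection \<open>Set representations\<close>

text \<open>
  A homomorphism into the full cylindric set algebra (complement and intersection determine the
  other Boolean operations) whose values depend only on the dimension set of the argument.
\<close>

definition set_representation :: "'u set \<Rightarrow> ('p set \<Rightarrow> ('i \<Rightarrow> 'u) set) \<Rightarrow> bool" where
  "set_representation U h \<longleftrightarrow>
     (\<forall>b \<in> B. h b \<subseteq> seqs \<alpha> U \<and> h (- b) = seqs \<alpha> U - h b \<and> depends_on \<alpha> U (h b) (dims b) \<and>
       (\<forall>\<kappa> \<in> Field \<alpha>. h (cyl \<kappa> b) = {s \<in> seqs \<alpha> U. \<exists>x \<in> U. s(\<kappa> := x) \<in> h b})) \<and>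
     (\<forall>a \<in> B. \<forall>b \<in> B. h (a \<inter> b) = h a \<inter> h b) \<and>
     (\<forall>\<kappa> \<in> Field \<alpha>. \<forall>\<mu> \<in> Field \<alpha>. h (diag \<kappa> \<mu>) = {s \<in> seqs \<alpha> U. s \<kappa> = s \<mu>})"

lemma
  assumes "set_representation U h"
  shows set_representation_subset: "b \<in> B \<Longrightarrow> h b \<subseteq> seqs \<alpha> U"
    and set_representation_Compl: "b \<in> B \<Longrightarrow> h (- b) = seqs \<alpha> U - h b"
    and set_representation_depends: "b \<in> B \<Longrightarrow> depends_on \<alpha> U (h b) (dims b)"
    and set_representation_cyl: "\<kappa> \<in> Field \<alpha> \<Longrightarrow> b \<in> B \<Longrightarrow>
      h (cyl \<kappa> b) = {s \<in> seqs \<alpha> U. \<exists>x \<in> U. s(\<kappa> := x) \<in> h b}"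
    and set_representation_Int: "a \<in> B \<Longrightarrow> b \<in> B \<Longrightarrow> h (a \<inter> b) = h a \<inter> h b"
    and set_representation_diag: "\<kappa> \<in> Field \<alpha> \<Longrightarrow> \<mu> \<in> Field \<alpha> \<Longrightarrow>
      h (diag \<kappa> \<mu>) = {s \<in> seqs \<alpha> U. s \<kappa> = s \<mu>}"
  using assms by (simp_all add: set_representation_def)

end

locale cylindric_field_diag = cylindric_field \<alpha> B cyl diag
  for \<alpha> :: "'i rel" and B :: "'p set set"
    and cyl :: "'i \<Rightarrow> 'p set \<Rightarrow> 'p set" and diag :: "'i \<Rightarrow> 'i \<Rightarrow> 'p set" +
  assumes cyl_diag_diag: "\<kappa> \<in> Field \<alpha> \<Longrightarrow> \<mu> \<in> Field \<alpha> \<Longrightarrow> \<nu> \<in> Field \<alpha> \<Longrightarrow> \<kappa> \<noteq> \<mu> \<Longrightarrow> \<kappa> \<noteq> \<nu> \<Longrightarrow>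
      diag \<mu> \<nu> = cyl \<kappa> (diag \<mu> \<kappa> \<inter> diag \<kappa> \<nu>)"
begin

text \<open>
  The cylindrification of \<open>diag \<kappa> \<mu> \<inter> diag \<mu> \<kappa>\<close> along \<open>\<kappa>\<close> is everything, so the substitution axiom for
  the set \<open>diag \<mu> \<kappa>\<close> leaves no room for \<open>diag \<kappa> \<mu> \<inter> - diag \<mu> \<kappa>\<close>.
\<close>

lemma diag_sym:
  assumes "\<kappa> \<in> Field \<alpha>" "\<mu> \<in> Field \<alpha>"
  shows "diag \<kappa> \<mu> = diag \<mu> \<kappa>"
proof -
  have "diag \<kappa> \<mu> \<subseteq> diag \<mu> \<kappa>" if "\<kappa> \<in> Field \<alpha>" "\<mu> \<in> Field \<alpha>" "\<kappa> \<noteq> \<mu>" for \<kappa> \<mu>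
  proof -
    have "cyl \<kappa> (diag \<kappa> \<mu> \<inter> diag \<mu> \<kappa>) = UNIV"
      using cyl_diag_diag[of \<kappa> \<mu> \<mu>] that diag_refl[of \<mu>] by (simp add: Int_commute)
    then have "cyl \<kappa> (diag \<kappa> \<mu> \<inter> - diag \<mu> \<kappa>) = {}"
      using cyl_diag_Compl[of \<kappa> \<mu> "diag \<mu> \<kappa>"] that by (simp add: diag_in)
    then have "diag \<kappa> \<mu> \<inter> - diag \<mu> \<kappa> = {}"
      using cyl_increasing[of \<kappa> "diag \<kappa> \<mu> \<inter> - diag \<mu> \<kappa>"] that by (auto simp: in_B)
    then show ?thesis by blast
  qed
  then show ?thesis using assms by (cases "\<kappa> = \<mu>") blast+
qed

lemma diag_trans:
  assumes "\<kappa> \<in> Field \<alpha>" "\<mu> \<in> Field \<alpha>" "\<nu> \<in> Field \<alpha>"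
  shows "diag \<kappa> \<mu> \<inter> diag \<mu> \<nu> \<subseteq> diag \<kappa> \<nu>"
proof (cases "\<mu> = \<kappa> \<or> \<mu> = \<nu>")
  case False
  then show ?thesis
    using cyl_diag_diag[of \<mu> \<kappa> \<nu>] cyl_increasing[of \<mu> "diag \<kappa> \<mu> \<inter> diag \<mu> \<nu>"] assms
    by (auto simp: in_B)
qed auto

lemma cyl_diag: "\<kappa> \<in> Field \<alpha> \<Longrightarrow> \<mu> \<in> Field \<alpha> \<Longrightarrow> \<kappa> \<noteq> \<mu> \<Longrightarrow> cyl \<kappa> (diag \<kappa> \<mu>) = UNIV"
  using cyl_diag_diag[of \<kappa> \<mu> \<mu>] diag_sym[of \<kappa> \<mu>] diag_refl[of \<mu>] by simp

lemma cyl_diag_other: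
  assumes "\<kappa> \<in> Field \<alpha>" "\<mu> \<in> Field \<alpha>" "\<nu> \<in> Field \<alpha>" "\<kappa> \<noteq> \<mu>" "\<kappa> \<noteq> \<nu>"
  shows "cyl \<kappa> (diag \<mu> \<nu>) = diag \<mu> \<nu>"
  using cyl_diag_diag[of \<kappa> \<mu> \<nu>] assms cyl_idem[of \<kappa> "diag \<mu> \<kappa> \<inter> diag \<kappa> \<nu>"] by (simp add: in_B)

definition sub :: "'i \<Rightarrow> 'i \<Rightarrow> 'p set \<Rightarrow> 'p set" where
  "sub \<kappa> \<mu> b = cyl \<kappa> (diag \<kappa> \<mu> \<inter> b)"

context
  fixes \<kappa> \<mu> assumes \<kappa>\<mu>: "\<kappa> \<in> Field \<alpha>" "\<mu> \<in> Field \<alpha>" "\<kappa> \<noteq> \<mu>"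
begin

lemma sub_in: "b \<in> B \<Longrightarrow> sub \<kappa> \<mu> b \<in> B"
  using \<kappa>\<mu> by (simp add: sub_def in_B)

lemma sub_Compl:
  assumes "b \<in> B"
  shows "sub \<kappa> \<mu> (- b) = - sub \<kappa> \<mu> b"
proof -
  have "sub \<kappa> \<mu> (- b) \<union> sub \<kappa> \<mu> b = cyl \<kappa> ((diag \<kappa> \<mu> \<inter> - b) \<union> (diag \<kappa> \<mu> \<inter> b))"
    using \<kappa>\<mu> assms by (simp add: sub_def cyl_Un in_B)
  also have "(diag \<kappa> \<mu> \<inter> - b) \<union> (diag \<kappa> \<mu> \<inter> b) = diag \<kappa> \<mu>" by blast
  finally have "sub \<kappa> \<mu> (- b) \<union> sub \<kappa> \<mu> b = UNIV" using \<kappa>\<mu> by (simp add: cyl_diag)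
  moreover have "sub \<kappa> \<mu> b \<inter> sub \<kappa> \<mu> (- b) = {}"
    using \<kappa>\<mu> assms by (simp add: sub_def cyl_diag_Compl)
  ultimately show ?thesis by blast
qed

lemma sub_mono: "a \<in> B \<Longrightarrow> b \<in> B \<Longrightarrow> a \<subseteq> b \<Longrightarrow> sub \<kappa> \<mu> a \<subseteq> sub \<kappa> \<mu> b"
  using \<kappa>\<mu> unfolding sub_def by (intro cyl_mono) (auto simp: in_B)

lemma sub_Int:
  assumes "a \<in> B" "b \<in> B"
  shows "sub \<kappa> \<mu> (a \<inter> b) = sub \<kappa> \<mu> a \<inter> sub \<kappa> \<mu> b"
proof
  show "sub \<kappa> \<mu> (a \<inter> b) \<subseteq> sub \<kappa> \<mu> a \<inter> sub \<kappa> \<mu> b"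
    using assms by (simp add: sub_mono in_B)
  have "a \<subseteq> (a \<inter> b) \<union> - b" by blast
  then have "sub \<kappa> \<mu> a \<subseteq> sub \<kappa> \<mu> ((a \<inter> b) \<union> - b)" using assms by (simp add: sub_mono in_B)
  also have "\<dots> = sub \<kappa> \<mu> (a \<inter> b) \<union> - sub \<kappa> \<mu> b"
    using assms \<kappa>\<mu> sub_Compl[of b] by (simp add: sub_def Int_Un_distrib cyl_Un in_B)
  finally show "sub \<kappa> \<mu> a \<inter> sub \<kappa> \<mu> b \<subseteq> sub \<kappa> \<mu> (a \<inter> b)" by blast
qed

lemma sub_closed: "b \<in> B \<Longrightarrow> cyl \<kappa> b = b \<Longrightarrow> sub \<kappa> \<mu> b = b"
  using \<kappa>\<mu> by (simp add: sub_def cyl_Int_closed cyl_diag in_B)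

lemma cyl_sub_other:
  assumes "\<nu> \<in> Field \<alpha>" "\<nu> \<noteq> \<kappa>" "\<nu> \<noteq> \<mu>" "b \<in> B"
  shows "cyl \<nu> (sub \<kappa> \<mu> b) = sub \<kappa> \<mu> (cyl \<nu> b)"
  using assms \<kappa>\<mu> cyl_Int_closed[of \<nu> b "diag \<kappa> \<mu>"]
  by (simp add: sub_def cyl_comm[of \<nu> \<kappa>] cyl_diag_other in_B Int_commute)

text \<open>
  If \<open>b\<close> does not depend on \<open>\<mu>\<close>, then substituting the free index \<open>\<mu>\<close> for \<open>\<kappa>\<close> loses nothing that
  cylindrification along \<open>\<mu>\<close> cannot recover; this is what makes a fresh index a witness.
\<close>

lemma cyl_sub_fresh: "b \<in> B \<Longrightarrow> cyl \<mu> b = b \<Longrightarrow> cyl \<mu> (sub \<kappa> \<mu> b) = cyl \<kappa> b"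
  using \<kappa>\<mu> cyl_diag[of \<mu> \<kappa>] diag_sym[of \<kappa> \<mu>] cyl_Int_closed[of \<mu> "diag \<kappa> \<mu>" b]
  by (simp add: sub_def cyl_comm[of \<mu> \<kappa>] in_B)

lemma sub_subset_cyl: "b \<in> B \<Longrightarrow> sub \<kappa> \<mu> b \<subseteq> cyl \<kappa> b"
  using \<kappa>\<mu> unfolding sub_def by (intro cyl_mono) (auto simp: in_B)

end

lemma sub_diag:
  assumes "\<kappa> \<in> Field \<alpha>" "\<mu> \<in> Field \<alpha>" "\<nu> \<in> Field \<alpha>" "\<kappa> \<noteq> \<mu>" "\<kappa> \<noteq> \<nu>"
  shows "sub \<kappa> \<mu> (diag \<kappa> \<nu>) = diag \<mu> \<nu>"
  using cyl_diag_diag[of \<kappa> \<mu> \<nu>] assms diag_sym[of \<kappa> \<mu>] by (simp add: sub_def)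

lemma diag_Int_sub:
  assumes "\<kappa> \<in> Field \<alpha>" "\<mu> \<in> Field \<alpha>" "\<nu> \<in> Field \<alpha>" "\<kappa> \<noteq> \<mu>" "\<kappa> \<noteq> \<nu>" "b \<in> B"
  shows "diag \<mu> \<nu> \<inter> sub \<kappa> \<mu> b \<subseteq> sub \<kappa> \<nu> b"
proof -
  have "diag \<mu> \<nu> \<inter> sub \<kappa> \<mu> b = cyl \<kappa> (diag \<kappa> \<mu> \<inter> b \<inter> diag \<mu> \<nu>)"
    using assms cyl_Int_closed[of \<kappa> "diag \<kappa> \<mu> \<inter> b" "diag \<mu> \<nu>"]
    by (simp add: sub_def cyl_diag_other in_B Int_commute)
  also have "\<dots> \<subseteq> cyl \<kappa> (diag \<kappa> \<nu> \<inter> b)"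
    using assms diag_trans[of \<kappa> \<mu> \<nu>] by (intro cyl_mono) (auto simp: in_B)
  finally show ?thesis by (simp add: sub_def)
qed

text \<open>
  Simultaneous substitution of \<open>g \<kappa>\<close> for all \<open>\<kappa> \<in> \<Gamma>\<close>.  This formula is right when the new indices
  \<open>g \<kappa>\<close> lie outside \<open>\<Gamma>\<close>, and then it agrees with the substitutions carried out one after another in
  any order.
\<close>

definition Sub :: "'i set \<Rightarrow> ('i \<Rightarrow> 'i) \<Rightarrow> 'p set \<Rightarrow> 'p set" where
  "Sub \<Gamma> g b = Cyl \<Gamma> ((\<Inter>\<kappa>\<in>\<Gamma>. diag \<kappa> (g \<kappa>)) \<inter> b)"

definition apart :: "'i set \<Rightarrow> ('i \<Rightarrow> 'i) \<Rightarrow> bool" where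
  "apart \<Gamma> g \<longleftrightarrow> finite \<Gamma> \<and> \<Gamma> \<subseteq> Field \<alpha> \<and> g ` \<Gamma> \<subseteq> Field \<alpha> - \<Gamma>"

lemma Sub_cong: "(\<And>\<kappa>. \<kappa> \<in> \<Gamma> \<Longrightarrow> g \<kappa> = g' \<kappa>) \<Longrightarrow> Sub \<Gamma> g b = Sub \<Gamma> g' b"
  by (simp add: Sub_def)

lemma Sub_empty: "b \<in> B \<Longrightarrow> Sub {} g b = b"
  by (simp add: Sub_def Cyl_empty)

lemma INT_diag_in: "apart \<Gamma> g \<Longrightarrow> \<Delta> \<subseteq> \<Gamma> \<Longrightarrow> (\<Inter>\<kappa>\<in>\<Delta>. diag \<kappa> (g \<kappa>)) \<in> B"
proof -
  assume g: "apart \<Gamma> g" and \<Delta>: "\<Delta> \<subseteq> \<Gamma>"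
  then have "finite \<Delta>" by (auto simp: apart_def intro: finite_subset)
  then show ?thesis using \<Delta>
  proof (induction rule: finite_induct)
    case (insert \<kappa> \<Delta>)
    then have "diag \<kappa> (g \<kappa>) \<in> B" using g by (intro diag_in) (auto simp: apart_def)
    then show ?case using insert by (simp add: Int_in)
  qed (simp add: UNIV_in)
qed

lemma Sub_in: "apart \<Gamma> g \<Longrightarrow> b \<in> B \<Longrightarrow> Sub \<Gamma> g b \<in> B"
  using INT_diag_in[of \<Gamma> g \<Gamma>] by (auto simp: Sub_def apart_def intro!: Cyl_in Int_in)

lemma closed_INT_diag:
  assumes "apart \<Gamma> g" "\<Delta> \<subseteq> \<Gamma>" "\<mu> \<in> Field \<alpha>" "\<mu> \<notin> \<Delta>" "\<mu> \<notin> g ` \<Delta>"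
  shows "cyl \<mu> (\<Inter>\<kappa>\<in>\<Delta>. diag \<kappa> (g \<kappa>)) = (\<Inter>\<kappa>\<in>\<Delta>. diag \<kappa> (g \<kappa>))"
proof -
  have "finite \<Delta>" using assms by (auto simp: apart_def intro: finite_subset)
  then show ?thesis using assms(2,4,5)
  proof (induction rule: finite_induct)
    case (insert \<kappa> \<Delta>)
    let ?D = "\<Inter>\<kappa>\<in>\<Delta>. diag \<kappa> (g \<kappa>)"
    have "\<kappa> \<in> Field \<alpha>" "g \<kappa> \<in> Field \<alpha>" using insert.prems assms(1) by (auto simp: apart_def)
    then have "cyl \<mu> (diag \<kappa> (g \<kappa>)) = diag \<kappa> (g \<kappa>)" "diag \<kappa> (g \<kappa>) \<in> B"
      using insert.prems assms(3) by (simp_all add: cyl_diag_other diag_in)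
    moreover have "?D \<in> B" "cyl \<mu> ?D = ?D"
      using insert INT_diag_in[OF assms(1), of \<Delta>] by auto
    ultimately show ?case using assms(3) by (simp add: cyl_Int_closed)
  qed (simp add: cyl_UNIV assms(3))
qed

lemma apart_subset: "apart \<Gamma> g \<Longrightarrow> \<Delta> \<subseteq> \<Gamma> \<Longrightarrow> apart \<Delta> g"
  by (auto simp: apart_def intro: finite_subset)

lemma Sub_insert:
  assumes g: "apart (insert \<kappa> \<Gamma>) g" and \<kappa>: "\<kappa> \<notin> \<Gamma>" and b: "b \<in> B"
  shows "Sub (insert \<kappa> \<Gamma>) g b = sub \<kappa> (g \<kappa>) (Sub \<Gamma> g b)"
    and "Sub (insert \<kappa> \<Gamma>) g b = Sub \<Gamma> g (sub \<kappa> (g \<kappa>) b)"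
proof -
  let ?D = "\<Inter>\<kappa>\<in>\<Gamma>. diag \<kappa> (g \<kappa>)"
  have fin: "finite \<Gamma>" "\<Gamma> \<subseteq> Field \<alpha>" "\<kappa> \<in> Field \<alpha>" "g \<kappa> \<in> Field \<alpha>" "\<kappa> \<noteq> g \<kappa>" "\<kappa> \<notin> g ` \<Gamma>" "g \<kappa> \<notin> \<Gamma>"
    using g by (auto simp: apart_def)
  have D: "?D \<in> B" using INT_diag_in[OF g, of \<Gamma>] by blast
  have d: "diag \<kappa> (g \<kappa>) \<in> B" using fin by (simp add: diag_in)
  have eq: "Sub (insert \<kappa> \<Gamma>) g b = cyl \<kappa> (Cyl \<Gamma> (diag \<kappa> (g \<kappa>) \<inter> (?D \<inter> b)))"
    using fin D d b by (simp add: Sub_def Cyl_insert in_B Int_assoc)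
  also have "Cyl \<Gamma> (diag \<kappa> (g \<kappa>) \<inter> (?D \<inter> b)) = diag \<kappa> (g \<kappa>) \<inter> Cyl \<Gamma> (?D \<inter> b)"
  proof (rule Cyl_Int_closed)
    show "cyl \<mu> (diag \<kappa> (g \<kappa>)) = diag \<kappa> (g \<kappa>)" if "\<mu> \<in> \<Gamma>" for \<mu>
      using fin that \<kappa> by (intro cyl_diag_other) auto
  qed (use fin D d b in \<open>auto simp: in_B\<close>)
  finally show "Sub (insert \<kappa> \<Gamma>) g b = sub \<kappa> (g \<kappa>) (Sub \<Gamma> g b)" by (simp add: sub_def Sub_def)
  have "cyl \<kappa> ?D = ?D" using closed_INT_diag[OF g, of \<Gamma> \<kappa>] fin \<kappa> by auto
  then have "?D \<inter> sub \<kappa> (g \<kappa>) b = cyl \<kappa> (diag \<kappa> (g \<kappa>) \<inter> (?D \<inter> b))"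
    using cyl_Int_closed[of \<kappa> "diag \<kappa> (g \<kappa>) \<inter> b" ?D] fin D d b
    by (simp add: sub_def in_B Int_ac)
  then show "Sub (insert \<kappa> \<Gamma>) g b = Sub \<Gamma> g (sub \<kappa> (g \<kappa>) b)"
    using Cyl_cyl_comm[of \<Gamma> \<kappa> "diag \<kappa> (g \<kappa>) \<inter> (?D \<inter> b)"] fin D d b eq
    by (simp add: Sub_def[of \<Gamma>] in_B)
qed

lemma Sub_Compl_Int:
  assumes "apart \<Gamma> g" "a \<in> B" "b \<in> B"
  shows "Sub \<Gamma> g (- b) = - Sub \<Gamma> g b \<and> Sub \<Gamma> g (a \<inter> b) = Sub \<Gamma> g a \<inter> Sub \<Gamma> g b"
proof -
  have "finite \<Gamma>" using assms(1) by (simp add: apart_def)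
  then show ?thesis using assms(1)
  proof (induction rule: finite_induct)
    case (insert \<kappa> \<Gamma>)
    have ap: "apart \<Gamma> g" using apart_subset[OF insert.prems] by blast
    have "\<kappa> \<in> Field \<alpha>" "g \<kappa> \<in> Field \<alpha>" "\<kappa> \<noteq> g \<kappa>" using insert.prems by (auto simp: apart_def)
    then show ?case
      using insert ap assms(2,3) by (simp add: Sub_insert(1) Sub_in sub_Compl sub_Int in_B)
  qed (simp add: Sub_empty in_B assms)
qed

text \<open>
  By applying the substitution for an index in \<open>\<Delta>\<close> first, to \<open>b\<close> itself, one sees that it has no
  effect.  Hence \<open>Sub \<Gamma> g b\<close> is the same for all \<open>\<Gamma>\<close> that contain the dimension set, and sets with
  different dimension sets can be compared over a common \<open>\<Gamma>\<close>.
\<close>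

lemma Sub_superfluous:
  assumes "apart (\<Gamma> \<union> \<Delta>) g" "\<Gamma> \<inter> \<Delta> = {}" "b \<in> B" "\<And>\<kappa>. \<kappa> \<in> \<Delta> \<Longrightarrow> cyl \<kappa> b = b"
  shows "Sub (\<Gamma> \<union> \<Delta>) g b = Sub \<Gamma> g b"
proof -
  have "finite \<Delta>" using assms(1) by (simp add: apart_def)
  then show ?thesis using assms(1,2,4)
  proof (induction rule: finite_induct)
    case (insert \<kappa> \<Delta>)
    have ap: "apart (\<Gamma> \<union> \<Delta>) g" using apart_subset[OF insert.prems(1)] by auto
    have "\<kappa> \<in> Field \<alpha>" "g \<kappa> \<in> Field \<alpha>" "\<kappa> \<noteq> g \<kappa>" using insert.prems(1) by (auto simp: apart_def)
    then have "sub \<kappa> (g \<kappa>) b = b" using insert.prems assms(3) by (simp add: sub_closed)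
    moreover have "\<kappa> \<notin> \<Gamma> \<union> \<Delta>" using insert by auto
    ultimately have "Sub (\<Gamma> \<union> insert \<kappa> \<Delta>) g b = Sub (\<Gamma> \<union> \<Delta>) g b"
      using Sub_insert(2)[of \<kappa> "\<Gamma> \<union> \<Delta>" g b] insert.prems(1) assms(3) by simp
    then show ?case using insert ap by auto
  qed simp
qed

lemma Sub_dims:
  assumes "apart \<Gamma> g" "dims b \<subseteq> \<Gamma>" "b \<in> B"
  shows "Sub \<Gamma> g b = Sub (dims b) g b"
proof -
  have "\<Gamma> = dims b \<union> (\<Gamma> - dims b)" using assms by blast
  moreover have "cyl \<kappa> b = b" if "\<kappa> \<in> \<Gamma> - dims b" for \<kappa>
    using that assms by (auto simp: dims_def apart_def)
  ultimately show ?thesis using Sub_superfluous[of "dims b" "\<Gamma> - dims b" g b] assms by auto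
qed

lemma cyl_Sub:
  assumes "apart \<Gamma> g" "\<mu> \<in> Field \<alpha>" "\<mu> \<notin> \<Gamma>" "\<mu> \<notin> g ` \<Gamma>" "b \<in> B"
  shows "cyl \<mu> (Sub \<Gamma> g b) = Sub \<Gamma> g (cyl \<mu> b)"
proof -
  have "finite \<Gamma>" using assms(1) by (simp add: apart_def)
  then show ?thesis using assms(1,3,4)
  proof (induction rule: finite_induct)
    case (insert \<kappa> \<Gamma>)
    have ap: "apart \<Gamma> g" using apart_subset[OF insert.prems(1)] by blast
    have \<kappa>: "\<kappa> \<in> Field \<alpha>" "g \<kappa> \<in> Field \<alpha>" "\<kappa> \<noteq> g \<kappa>" using insert.prems(1) by (auto simp: apart_def)
    have "cyl \<mu> (sub \<kappa> (g \<kappa>) (Sub \<Gamma> g b)) = sub \<kappa> (g \<kappa>) (cyl \<mu> (Sub \<Gamma> g b))"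
      using \<kappa> insert.prems assms(2,5) ap by (intro cyl_sub_other) (auto intro!: Sub_in)
    then show ?case
      using insert ap assms(2,5) by (simp add: Sub_insert(1) cyl_in)
  qed (use assms in \<open>simp add: Sub_empty cyl_in\<close>)
qed

end

section \<open>Infinite dimension: limits of substitutions\<close>

locale infinite_cylindric_field = cylindric_field_diag \<alpha> B cyl diag
  for \<alpha> :: "'i rel" and B :: "'p set set"
    and cyl :: "'i \<Rightarrow> 'p set \<Rightarrow> 'p set" and diag :: "'i \<Rightarrow> 'i \<Rightarrow> 'p set" +
  assumes infinite_Field: "infinite (Field \<alpha>)"
    and finite_dims: "b \<in> B \<Longrightarrow> finite (dims b)"
begin

text \<open>
  A name is interpreted by an index.  An interpretation is only expected to behave well on a
  finite set \<open>\<Gamma>\<close> of names: it separates them and avoids a finite set \<open>\<Delta>\<close> of indices in use.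
\<close>

definition avoiding :: "'n set \<Rightarrow> 'i set \<Rightarrow> ('n \<Rightarrow> 'i) set" where
  "avoiding \<Gamma> \<Delta> = {\<rho>. inj_on \<rho> \<Gamma> \<and> \<rho> ` \<Gamma> \<subseteq> Field \<alpha> - \<Delta>}"

lemma avoiding_nonempty:
  assumes "finite \<Gamma>" "finite \<Delta>"
  shows "\<exists>\<rho>. \<rho> \<in> avoiding \<Gamma> \<Delta>"
proof -
  have "infinite (Field \<alpha> - \<Delta>)" using assms infinite_Field by simp
  then obtain S where S: "S \<subseteq> Field \<alpha> - \<Delta>" "finite S" "card S = card \<Gamma>"
    using infinite_arbitrarily_large by blast
  then obtain \<rho> where "bij_betw \<rho> \<Gamma> S" using assms(1) finite_same_card_bij by metis
  then show ?thesis using S by (auto simp: avoiding_def bij_betw_def)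
qed

lemma avoiding_antimono: "\<Gamma> \<subseteq> \<Gamma>' \<Longrightarrow> \<Delta> \<subseteq> \<Delta>' \<Longrightarrow> avoiding \<Gamma>' \<Delta>' \<subseteq> avoiding \<Gamma> \<Delta>"
  by (auto simp: avoiding_def intro: inj_on_subset)

lemma avoiding_apart:
  assumes "\<rho> \<in> avoiding N \<Delta>" "f ` \<Gamma> \<subseteq> N" "\<Gamma> \<subseteq> \<Delta>" "finite \<Gamma>" "\<Gamma> \<subseteq> Field \<alpha>"
  shows "apart \<Gamma> (\<rho> \<circ> f)"
proof -
  have "\<rho> (f \<kappa>) \<in> Field \<alpha> - \<Delta>" if "\<kappa> \<in> \<Gamma>" for \<kappa>
    using assms(1,2) that unfolding avoiding_def by blast
  then show ?thesis using assms(3-5) by (auto simp: apart_def)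
qed

lemma Sub_update:
  assumes "\<rho> \<in> avoiding N \<Delta>" "insert m (f ` \<Gamma>) \<subseteq> N" "insert \<kappa> \<Gamma> \<subseteq> \<Delta>" "finite \<Gamma>"
    "insert \<kappa> \<Gamma> \<subseteq> Field \<alpha>" "\<kappa> \<notin> \<Gamma>" "b \<in> B"
  shows "Sub (insert \<kappa> \<Gamma>) (\<rho> \<circ> f(\<kappa> := m)) b = sub \<kappa> (\<rho> m) (Sub \<Gamma> (\<rho> \<circ> f) b)"
proof -
  have "apart (insert \<kappa> \<Gamma>) (\<rho> \<circ> f(\<kappa> := m))"
    using assms by (intro avoiding_apart[of _ N \<Delta>]) auto
  moreover have "Sub \<Gamma> (\<rho> \<circ> f(\<kappa> := m)) b = Sub \<Gamma> (\<rho> \<circ> f) b"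
    using assms(6) by (intro Sub_cong) auto
  ultimately show ?thesis using assms(6,7) by (simp add: Sub_insert(1))
qed

end

subsection \<open>Witnesses\<close>

text \<open>
  A request \<open>(b, \<kappa>, f)\<close> asks for a name \<open>n\<close> that witnesses \<open>cyl \<kappa> b\<close> when the other indices in the
  dimension set of \<open>b\<close> are interpreted by the names \<open>f\<close>.  Each request has its own witness, whose
  level exceeds the levels of all names that the request mentions.
\<close>

locale henkin_names = infinite_cylindric_field \<alpha> B cyl diag
  for \<alpha> :: "'i rel" and B :: "'p set set"
    and cyl :: "'i \<Rightarrow> 'p set \<Rightarrow> 'p set" and diag :: "'i \<Rightarrow> 'i \<Rightarrow> 'p set" +
  fixes wit :: "'p set \<times> 'i \<times> ('i \<Rightarrow> 'n) \<Rightarrow> 'n" and level :: "'n \<Rightarrow> nat"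
    and requests :: "('p set \<times> 'i \<times> ('i \<Rightarrow> 'n)) set"
  assumes requests_def: "requests = {(b, \<kappa>, f). b \<in> B \<and> \<kappa> \<in> Field \<alpha> \<and> f \<in> extensional (dims b)}"
    and inj_wit: "inj_on wit requests"
    and level_wit: "(b, \<kappa>, f) \<in> requests \<Longrightarrow> \<mu> \<in> dims b \<Longrightarrow> level (f \<mu>) < level (wit (b, \<kappa>, f))"
begin

fun req_names :: "'p set \<times> 'i \<times> ('i \<Rightarrow> 'n) \<Rightarrow> 'n set" where
  "req_names (b, \<kappa>, f) = insert (wit (b, \<kappa>, f)) (f ` dims b)"

fun req_dims :: "'p set \<times> 'i \<times> ('i \<Rightarrow> 'n) \<Rightarrow> 'i set" where
  "req_dims (b, \<kappa>, f) = insert \<kappa> (dims b)"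

text \<open>
  The Henkin condition of a request under the interpretation \<open>\<rho>\<close>: if the cylindrification holds,
  then it holds at the index that interprets the witness.
\<close>

fun witnessed :: "('n \<Rightarrow> 'i) \<Rightarrow> 'p set \<times> 'i \<times> ('i \<Rightarrow> 'n) \<Rightarrow> 'p set" where
  "witnessed \<rho> (b, \<kappa>, f) =
    - cyl \<kappa> (Sub (dims b - {\<kappa>}) (\<rho> \<circ> f) b) \<union>
    sub \<kappa> (\<rho> (wit (b, \<kappa>, f))) (Sub (dims b - {\<kappa>}) (\<rho> \<circ> f) b)"

lemma request_facts:
  assumes r: "(b, \<kappa>, f) \<in> requests" and \<rho>: "\<rho> \<in> avoiding \<Gamma> \<Delta>"
    and sub: "req_names (b, \<kappa>, f) \<subseteq> \<Gamma>" "req_dims (b, \<kappa>, f) \<subseteq> \<Delta>"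
  defines "w \<equiv> \<rho> (wit (b, \<kappa>, f))" and "z \<equiv> Sub (dims b - {\<kappa>}) (\<rho> \<circ> f) b"
  shows "z \<in> B" "\<kappa> \<in> Field \<alpha>" "w \<in> Field \<alpha>" "\<kappa> \<noteq> w"
    "\<And>n. n \<in> \<Gamma> \<Longrightarrow> n \<notin> f ` dims b \<Longrightarrow> \<rho> n \<in> Field \<alpha> \<and> \<rho> n \<noteq> \<kappa> \<and> cyl (\<rho> n) z = z"
proof -
  have b: "b \<in> B" and \<kappa>: "\<kappa> \<in> Field \<alpha>" using r by (auto simp: requests_def)
  have ap: "apart (dims b - {\<kappa>}) (\<rho> \<circ> f)"
    using \<rho> sub finite_dims[OF b] dims_subset by (intro avoiding_apart[of _ \<Gamma> \<Delta>]) auto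
  show "z \<in> B" using ap b by (simp add: z_def Sub_in)
  show "\<kappa> \<in> Field \<alpha>" by (fact \<kappa>)
  show "w \<in> Field \<alpha>" "\<kappa> \<noteq> w" using sub \<rho> by (auto simp: avoiding_def w_def)
  fix n assume n: "n \<in> \<Gamma>" "n \<notin> f ` dims b"
  have fld: "\<rho> n \<in> Field \<alpha>" and out: "\<rho> n \<notin> insert \<kappa> (dims b)"
    using n \<rho> sub by (auto simp: avoiding_def)
  have "\<rho> n \<noteq> (\<rho> \<circ> f) \<mu>" if "\<mu> \<in> dims b" for \<mu>
  proof -
    have "f \<mu> \<in> \<Gamma>" "f \<mu> \<noteq> n" using that sub n by auto
    then show ?thesis using n(1) \<rho> by (auto simp: avoiding_def inj_on_def)
  qed
  then have "cyl (\<rho> n) z = Sub (dims b - {\<kappa>}) (\<rho> \<circ> f) (cyl (\<rho> n) b)"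
    unfolding z_def using ap fld out b by (intro cyl_Sub) auto
  also have "cyl (\<rho> n) b = b" using out fld by (auto simp: dims_def)
  finally have "cyl (\<rho> n) z = z" by (simp only: z_def)
  then show "\<rho> n \<in> Field \<alpha> \<and> \<rho> n \<noteq> \<kappa> \<and> cyl (\<rho> n) z = z" using fld out by simp
qed

text \<open>
  Finitely many requests are granted one by one in the order of their levels.  The witness of the
  request treated last is interpreted by an index on which neither \<open>a\<close> nor the earlier conditions
  depend; cylindrification along this index turns the new condition into the whole space and leaves
  their intersection as it is.
\<close>

lemma requests_consistent:
  assumes "finite T" "T \<subseteq> requests" and a: "a \<in> B" "a \<noteq> {}" and \<rho>: "\<rho> \<in> avoiding \<Gamma> \<Delta>"
    and dims: "dims a \<subseteq> \<Delta>" "\<And>r. r \<in> T \<Longrightarrow> req_names r \<subseteq> \<Gamma> \<and> req_dims r \<subseteq> \<Delta>"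
  shows "a \<inter> (\<Inter>r\<in>T. witnessed \<rho> r) \<noteq> {}"
proof -
  let ?Y = "\<lambda>T. a \<inter> (\<Inter>r\<in>T. witnessed \<rho> r)"
  have "?Y S \<in> B \<and> ?Y S \<noteq> {} \<and>
      (\<forall>n \<in> \<Gamma>. (\<forall>r \<in> S. n \<notin> req_names r) \<longrightarrow> cyl (\<rho> n) (?Y S) = ?Y S)" if "finite S" "S \<subseteq> T" for S
    using that
  proof (induction S rule: finite_ranking_induct[where f = "\<lambda>r. level (wit r)"])
    case empty
    have "\<rho> n \<in> Field \<alpha> - \<Delta>" if "n \<in> \<Gamma>" for n using that \<rho> by (auto simp: avoiding_def)
    then show ?case using a dims(1) by (auto simp: dims_def)
  next
    case (insert r S)
    show ?case
    proof (cases "r \<in> S")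
      case True
      then show ?thesis using insert by (simp add: insert_absorb)
    next
      case False
      obtain b \<kappa> f where r: "r = (b, \<kappa>, f)" by (cases r)
      have rT: "(b, \<kappa>, f) \<in> requests" "req_names (b, \<kappa>, f) \<subseteq> \<Gamma>" "req_dims (b, \<kappa>, f) \<subseteq> \<Delta>"
        using insert.prems assms(2) dims(2)[of r] r by auto
      note facts = request_facts[OF rT(1) \<rho> rT(2,3)]
      define w where "w = \<rho> (wit (b, \<kappa>, f))"
      define z where "z = Sub (dims b - {\<kappa>}) (\<rho> \<circ> f) b"
      have wr: "witnessed \<rho> r = - cyl \<kappa> z \<union> sub \<kappa> w z" by (simp add: r w_def z_def)
      have z: "z \<in> B" "\<kappa> \<in> Field \<alpha>" "w \<in> Field \<alpha>" "\<kappa> \<noteq> w" using facts(1-4) by (simp_all add: z_def w_def)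
      have sz: "sub \<kappa> w z \<in> B" using z by (simp add: sub_in)
      have wB: "witnessed \<rho> r \<in> B" using z sz by (simp add: wr in_B)
      have IH: "?Y S \<in> B" "?Y S \<noteq> {}"
        "\<And>n. n \<in> \<Gamma> \<Longrightarrow> (\<And>r. r \<in> S \<Longrightarrow> n \<notin> req_names r) \<Longrightarrow> cyl (\<rho> n) (?Y S) = ?Y S"
        using insert by auto
      have split: "?Y (insert r S) = witnessed \<rho> r \<inter> ?Y S" by blast
      have fresh: "wit r \<notin> req_names r'" if r': "r' \<in> S" for r'
      proof -
        obtain b' \<kappa>' f' where e: "r' = (b', \<kappa>', f')" by (cases r')
        have req: "r' \<in> requests" "r \<in> requests" using r' insert.prems assms(2) by auto
        have "wit r \<noteq> wit r'" using inj_wit req False r' by (auto simp: inj_on_def)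
        moreover have "wit r \<notin> f' ` dims b'"
        proof
          assume "wit r \<in> f' ` dims b'"
          then obtain \<mu> where "\<mu> \<in> dims b'" "wit r = f' \<mu>" by blast
          then have "level (wit r) < level (wit r')" using level_wit[of b' \<kappa>' f' \<mu>] req by (simp add: e)
          then show False using insert.hyps(2)[OF r'] by simp
        qed
        ultimately show ?thesis by (simp add: e)
      qed
      have w\<Gamma>: "wit r \<in> \<Gamma>" using rT(2) by (simp add: r)
      have "wit r \<notin> f ` dims b" using level_wit[OF rT(1)] by (force simp: r)
      then have wz: "cyl w z = z" using facts(5)[of "wit r"] w\<Gamma> by (simp add: w_def z_def r)
      then have "cyl w (witnessed \<rho> r) = UNIV"
        using z sz by (simp add: wr cyl_Un closed_Compl cyl_sub_fresh cyl_comm[of w \<kappa>] in_B)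
      moreover have "cyl w (?Y S) = ?Y S" using IH(3)[OF w\<Gamma> fresh] by (simp add: w_def r)
      ultimately have "cyl w (?Y (insert r S)) = ?Y S"
        unfolding split using cyl_Int_closed[of w "witnessed \<rho> r" "?Y S"] z(3) wB IH(1) by simp
      then have "?Y (insert r S) \<noteq> {}" using IH(2) z(3) cyl_empty by metis
      moreover have "?Y (insert r S) \<in> B" unfolding split using wB IH(1) by (rule Int_in)
      moreover have "cyl (\<rho> n) (?Y (insert r S)) = ?Y (insert r S)"
        if n: "n \<in> \<Gamma>" "\<forall>r' \<in> insert r S. n \<notin> req_names r'" for n
      proof -
        have "n \<noteq> wit r" "n \<notin> f ` dims b" using n by (auto simp: r)
        then have nz: "\<rho> n \<in> Field \<alpha>" "\<rho> n \<noteq> \<kappa>" "cyl (\<rho> n) z = z" "\<rho> n \<noteq> w"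
          using facts(5)[of n] n(1) w\<Gamma> \<rho> by (auto simp: z_def w_def r avoiding_def inj_on_def)
        then have "cyl (\<rho> n) (witnessed \<rho> r) = witnessed \<rho> r"
          using z sz by (simp add: wr cyl_Un closed_Compl cyl_sub_other cyl_comm[of "\<rho> n" \<kappa>] in_B)
        moreover have "cyl (\<rho> n) (?Y S) = ?Y S" using IH(3) n by blast
        ultimately show ?thesis
          unfolding split using cyl_Int_closed[of "\<rho> n" "witnessed \<rho> r" "?Y S"] nz(1) wB IH(1) by simp
      qed
      ultimately show ?thesis by blast
    qed
  qed
  then show ?thesis using assms(1) by blast
qed

text \<open>
  Only finitely many conditions matter for a proper filter, and these are met at a common pair of an
  interpretation and a point: choose an interpretation that is injective on all names and avoids all
  indices that the conditions mention.
\<close>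

lemma limit_exists:
  assumes a: "a \<in> B" "a \<noteq> {}"
  shows "\<exists>W :: (('n \<Rightarrow> 'i) \<times> 'p) set set. (\<forall>Y. - Y \<in> W \<longleftrightarrow> Y \<notin> W) \<and>
    (\<forall>Y Z. Y \<inter> Z \<in> W \<longleftrightarrow> Y \<in> W \<and> Z \<in> W) \<and>
    (\<forall>\<Gamma> \<Delta>. finite \<Gamma> \<longrightarrow> finite \<Delta> \<longrightarrow> avoiding \<Gamma> \<Delta> \<times> UNIV \<in> W) \<and> UNIV \<times> a \<in> W \<and>
    (\<forall>r \<in> requests. {(\<rho>, x). x \<in> witnessed \<rho> r} \<in> W)"
proof -
  interpret pw: boolean_algebra_on "UNIV :: (('n \<Rightarrow> 'i) \<times> 'p) set set" "(\<union>)" "(\<inter>)" uminus "{}" UNIV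
    by (rule powerset_boolean_algebra)
  define base where "base \<Gamma> \<Delta> T = {(\<rho>, x). \<rho> \<in> avoiding \<Gamma> \<Delta> \<and> x \<in> a \<inter> (\<Inter>r\<in>T. witnessed \<rho> r)}"
    for \<Gamma> \<Delta> T
  define G where "G = {Y. \<exists>\<Gamma> \<Delta> T. finite \<Gamma> \<and> finite \<Delta> \<and> finite T \<and> T \<subseteq> requests \<and> base \<Gamma> \<Delta> T \<subseteq> Y}"
  have G: "Y \<in> G" if "finite \<Gamma>" "finite \<Delta>" "finite T" "T \<subseteq> requests" "base \<Gamma> \<Delta> T \<subseteq> Y" for \<Gamma> \<Delta> T Y
    using that by (auto simp: G_def)
  have "base \<Gamma> \<Delta> T \<noteq> {}" if T: "finite \<Gamma>" "finite \<Delta>" "finite T" "T \<subseteq> requests" for \<Gamma> \<Delta> T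
  proof -
    let ?\<Gamma> = "\<Gamma> \<union> (\<Union>r\<in>T. req_names r)" and ?\<Delta> = "\<Delta> \<union> dims a \<union> (\<Union>r\<in>T. req_dims r)"
    have "finite (req_names r) \<and> finite (req_dims r)" if "r \<in> requests" for r
      using that finite_dims by (cases r) (simp add: requests_def)
    then have "finite (\<Union>r\<in>T. req_names r)" "finite (\<Union>r\<in>T. req_dims r)"
      using T(3,4) by (meson finite_UN_I subsetD)+
    then have fin: "finite ?\<Gamma>" "finite ?\<Delta>"
      using T(1,2) finite_dims[OF a(1)] by (blast intro: finite_UnI)+
    obtain \<rho> where \<rho>: "\<rho> \<in> avoiding ?\<Gamma> ?\<Delta>" using avoiding_nonempty[OF fin] ..
    have "a \<inter> (\<Inter>r\<in>T. witnessed \<rho> r) \<noteq> {}"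
      by (rule requests_consistent[OF T(3,4) a \<rho>]) auto
    moreover have "\<rho> \<in> avoiding \<Gamma> \<Delta>" using \<rho> avoiding_antimono[of \<Gamma> ?\<Gamma> \<Delta> ?\<Delta>] by (simp add: Un_assoc subset_iff)
    ultimately show ?thesis by (auto simp: base_def)
  qed
  then have "{} \<notin> G" by (fastforce simp: G_def)
  moreover have "Y \<inter> Z \<in> G" if YZ: "Y \<in> G" "Z \<in> G" for Y Z
  proof -
    obtain \<Gamma> \<Delta> T where 1: "finite \<Gamma>" "finite \<Delta>" "finite T" "T \<subseteq> requests" "base \<Gamma> \<Delta> T \<subseteq> Y"
      using YZ(1) by (auto simp: G_def)
    obtain \<Gamma>' \<Delta>' T' where 2: "finite \<Gamma>'" "finite \<Delta>'" "finite T'" "T' \<subseteq> requests" "base \<Gamma>' \<Delta>' T' \<subseteq> Z"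
      using YZ(2) by (auto simp: G_def)
    have "avoiding (\<Gamma> \<union> \<Gamma>') (\<Delta> \<union> \<Delta>') \<subseteq> avoiding \<Gamma> \<Delta> \<inter> avoiding \<Gamma>' \<Delta>'"
      by (auto simp: avoiding_def inj_on_def)
    then have "base (\<Gamma> \<union> \<Gamma>') (\<Delta> \<union> \<Delta>') (T \<union> T') \<subseteq> base \<Gamma> \<Delta> T \<inter> base \<Gamma>' \<Delta>' T'"
      by (auto simp: base_def)
    then show ?thesis
      using 1 2 by (intro G[of "\<Gamma> \<union> \<Gamma>'" "\<Delta> \<union> \<Delta>'" "T \<union> T'"]) auto
  qed
  moreover have "Y \<union> Z \<in> G" if "Y \<in> G" for Y Z
    using that unfolding G_def by (blast intro: le_supI1)
  moreover have "UNIV \<in> G" by (rule G[of "{}" "{}" "{}"]) auto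
  ultimately have "pw.proper_filter G" by (simp add: pw.proper_filter_def)
  then obtain W where W: "pw.ultrafilter W" "G \<subseteq> W" using pw.ultrafilter_extension by blast
  have "avoiding \<Gamma> \<Delta> \<times> UNIV \<in> G" if "finite \<Gamma>" "finite \<Delta>" for \<Gamma> \<Delta>
    using that by (intro G[of \<Gamma> \<Delta> "{}"]) (auto simp: base_def)
  moreover have "UNIV \<times> a \<in> G" by (rule G[of "{}" "{}" "{}"]) (auto simp: base_def)
  moreover have "{(\<rho>, x). x \<in> witnessed \<rho> r} \<in> G" if "r \<in> requests" for r
    using that by (intro G[of "{}" "{}" "{r}"]) (auto simp: base_def)
  ultimately show ?thesis
    using W pw.ultrafilter_compl[OF W(1)] pw.ultrafilter_meet[OF W(1)]
    by (intro exI[of _ W] conjI allI impI ballI) auto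
qed

end

subsection \<open>Truth in the limit\<close>

locale henkin_limit = henkin_names \<alpha> B cyl diag wit level requests
  for \<alpha> :: "'i rel" and B :: "'p set set"
    and cyl :: "'i \<Rightarrow> 'p set \<Rightarrow> 'p set" and diag :: "'i \<Rightarrow> 'i \<Rightarrow> 'p set"
    and wit :: "'p set \<times> 'i \<times> ('i \<Rightarrow> 'n) \<Rightarrow> 'n" and level :: "'n \<Rightarrow> nat"
    and requests :: "('p set \<times> 'i \<times> ('i \<Rightarrow> 'n)) set" +
  fixes a :: "'p set" and W :: "(('n \<Rightarrow> 'i) \<times> 'p) set set"
  assumes a_in: "a \<in> B"
    and W_Compl: "- Y \<in> W \<longleftrightarrow> Y \<notin> W"
    and W_Int: "Y \<inter> Z \<in> W \<longleftrightarrow> Y \<in> W \<and> Z \<in> W"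
    and W_avoiding: "finite \<Gamma> \<Longrightarrow> finite \<Delta> \<Longrightarrow> avoiding \<Gamma> \<Delta> \<times> UNIV \<in> W"
    and W_a: "UNIV \<times> a \<in> W"
    and W_witnessed: "r \<in> requests \<Longrightarrow> {(\<rho>, x). x \<in> witnessed \<rho> r} \<in> W"
begin

text \<open>
  Truth of \<open>b\<close> when every index \<open>\<kappa>\<close> is assigned the name \<open>f \<kappa>\<close>: at almost all pairs the point
  belongs to the result of substituting the interpretations of the names in \<open>b\<close>.
\<close>

definition holds :: "'p set \<Rightarrow> ('i \<Rightarrow> 'n) \<Rightarrow> bool" where
  "holds b f \<longleftrightarrow> {(\<rho>, x). x \<in> Sub (dims b) (\<rho> \<circ> f) b} \<in> W"

definition same :: "'n \<Rightarrow> 'n \<Rightarrow> bool" where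
  "same m n \<longleftrightarrow> {(\<rho>, x). x \<in> diag (\<rho> m) (\<rho> n)} \<in> W"

text \<open>
  Almost all interpretations map a given finite set of names injectively to indices outside a given
  finite set, so inclusions need to be checked for such interpretations only.
\<close>

lemma W_mono:
  assumes "Y \<in> W" "finite \<Gamma>" "finite \<Delta>"
    and "\<And>\<rho> x. \<rho> \<in> avoiding \<Gamma> \<Delta> \<Longrightarrow> (\<rho>, x) \<in> Y \<Longrightarrow> (\<rho>, x) \<in> Z"
  shows "Z \<in> W"
proof -
  have "Y \<inter> (avoiding \<Gamma> \<Delta> \<times> UNIV) \<in> W" using assms(1-3) W_avoiding W_Int by blast
  moreover have "Y \<inter> (avoiding \<Gamma> \<Delta> \<times> UNIV) = (Y \<inter> (avoiding \<Gamma> \<Delta> \<times> UNIV)) \<inter> Z"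
    using assms(4) by auto
  ultimately show ?thesis using W_Int by metis
qed

lemma W_cong:
  assumes "finite \<Gamma>" "finite \<Delta>"
    and "\<And>\<rho>. \<rho> \<in> avoiding \<Gamma> \<Delta> \<Longrightarrow> P \<rho> = Q \<rho>"
  shows "{(\<rho>, x). x \<in> P \<rho>} \<in> W \<longleftrightarrow> {(\<rho>, x). x \<in> Q \<rho>} \<in> W"
  using W_mono[of _ \<Gamma> \<Delta>] assms by (metis (mono_tags, lifting) case_prodD case_prodI mem_Collect_eq)

lemma holds_Sub:
  assumes "finite \<Gamma>" "\<Gamma> \<subseteq> Field \<alpha>" "dims b \<subseteq> \<Gamma>" "b \<in> B"
  shows "holds b f \<longleftrightarrow> {(\<rho>, x). x \<in> Sub \<Gamma> (\<rho> \<circ> f) b} \<in> W"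
  unfolding holds_def
proof (rule W_cong[of "f ` \<Gamma>" \<Gamma>])
  fix \<rho> :: "'n \<Rightarrow> 'i" assume \<rho>: "\<rho> \<in> avoiding (f ` \<Gamma>) \<Gamma>"
  have "apart \<Gamma> (\<rho> \<circ> f)" using assms by (intro avoiding_apart[OF \<rho>]) auto
  then show "Sub (dims b) (\<rho> \<circ> f) b = Sub \<Gamma> (\<rho> \<circ> f) b" using Sub_dims assms by metis
qed (use assms in auto)

lemma holds_local: "(\<And>\<kappa>. \<kappa> \<in> dims b \<Longrightarrow> f \<kappa> = f' \<kappa>) \<Longrightarrow> holds b f \<longleftrightarrow> holds b f'"
  using Sub_cong[of "dims b" "_ \<circ> f" "_ \<circ> f'" b] unfolding holds_def by simp

lemma holds_Compl:
  assumes b: "b \<in> B"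
  shows "holds (- b) f \<longleftrightarrow> \<not> holds b f"
proof -
  have "holds (- b) f \<longleftrightarrow> {(\<rho>, x). x \<in> - Sub (dims b) (\<rho> \<circ> f) b} \<in> W"
    unfolding holds_def dims_Compl[OF b]
  proof (rule W_cong[of "f ` dims b" "dims b"])
    fix \<rho> :: "'n \<Rightarrow> 'i" assume \<rho>: "\<rho> \<in> avoiding (f ` dims b) (dims b)"
    have "apart (dims b) (\<rho> \<circ> f)"
      using finite_dims[OF b] dims_subset by (intro avoiding_apart[OF \<rho>]) auto
    then show "Sub (dims b) (\<rho> \<circ> f) (- b) = - Sub (dims b) (\<rho> \<circ> f) b"
      using Sub_Compl_Int b by blast
  qed (use finite_dims[OF b] in auto)
  also have "{(\<rho>, x). x \<in> - Sub (dims b) (\<rho> \<circ> f) b} = - {(\<rho>, x). x \<in> Sub (dims b) (\<rho> \<circ> f) b}"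
    by auto
  finally show ?thesis by (simp add: W_Compl holds_def)
qed

lemma holds_Int:
  assumes ab: "b \<in> B" "c \<in> B"
  shows "holds (b \<inter> c) f \<longleftrightarrow> holds b f \<and> holds c f"
proof -
  let ?\<Gamma> = "dims b \<union> dims c"
  have \<Gamma>: "finite ?\<Gamma>" "?\<Gamma> \<subseteq> Field \<alpha>" using finite_dims ab dims_subset by auto
  have "holds (b \<inter> c) f \<longleftrightarrow> {(\<rho>, x). x \<in> Sub ?\<Gamma> (\<rho> \<circ> f) (b \<inter> c)} \<in> W"
    using \<Gamma> ab dims_Int[of b c] by (intro holds_Sub) (auto simp: Int_in)
  also have "\<dots> \<longleftrightarrow> {(\<rho>, x). x \<in> Sub ?\<Gamma> (\<rho> \<circ> f) b \<inter> Sub ?\<Gamma> (\<rho> \<circ> f) c} \<in> W"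
  proof (rule W_cong[of "f ` ?\<Gamma>" ?\<Gamma>])
    fix \<rho> :: "'n \<Rightarrow> 'i" assume \<rho>: "\<rho> \<in> avoiding (f ` ?\<Gamma>) ?\<Gamma>"
    have "apart ?\<Gamma> (\<rho> \<circ> f)" using \<Gamma> by (intro avoiding_apart[OF \<rho>]) auto
    then show "Sub ?\<Gamma> (\<rho> \<circ> f) (b \<inter> c) = Sub ?\<Gamma> (\<rho> \<circ> f) b \<inter> Sub ?\<Gamma> (\<rho> \<circ> f) c"
      using Sub_Compl_Int ab by blast
  qed (use \<Gamma> in auto)
  also have "{(\<rho>, x). x \<in> Sub ?\<Gamma> (\<rho> \<circ> f) b \<inter> Sub ?\<Gamma> (\<rho> \<circ> f) c} =
      {(\<rho>, x). x \<in> Sub ?\<Gamma> (\<rho> \<circ> f) b} \<inter> {(\<rho>, x). x \<in> Sub ?\<Gamma> (\<rho> \<circ> f) c}" by auto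
  finally show ?thesis using holds_Sub[OF \<Gamma>] ab by (simp add: W_Int)
qed

lemma UNIV_in_W: "UNIV \<in> W"
  using W_mono[OF W_a, of "{}" "{}"] by simp

lemma holds_diag:
  assumes "\<kappa> \<in> Field \<alpha>" "\<mu> \<in> Field \<alpha>"
  shows "holds (diag \<kappa> \<mu>) f \<longleftrightarrow> same (f \<kappa>) (f \<mu>)"
proof (cases "\<kappa> = \<mu>")
  case True
  have "dims UNIV = {}" by (auto simp: dims_def cyl_UNIV)
  then have "holds (diag \<kappa> \<mu>) f"
    using True assms by (simp add: holds_def diag_refl Sub_empty UNIV_in UNIV_in_W)
  moreover have "same (f \<kappa>) (f \<mu>)"
    unfolding same_def using True
    by (intro W_mono[OF UNIV_in_W, of "{f \<kappa>}" "{}"]) (auto simp: avoiding_def diag_refl)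
  ultimately show ?thesis by simp
next
  case False
  have "dims (diag \<kappa> \<mu>) \<subseteq> {\<kappa>, \<mu>}" using assms by (auto simp: dims_def cyl_diag_other)
  then have "holds (diag \<kappa> \<mu>) f \<longleftrightarrow> {(\<rho>, x). x \<in> Sub {\<kappa>, \<mu>} (\<rho> \<circ> f) (diag \<kappa> \<mu>)} \<in> W"
    using assms by (intro holds_Sub) (auto simp: diag_in)
  also have "\<dots> \<longleftrightarrow> {(\<rho>, x). x \<in> diag (\<rho> (f \<kappa>)) (\<rho> (f \<mu>))} \<in> W"
  proof (rule W_cong[of "{f \<kappa>, f \<mu>}" "{\<kappa>, \<mu>}"])
    fix \<rho> :: "'n \<Rightarrow> 'i" assume \<rho>: "\<rho> \<in> avoiding {f \<kappa>, f \<mu>} {\<kappa>, \<mu>}"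
    define g where "g = \<rho> \<circ> f"
    have ap: "apart {\<kappa>, \<mu>} g" unfolding g_def using assms \<rho> by (intro avoiding_apart[OF \<rho>]) auto
    then have g: "g \<kappa> \<in> Field \<alpha>" "g \<mu> \<in> Field \<alpha>" "g \<kappa> \<noteq> \<kappa>" "g \<mu> \<noteq> \<kappa>" "g \<mu> \<noteq> \<mu>" by (auto simp: apart_def)
    have "Sub {\<kappa>, \<mu>} g (diag \<kappa> \<mu>) = sub \<kappa> (g \<kappa>) (Sub {\<mu>} g (diag \<kappa> \<mu>))"
      using Sub_insert(1)[OF ap] False assms by (simp add: diag_in)
    also have "Sub {\<mu>} g (diag \<kappa> \<mu>) = sub \<mu> (g \<mu>) (diag \<mu> \<kappa>)"
      using Sub_insert(1)[of \<mu> "{}" g "diag \<mu> \<kappa>"] apart_subset[OF ap, of "{\<mu>}"] assms diag_sym[of \<kappa> \<mu>]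
      by (simp add: diag_in Sub_empty)
    also have "\<dots> = diag \<kappa> (g \<mu>)" using assms g False diag_sym[of "g \<mu>" \<kappa>] by (simp add: sub_diag)
    also have "sub \<kappa> (g \<kappa>) (diag \<kappa> (g \<mu>)) = diag (g \<kappa>) (g \<mu>)" using assms g by (simp add: sub_diag)
    finally show "Sub {\<kappa>, \<mu>} (\<rho> \<circ> f) (diag \<kappa> \<mu>) = diag (\<rho> (f \<kappa>)) (\<rho> (f \<mu>))"
      by (simp only: g_def comp_def)
  qed auto
  finally show ?thesis by (simp add: same_def)
qed

lemma same_refl: "same m m"
  unfolding same_def
  by (rule W_mono[OF UNIV_in_W, of "{m}" "{}"]) (auto simp: avoiding_def diag_refl)

lemma same_sym: "same m n \<Longrightarrow> same n m"
  unfolding same_def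
  by (erule W_mono[of _ "{m, n}" "{}"]) (auto simp: avoiding_def diag_sym)

lemma same_trans:
  assumes "same m n" "same n k"
  shows "same m k"
proof -
  have "{(\<rho>, x). x \<in> diag (\<rho> m) (\<rho> n)} \<inter> {(\<rho>, x). x \<in> diag (\<rho> n) (\<rho> k)} \<in> W"
    using assms by (simp add: same_def W_Int)
  then show ?thesis unfolding same_def
  proof (rule W_mono[of _ "{m, n, k}" "{}"])
    fix \<rho> :: "'n \<Rightarrow> 'i" and x assume "\<rho> \<in> avoiding {m, n, k} {}"
      and x: "(\<rho>, x) \<in> {(\<rho>, x). x \<in> diag (\<rho> m) (\<rho> n)} \<inter> {(\<rho>, x). x \<in> diag (\<rho> n) (\<rho> k)}"
    then have "\<rho> m \<in> Field \<alpha>" "\<rho> n \<in> Field \<alpha>" "\<rho> k \<in> Field \<alpha>" by (auto simp: avoiding_def)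
    then show "(\<rho>, x) \<in> {(\<rho>, x). x \<in> diag (\<rho> m) (\<rho> k)}"
      using diag_trans[of "\<rho> m" "\<rho> n" "\<rho> k"] x by auto
  qed auto
qed

text \<open>
  Isolating the substitution for \<open>\<kappa>\<close> as the outermost one lets the names assigned to \<open>\<kappa>\<close> vary while
  the set under it stays fixed.
\<close>

lemma holds_update:
  assumes "\<kappa> \<in> Field \<alpha>" "b \<in> B"
  shows "holds b (f(\<kappa> := m)) \<longleftrightarrow> {(\<rho>, x). x \<in> sub \<kappa> (\<rho> m) (Sub (dims b - {\<kappa>}) (\<rho> \<circ> f) b)} \<in> W"
proof -
  let ?\<Gamma> = "dims b - {\<kappa>}"
  have \<Gamma>: "finite ?\<Gamma>" "insert \<kappa> ?\<Gamma> \<subseteq> Field \<alpha>" using finite_dims assms dims_subset by auto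
  then have "holds b (f(\<kappa> := m)) \<longleftrightarrow> {(\<rho>, x). x \<in> Sub (insert \<kappa> ?\<Gamma>) (\<rho> \<circ> f(\<kappa> := m)) b} \<in> W"
    using assms by (intro holds_Sub) auto
  also have "\<dots> \<longleftrightarrow> {(\<rho>, x). x \<in> sub \<kappa> (\<rho> m) (Sub ?\<Gamma> (\<rho> \<circ> f) b)} \<in> W"
  proof (rule W_cong[of "insert m (f ` ?\<Gamma>)" "insert \<kappa> ?\<Gamma>"])
    fix \<rho> :: "'n \<Rightarrow> 'i" assume \<rho>: "\<rho> \<in> avoiding (insert m (f ` ?\<Gamma>)) (insert \<kappa> ?\<Gamma>)"
    show "Sub (insert \<kappa> ?\<Gamma>) (\<rho> \<circ> f(\<kappa> := m)) b = sub \<kappa> (\<rho> m) (Sub ?\<Gamma> (\<rho> \<circ> f) b)"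
      using \<Gamma> assms by (intro Sub_update[OF \<rho>]) auto
  qed (use \<Gamma> in auto)
  finally show ?thesis .
qed

lemma holds_update_same:
  assumes "same m n" "\<kappa> \<in> Field \<alpha>" "b \<in> B" "holds b (f(\<kappa> := m))"
  shows "holds b (f(\<kappa> := n))"
proof -
  let ?\<Gamma> = "dims b - {\<kappa>}"
  let ?z = "\<lambda>\<rho>. Sub ?\<Gamma> (\<rho> \<circ> f) b"
  have \<Gamma>: "finite ?\<Gamma>" "insert \<kappa> ?\<Gamma> \<subseteq> Field \<alpha>" using finite_dims assms dims_subset by auto
  have "{(\<rho>, x). x \<in> diag (\<rho> m) (\<rho> n)} \<inter> {(\<rho>, x). x \<in> sub \<kappa> (\<rho> m) (?z \<rho>)} \<in> W"
    using assms by (simp add: same_def holds_update W_Int)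
  then have "{(\<rho>, x). x \<in> sub \<kappa> (\<rho> n) (?z \<rho>)} \<in> W"
  proof (rule W_mono[of _ "{m, n} \<union> f ` ?\<Gamma>" "insert \<kappa> ?\<Gamma>"])
    fix \<rho> :: "'n \<Rightarrow> 'i" and x assume \<rho>: "\<rho> \<in> avoiding ({m, n} \<union> f ` ?\<Gamma>) (insert \<kappa> ?\<Gamma>)"
      and x: "(\<rho>, x) \<in> {(\<rho>, x). x \<in> diag (\<rho> m) (\<rho> n)} \<inter> {(\<rho>, x). x \<in> sub \<kappa> (\<rho> m) (?z \<rho>)}"
    have "apart ?\<Gamma> (\<rho> \<circ> f)" using \<rho> \<Gamma> by (intro avoiding_apart[OF \<rho>]) auto
    then have "?z \<rho> \<in> B" using assms(3) by (rule Sub_in)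
    moreover have "\<rho> m \<in> Field \<alpha>" "\<rho> n \<in> Field \<alpha>" "\<kappa> \<noteq> \<rho> m" "\<kappa> \<noteq> \<rho> n"
      using \<rho> by (auto simp: avoiding_def)
    ultimately show "(\<rho>, x) \<in> {(\<rho>, x). x \<in> sub \<kappa> (\<rho> n) (?z \<rho>)}"
      using diag_Int_sub[of \<kappa> "\<rho> m" "\<rho> n" "?z \<rho>"] x assms(2) by auto
  qed (use \<Gamma> in auto)
  then show ?thesis using assms by (simp add: holds_update)
qed

text \<open>
  From left to right the witness of the request made by \<open>b\<close>, \<open>\<kappa>\<close> and \<open>f\<close> serves as \<open>n\<close>; conversely
  a substitution instance lies below the cylindrification.
\<close>

lemma holds_cyl:
  assumes \<kappa>: "\<kappa> \<in> Field \<alpha>" and b: "b \<in> B"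
  shows "holds (cyl \<kappa> b) f \<longleftrightarrow> (\<exists>n. holds b (f(\<kappa> := n)))"
proof -
  let ?\<Gamma> = "dims b - {\<kappa>}"
  let ?z = "\<lambda>\<rho>. Sub ?\<Gamma> (\<rho> \<circ> f) b"
  have \<Gamma>: "finite ?\<Gamma>" "insert \<kappa> ?\<Gamma> \<subseteq> Field \<alpha>" using finite_dims \<kappa> b dims_subset by auto
  have "holds (cyl \<kappa> b) f \<longleftrightarrow> {(\<rho>, x). x \<in> Sub ?\<Gamma> (\<rho> \<circ> f) (cyl \<kappa> b)} \<in> W"
    using \<Gamma> \<kappa> b dims_cyl[of \<kappa> b] by (intro holds_Sub) (auto simp: cyl_in)
  also have "\<dots> \<longleftrightarrow> {(\<rho>, x). x \<in> cyl \<kappa> (?z \<rho>)} \<in> W"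
  proof (rule W_cong[of "f ` ?\<Gamma>" "insert \<kappa> ?\<Gamma>"])
    fix \<rho> :: "'n \<Rightarrow> 'i" assume \<rho>: "\<rho> \<in> avoiding (f ` ?\<Gamma>) (insert \<kappa> ?\<Gamma>)"
    have "apart ?\<Gamma> (\<rho> \<circ> f)" using \<Gamma> by (intro avoiding_apart[OF \<rho>]) auto
    moreover have "\<kappa> \<notin> (\<rho> \<circ> f) ` ?\<Gamma>" using \<rho> by (auto simp: avoiding_def)
    ultimately show "Sub ?\<Gamma> (\<rho> \<circ> f) (cyl \<kappa> b) = cyl \<kappa> (?z \<rho>)"
      using cyl_Sub[of ?\<Gamma> "\<rho> \<circ> f" \<kappa> b] \<kappa> b by simp
  qed (use \<Gamma> in auto)
  finally have cyl: "holds (cyl \<kappa> b) f \<longleftrightarrow> {(\<rho>, x). x \<in> cyl \<kappa> (?z \<rho>)} \<in> W" .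
  show ?thesis
  proof
    define r where "r = (b, \<kappa>, restrict f (dims b))"
    have r: "r \<in> requests" using \<kappa> b by (simp add: r_def requests_def)
    have "Sub ?\<Gamma> (\<rho> \<circ> restrict f (dims b)) b = ?z \<rho>" for \<rho> :: "'n \<Rightarrow> 'i"
      by (rule Sub_cong) simp
    then have eq: "witnessed \<rho> r = - cyl \<kappa> (?z \<rho>) \<union> sub \<kappa> (\<rho> (wit r)) (?z \<rho>)" for \<rho>
      by (simp add: r_def)
    assume "holds (cyl \<kappa> b) f"
    then have "{(\<rho>, x). x \<in> cyl \<kappa> (?z \<rho>)} \<inter> {(\<rho>, x). x \<in> witnessed \<rho> r} \<in> W"
      using W_witnessed[OF r] cyl by (simp add: W_Int)
    then have "{(\<rho>, x). x \<in> sub \<kappa> (\<rho> (wit r)) (?z \<rho>)} \<in> W"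
      by (rule W_mono[of _ "{}" "{}"]) (auto simp: eq)
    then show "\<exists>n. holds b (f(\<kappa> := n))" using \<kappa> b holds_update by blast
  next
    assume "\<exists>n. holds b (f(\<kappa> := n))"
    then obtain n where "{(\<rho>, x). x \<in> sub \<kappa> (\<rho> n) (?z \<rho>)} \<in> W" using \<kappa> b holds_update by blast
    then have "{(\<rho>, x). x \<in> cyl \<kappa> (?z \<rho>)} \<in> W"
    proof (rule W_mono[of _ "insert n (f ` ?\<Gamma>)" "insert \<kappa> ?\<Gamma>"])
      fix \<rho> :: "'n \<Rightarrow> 'i" and x assume \<rho>: "\<rho> \<in> avoiding (insert n (f ` ?\<Gamma>)) (insert \<kappa> ?\<Gamma>)"
        and x: "(\<rho>, x) \<in> {(\<rho>, x). x \<in> sub \<kappa> (\<rho> n) (?z \<rho>)}"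
      have "apart ?\<Gamma> (\<rho> \<circ> f)" using \<Gamma> by (intro avoiding_apart[OF \<rho>]) auto
      then have "?z \<rho> \<in> B" using b by (rule Sub_in)
      moreover have "\<rho> n \<in> Field \<alpha>" "\<kappa> \<noteq> \<rho> n" using \<rho> by (auto simp: avoiding_def)
      ultimately show "(\<rho>, x) \<in> {(\<rho>, x). x \<in> cyl \<kappa> (?z \<rho>)}"
        using sub_subset_cyl[of \<kappa> "\<rho> n" "?z \<rho>"] x \<kappa> by auto
    qed (use \<Gamma> in auto)
    then show "holds (cyl \<kappa> b) f" using cyl by simp
  qed
qed

text \<open>
  The base of the set algebra consists of one representative of each class of names that the
  diagonals identify in the limit; the injection only moves it into a prescribed type.
\<close>

lemma limit_representation:
  fixes emb :: "'n \<Rightarrow> 'u"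
  assumes emb: "inj emb"
  shows "\<exists>(U :: 'u set) h. set_representation U h \<and> h a \<noteq> {}"
proof -
  define rep where "rep n = (SOME m. same n m)" for n
  have same_rep: "same n (rep n)" for n unfolding rep_def by (rule someI) (rule same_refl)
  have rep_eq: "rep m = rep n \<longleftrightarrow> same m n" for m n
  proof
    assume "rep m = rep n"
    then show "same m n" using same_rep same_sym same_trans by metis
  next
    assume "same m n"
    then have "same m = same n" using same_sym same_trans by blast
    then show "rep m = rep n" by (simp add: rep_def)
  qed
  define U where "U = emb ` range rep"
  define name where "name s = the_inv emb \<circ> s" for s :: "'i \<Rightarrow> 'u"
  define h where "h b = {s \<in> seqs \<alpha> U. holds b (name s)}" for b
  have name_upd: "name (s(\<kappa> := emb m)) = (name s)(\<kappa> := m)" for s \<kappa> m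
    using emb by (auto simp: name_def the_inv_f_f)
  have cyl: "h (cyl \<kappa> b) = {s \<in> seqs \<alpha> U. \<exists>x \<in> U. s(\<kappa> := x) \<in> h b}"
    if \<kappa>: "\<kappa> \<in> Field \<alpha>" and b: "b \<in> B" for \<kappa> b
  proof -
    have "(\<exists>n. holds b ((name s)(\<kappa> := n))) \<longleftrightarrow> (\<exists>x \<in> U. s(\<kappa> := x) \<in> h b)" if s: "s \<in> seqs \<alpha> U" for s
    proof
      assume "\<exists>n. holds b ((name s)(\<kappa> := n))"
      then obtain n where "holds b ((name s)(\<kappa> := n))" ..
      then have "holds b ((name s)(\<kappa> := rep n))" using holds_update_same same_rep \<kappa> b by blast
      moreover have "emb (rep n) \<in> U" by (simp add: U_def)
      moreover have "s(\<kappa> := emb (rep n)) \<in> seqs \<alpha> U"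
        using s \<kappa> \<open>emb (rep n) \<in> U\<close> by (auto simp: PiE_iff extensional_def)
      ultimately show "\<exists>x \<in> U. s(\<kappa> := x) \<in> h b"
        by (intro bexI[of _ "emb (rep n)"]) (auto simp: h_def name_upd)
    next
      assume "\<exists>x \<in> U. s(\<kappa> := x) \<in> h b"
      then show "\<exists>n. holds b ((name s)(\<kappa> := n))" by (auto simp: U_def h_def name_upd)
    qed
    then show ?thesis using holds_cyl[OF \<kappa> b] by (auto simp: h_def)
  qed
  have dg: "h (diag \<kappa> \<mu>) = {s \<in> seqs \<alpha> U. s \<kappa> = s \<mu>}" if \<kappa>: "\<kappa> \<in> Field \<alpha>" "\<mu> \<in> Field \<alpha>" for \<kappa> \<mu>
  proof -
    have "holds (diag \<kappa> \<mu>) (name s) \<longleftrightarrow> s \<kappa> = s \<mu>" if s: "s \<in> seqs \<alpha> U" for s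
    proof -
      obtain m n where mn: "s \<kappa> = emb (rep m)" "s \<mu> = emb (rep n)"
        using s \<kappa> unfolding U_def by (auto simp: PiE_iff image_iff) metis
      have "same (rep m) (rep n) \<longleftrightarrow> same m n"
        using same_rep same_sym same_trans by metis
      also have "\<dots> \<longleftrightarrow> s \<kappa> = s \<mu>" using rep_eq mn emb by (simp add: inj_eq)
      finally show ?thesis using \<kappa> mn emb by (simp add: holds_diag name_def the_inv_f_f)
    qed
    then show ?thesis by (auto simp: h_def)
  qed
  have dep: "depends_on \<alpha> U (h b) (dims b)" for b
  proof -
    have "holds b (name s) \<longleftrightarrow> holds b (name t)" if "\<forall>\<kappa> \<in> dims b. s \<kappa> = t \<kappa>" for s t
      using that by (intro holds_local) (simp add: name_def)
    then show ?thesis by (auto simp: depends_on_def h_def)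
  qed
  have rep: "set_representation U h"
    unfolding set_representation_def
    using cyl dg dep by (auto simp: h_def holds_Compl holds_Int)
  have "h a \<noteq> {}"
  proof -
    have fin: "finite (dims a)" "dims a \<subseteq> Field \<alpha>" using finite_dims[OF a_in] dims_subset by auto
    \<comment> \<open>The cylindrical closure of \<open>a\<close> has no dimensions left, so it is true under every assignment.\<close>
    let ?c = "Cyl (dims a) a"
    have c: "?c \<in> B" "a \<subseteq> ?c" using fin a_in by (simp_all add: Cyl_in Cyl_increasing)
    have "cyl \<kappa> ?c = ?c" if "\<kappa> \<in> Field \<alpha>" for \<kappa>
      using Cyl_closed[OF fin a_in] Cyl_cyl_comm[OF fin that a_in] that
      by (cases "\<kappa> \<in> dims a") (auto simp: dims_def)
    then have "dims ?c = {}" by (auto simp: dims_def)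
    moreover have "{(\<rho>, x). x \<in> ?c} \<in> W" by (rule W_mono[OF W_a, of "{}" "{}"]) (use c(2) in auto)
    ultimately have "holds ?c f" for f using c(1) by (simp add: holds_def Sub_empty)
    moreover have "seqs \<alpha> U \<noteq> {}" by (simp add: PiE_eq_empty_iff U_def)
    ultimately have "h ?c \<noteq> {}" by (auto simp: h_def)
    moreover have "h a \<noteq> {}" if "h (Cyl \<Gamma> a) \<noteq> {}" "finite \<Gamma>" "\<Gamma> \<subseteq> Field \<alpha>" for \<Gamma>
      using that(2,3,1)
    proof (induction rule: finite_induct)
      case (insert \<kappa> \<Gamma>)
      then have "h (cyl \<kappa> (Cyl \<Gamma> a)) \<noteq> {}" using a_in by (simp add: Cyl_insert)
      then have "h (Cyl \<Gamma> a) \<noteq> {}" using cyl[of \<kappa> "Cyl \<Gamma> a"] insert a_in by (auto simp: Cyl_in)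
      then show ?case using insert by auto
    qed (use a_in in \<open>simp add: Cyl_empty\<close>)
    ultimately show ?thesis using fin by blast
  qed
  then show ?thesis using rep by blast
qed

end

subsection \<open>Supply of names\<close>

lemma ex_inj_prod:
  assumes "infinite (UNIV :: 'x set)"
  shows "\<exists>p :: 'x \<times> 'x \<Rightarrow> 'x. inj p"
  using card_of_Times_same_infinite[OF assms, THEN ordIso_imp_ordLeq]
  unfolding card_of_ordLeq[symmetric] by auto

lemma ex_inj_list:
  assumes p: "inj (p :: 'x \<times> 'x \<Rightarrow> 'x)" and k: "inj (k :: nat \<Rightarrow> 'x)"
  shows "\<exists>c :: 'x list \<Rightarrow> 'x. inj c"
proof -
  define c where "c xs = foldr (\<lambda>x y. p (x, y)) xs (k 0)" for xs
  have pp: "p u = p v \<longleftrightarrow> u = v" for u v using p by (simp add: inj_eq)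
  have "c xs = c ys \<Longrightarrow> xs = ys" if "length xs = length ys" for xs ys
    using that by (induction xs ys rule: list_induct2) (auto simp: c_def pp)
  \<comment> \<open>The length is recorded because \<open>k 0\<close>, which ends every list, may itself be a value of \<open>p\<close>.\<close>
  then have "inj (\<lambda>xs. p (k (length xs), c xs))"
    using k by (auto simp: inj_on_def pp)
  then show ?thesis by blast
qed

context infinite_cylindric_field
begin

text \<open>
  Since dimension sets are finite, a request is a finite string over \<open>'i + 'a + nat\<close>, so it can be
  coded by a point of that infinite type.  The witness is the code paired with the height of the
  request; the level of any point is read off from its second component, so heights can refer to
  levels without circularity.
\<close>

lemma henkin_names_exist:
  fixes e :: "'p set \<Rightarrow> 'a"
  assumes e: "inj_on e B"
  shows "\<exists>(wit :: 'p set \<times> 'i \<times> ('i \<Rightarrow> 'i + 'a + nat) \<Rightarrow> 'i + 'a + nat) level requests.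
    henkin_names \<alpha> B cyl diag wit level requests"
proof -
  define k :: "nat \<Rightarrow> 'i + 'a + nat" where "k n = Inr (Inr n)" for n
  have k: "inj k" by (auto simp: k_def inj_on_def)
  then have "infinite (UNIV :: ('i + 'a + nat) set)"
    by (metis finite_subset infinite_UNIV_nat finite_imageD subset_UNIV)
  then obtain p :: "('i + 'a + nat) \<times> ('i + 'a + nat) \<Rightarrow> 'i + 'a + nat" where p: "inj p"
    using ex_inj_prod by blast
  obtain c :: "('i + 'a + nat) list \<Rightarrow> 'i + 'a + nat" where c: "inj c" using ex_inj_list[OF p k] by blast
  have peq: "p u = p v \<longleftrightarrow> u = v" for u v using p by (simp add: inj_eq)
  have ceq: "c u = c v \<longleftrightarrow> u = v" for u v using c by (simp add: inj_eq)
  define enum where "enum b = (SOME xs. set xs = dims b)" for b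
  have enum: "set (enum b) = dims b" if "b \<in> B" for b
    unfolding enum_def using finite_list[OF finite_dims[OF that]] by (rule someI_ex)
  define level where "level x = (case snd (the_inv p x) of Inr (Inr n) \<Rightarrow> n | _ \<Rightarrow> 0)" for x
  define height where "height = (\<lambda>(b, \<kappa> :: 'i, f). Suc (Max (insert 0 (level ` f ` dims b))))"
  define code where "code = (\<lambda>(b, \<kappa>, f). p (Inr (Inl (e b)), p (Inl \<kappa>, c (map f (enum b)))))"
  define wit where "wit r = p (code r, k (height r))" for r
  define R where "R = {(b, \<kappa>, f :: 'i \<Rightarrow> 'i + 'a + nat). b \<in> B \<and> \<kappa> \<in> Field \<alpha> \<and> f \<in> extensional (dims b)}"
  have level: "level (wit r) = height r" for r
    using p by (simp add: level_def wit_def the_inv_f_f k_def)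
  have "henkin_names \<alpha> B cyl diag wit level R"
  proof
    show "R = {(b, \<kappa>, f). b \<in> B \<and> \<kappa> \<in> Field \<alpha> \<and> f \<in> extensional (dims b)}" by (fact R_def)
    show "inj_on wit R"
    proof
      fix r r' assume r: "r \<in> R" "r' \<in> R" "wit r = wit r'"
      obtain b \<kappa> f b' \<kappa>' f' where eq: "r = (b, \<kappa>, f)" "r' = (b', \<kappa>', f')" by (cases r, cases r')
      have B: "b \<in> B" "b' \<in> B" "f \<in> extensional (dims b)" "f' \<in> extensional (dims b')"
        using r eq by (auto simp: R_def)
      have "e b = e b'" and \<kappa>: "\<kappa> = \<kappa>'" and m: "map f (enum b) = map f' (enum b')"
        using r(3) by (simp_all add: wit_def eq code_def peq ceq)
      then have b: "b = b'" using e B by (auto simp: inj_on_def)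
      then have "f = f'" using m B enum by (intro extensionalityI[of f "dims b"]) auto
      then show "r = r'" using eq \<kappa> b by simp
    qed
    fix b \<kappa> f \<mu> assume r: "(b, \<kappa>, f) \<in> R" and \<mu>: "\<mu> \<in> dims b"
    then have "finite (dims b)" using finite_dims by (simp add: R_def)
    then have "level (f \<mu>) \<le> Max (insert 0 (level ` f ` dims b))" using \<mu> by (intro Max_ge) auto
    then show "level (f \<mu>) < level (wit (b, \<kappa>, f))" by (simp add: level height_def)
  qed
  then show ?thesis by blast
qed

lemma infinite_representation:
  fixes e :: "'p set \<Rightarrow> 'a" and emb :: "'i + 'a + nat \<Rightarrow> 'u"
  assumes "inj_on e B" "inj emb" and a: "a \<in> B" "a \<noteq> {}"
  shows "\<exists>(U :: 'u set) h. set_representation U h \<and> h a \<noteq> {}"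
proof -
  obtain wit :: "'p set \<times> 'i \<times> ('i \<Rightarrow> 'i + 'a + nat) \<Rightarrow> 'i + 'a + nat" and level requests
    where "henkin_names \<alpha> B cyl diag wit level requests" using henkin_names_exist[OF assms(1)] by blast
  then interpret henkin_names \<alpha> B cyl diag wit level requests .
  obtain W where W: "\<forall>Y. - Y \<in> W \<longleftrightarrow> Y \<notin> W" "\<forall>Y Z. Y \<inter> Z \<in> W \<longleftrightarrow> Y \<in> W \<and> Z \<in> W"
    "\<forall>\<Gamma> \<Delta>. finite \<Gamma> \<longrightarrow> finite \<Delta> \<longrightarrow> avoiding \<Gamma> \<Delta> \<times> UNIV \<in> W" "UNIV \<times> a \<in> W"
    "\<forall>r \<in> requests. {(\<rho>, x). x \<in> witnessed \<rho> r} \<in> W"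
    using limit_exists[OF a] by blast
  interpret henkin_limit \<alpha> B cyl diag wit level requests a W
    by unfold_locales (use W a in auto)
  show ?thesis using limit_representation[OF assms(2)] a by blast
qed

end

section \<open>Dimension one and trivial cylindrifications\<close>

context cylindric_field
begin

lemma trivial_representation:
  assumes cyl: "\<And>\<kappa> b. \<kappa> \<in> Field \<alpha> \<Longrightarrow> b \<in> B \<Longrightarrow> cyl \<kappa> b = b"
    and diag: "\<And>\<kappa> \<mu>. \<kappa> \<in> Field \<alpha> \<Longrightarrow> \<mu> \<in> Field \<alpha> \<Longrightarrow> diag \<kappa> \<mu> = UNIV"
    and a: "a \<noteq> {}"
  shows "\<exists>(U :: 'u set) h. set_representation U h \<and> h a \<noteq> {}"
proof -
  obtain x where x: "x \<in> a" using a by blast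
  define U where "U = {undefined :: 'u}"
  define h where "h b = (if x \<in> b then seqs \<alpha> U else {})" for b
  have upd: "s(\<kappa> := undefined) \<in> seqs \<alpha> U" if "s \<in> seqs \<alpha> U" "\<kappa> \<in> Field \<alpha>" for s \<kappa>
    using that by (auto simp: U_def PiE_iff extensional_def)
  have "s \<kappa> = s \<mu>" if "s \<in> seqs \<alpha> U" "\<kappa> \<in> Field \<alpha>" "\<mu> \<in> Field \<alpha>" for s \<kappa> \<mu>
    using that by (auto simp: U_def PiE_iff)
  then have "set_representation U h"
    unfolding set_representation_def depends_on_def
    using upd by (auto simp: h_def cyl diag, auto simp: U_def)
  moreover have "seqs \<alpha> U \<noteq> {}" by (simp add: PiE_eq_empty_iff U_def)
  ultimately show ?thesis using x by (auto simp: h_def intro!: exI[of _ U] exI[of _ h])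
qed

text \<open>
  When the indices of the diagonal axiom may coincide, the case \<open>\<mu> = \<kappa>\<close> makes \<open>diag \<kappa> \<mu>\<close> its own
  cylindrification along \<open>\<kappa>\<close>, which is everything by the case \<open>\<nu> = \<mu>\<close>.
\<close>

lemma degenerate_diag:
  assumes all: "\<And>\<kappa> \<mu> \<nu>. \<kappa> \<in> Field \<alpha> \<Longrightarrow> \<mu> \<in> Field \<alpha> \<Longrightarrow> \<nu> \<in> Field \<alpha> \<Longrightarrow>
      diag \<mu> \<nu> = cyl \<kappa> (diag \<mu> \<kappa> \<inter> diag \<kappa> \<nu>)"
    and \<kappa>: "\<kappa> \<in> Field \<alpha>" and \<mu>: "\<mu> \<in> Field \<alpha>"
  shows "diag \<kappa> \<mu> = UNIV"
proof -
  have "UNIV = cyl \<kappa> (diag \<mu> \<kappa> \<inter> diag \<kappa> \<mu>)" using all[OF \<kappa> \<mu> \<mu>] \<mu> by (simp add: diag_refl)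
  also have "\<dots> \<subseteq> cyl \<kappa> (diag \<kappa> \<mu>)" using \<kappa> \<mu> by (intro cyl_mono) (auto simp: in_B)
  also have "\<dots> = diag \<kappa> \<mu>" using all[OF \<kappa> \<kappa> \<mu>] \<kappa> by (simp add: diag_refl)
  finally show ?thesis by blast
qed

text \<open>
  With trivial diagonals the substitution axiom makes the cylindrifications of \<open>b\<close> and \<open>- b\<close>
  disjoint.
\<close>

lemma degenerate_cyl:
  assumes diag: "\<And>\<kappa> \<mu>. \<kappa> \<in> Field \<alpha> \<Longrightarrow> \<mu> \<in> Field \<alpha> \<Longrightarrow> diag \<kappa> \<mu> = UNIV"
    and "\<kappa> \<in> Field \<alpha>" "\<mu> \<in> Field \<alpha>" "\<kappa> \<noteq> \<mu>" "b \<in> B"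
  shows "cyl \<kappa> b = b"
proof -
  have "cyl \<kappa> b \<inter> cyl \<kappa> (- b) = {}"
    using cyl_diag_Compl[of \<kappa> \<mu> b] assms by simp
  then show ?thesis using cyl_increasing[of \<kappa> b] cyl_increasing[of \<kappa> "- b"] assms by (auto simp: in_B)
qed

text \<open>
  In dimension one the base consists of the points that satisfy the same closed sets as a given
  point \<open>x\<close>.  If \<open>x \<in> cyl \<kappa> b\<close>, then \<open>b\<close> meets every closed set that contains \<open>x\<close>, and compactness
  turns this into a point of the base in \<open>b\<close>.
\<close>

lemma monadic_representation:
  fixes emb :: "'p \<Rightarrow> 'u"
  assumes \<alpha>: "Field \<alpha> = {\<kappa>}" and emb: "inj emb" and a: "a \<noteq> {}"
    and compact: "\<And>K. K \<subseteq> B \<Longrightarrow> (\<And>T. T \<subseteq> K \<Longrightarrow> finite T \<Longrightarrow> \<Inter>T \<noteq> {}) \<Longrightarrow> \<Inter>K \<noteq> {}"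
  shows "\<exists>(U :: 'u set) h. set_representation U h \<and> h a \<noteq> {}"
proof -
  obtain x where x: "x \<in> a" using a by blast
  define Z where "Z = {b \<in> B. cyl \<kappa> b = b \<and> x \<in> b}"
  define P where "P = \<Inter>Z"
  have xP: "x \<in> P" by (auto simp: P_def Z_def)
  have agree: "y \<in> b \<longleftrightarrow> x \<in> b" if y: "y \<in> P" and b: "b \<in> B" "cyl \<kappa> b = b" for y b
  proof -
    have "b \<in> Z \<or> - b \<in> Z" using b closed_Compl[of \<kappa> b] by (auto simp: Z_def in_B \<alpha>)
    then show ?thesis using y xP by (auto simp: P_def)
  qed
  have meets: "\<exists>y \<in> P. y \<in> b" if b: "b \<in> B" "x \<in> cyl \<kappa> b" for b
  proof -
    have "\<Inter>T \<noteq> {}" if T: "T \<subseteq> insert b Z" "finite T" for T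
    proof -
      have "\<Inter>S \<in> Z" if "finite S" "S \<subseteq> Z" for S
        using that
      proof (induction rule: finite_induct)
        case empty
        then show ?case by (simp add: Z_def UNIV_in cyl_UNIV \<alpha>)
      next
        case (insert z S)
        then have "z \<in> Z" "\<Inter>S \<in> Z" by auto
        then show ?case by (auto simp: Z_def Int_in cyl_Int_closed \<alpha>)
      qed
      then have "\<Inter>(T - {b}) \<in> Z" using T by blast
      then have Z: "\<Inter>(T - {b}) \<in> B" "cyl \<kappa> (\<Inter>(T - {b})) = \<Inter>(T - {b})" "x \<in> \<Inter>(T - {b})"
        by (simp_all add: Z_def)
      then have "x \<in> cyl \<kappa> (b \<inter> \<Inter>(T - {b}))" using b by (simp add: cyl_Int_closed \<alpha>)
      then have "b \<inter> \<Inter>(T - {b}) \<noteq> {}" using cyl_empty[of \<kappa>] \<alpha> by auto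
      moreover have "b \<inter> \<Inter>(T - {b}) \<subseteq> \<Inter>T" by blast
      ultimately show ?thesis by blast
    qed
    moreover have "insert b Z \<subseteq> B" using b by (auto simp: Z_def)
    ultimately have "\<Inter>(insert b Z) \<noteq> {}" using compact[of "insert b Z"] by blast
    then show ?thesis by (auto simp: P_def)
  qed
  define U where "U = emb ` P"
  define h where "h b = {s \<in> seqs \<alpha> U. the_inv emb (s \<kappa>) \<in> b}" for b
  have val: "the_inv emb (s \<kappa>) \<in> P" if "s \<in> seqs \<alpha> U" for s
    using that emb by (auto simp: U_def \<alpha> PiE_iff the_inv_f_f)
  have upd: "s(\<kappa> := u) \<in> seqs \<alpha> U" if "s \<in> seqs \<alpha> U" "u \<in> U" for s u
    using that by (auto simp: \<alpha> PiE_iff extensional_def)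
  have cyl: "h (cyl \<kappa> b) = {s \<in> seqs \<alpha> U. \<exists>u \<in> U. s(\<kappa> := u) \<in> h b}" if b: "b \<in> B" for b
  proof -
    have "the_inv emb (s \<kappa>) \<in> cyl \<kappa> b \<longleftrightarrow> (\<exists>u \<in> U. s(\<kappa> := u) \<in> h b)" if s: "s \<in> seqs \<alpha> U" for s
    proof -
      have "the_inv emb (s \<kappa>) \<in> cyl \<kappa> b \<longleftrightarrow> x \<in> cyl \<kappa> b"
        using agree[OF val[OF s]] b by (simp add: cyl_in cyl_idem \<alpha>)
      also have "\<dots> \<longleftrightarrow> (\<exists>y \<in> P. y \<in> b)"
        using meets[OF b] agree[of _ "cyl \<kappa> b"] b cyl_increasing[of \<kappa> b]
        by (auto simp: cyl_in cyl_idem \<alpha>)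
      also have "\<dots> \<longleftrightarrow> (\<exists>u \<in> U. the_inv emb u \<in> b)" using emb by (simp add: U_def the_inv_f_f)
      also have "\<dots> \<longleftrightarrow> (\<exists>u \<in> U. s(\<kappa> := u) \<in> h b)" using upd[OF s] by (simp add: h_def)
      finally show ?thesis .
    qed
    then show ?thesis by (auto simp: h_def)
  qed
  have dep: "depends_on \<alpha> U (h b) (dims b)" if b: "b \<in> B" for b
  proof (cases "\<kappa> \<in> dims b")
    case True
    then show ?thesis by (simp add: depends_on_def h_def)
  next
    case False
    then have "cyl \<kappa> b = b" by (simp add: dims_def \<alpha>)
    then show ?thesis using agree[OF val b] by (simp add: depends_on_def h_def)
  qed
  have "set_representation U h"
    unfolding set_representation_def using cyl dep \<alpha> by (auto simp: h_def diag_refl)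
  moreover have "(\<lambda>\<mu>\<in>Field \<alpha>. emb x) \<in> h a"
    using x xP emb by (auto simp: h_def U_def \<alpha> the_inv_f_f)
  ultimately show ?thesis by blast
qed

end

section \<open>The Boolean elements of an \<open>M\<close>-cylindric algebra\<close>

lemma csum_full_csa:
  assumes "finite S" "\<And>k. k \<in> S \<Longrightarrow> f k \<subseteq> seqs \<alpha> U"
  shows "csum (full_csa \<alpha> U) f S = (\<Union>k\<in>S. f k)"
proof -
  interpret comm_monoid "\<lparr>carrier = Pow (seqs \<alpha> U), monoid.mult = (\<union>), one = {}\<rparr>"
    by unfold_locales auto
  show ?thesis using assms
    by (induction rule: finite_induct) (auto simp: csum_def iter_op_def full_csa_def Pi_def)
qed

lemma cprod_full_csa:
  assumes "finite S" "\<And>k. k \<in> S \<Longrightarrow> f k \<subseteq> seqs \<alpha> U"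
  shows "cprod (full_csa \<alpha> U) f S = seqs \<alpha> U \<inter> (\<Inter>k\<in>S. f k)"
proof -
  interpret comm_monoid "\<lparr>carrier = Pow (seqs \<alpha> U), monoid.mult = (\<inter>), one = seqs \<alpha> U\<rparr>"
    by unfold_locales auto
  show ?thesis using assms
    by (induction rule: finite_induct) (auto simp: cprod_def iter_op_def full_csa_def Pi_def)
qed

context m_ca_core
begin

text \<open>
  The elements that take only the values \<open>0\<close> and \<open>1\<close>.  They are the fixed points of \<open>\<delta> top\<close>, and
  all values of all \<open>\<delta> p\<close> are among them.
\<close>

definition bool_carrier :: "'a set" where
  "bool_carrier = {a \<in> carrier A. \<delta> top a = a}"

lemma bool_in_carrier: "a \<in> bool_carrier \<Longrightarrow> a \<in> carrier A"
  by (simp add: bool_carrier_def)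

lemma delta_in_bool: "a \<in> carrier A \<Longrightarrow> \<delta> p a \<in> bool_carrier"
  by (simp add: bool_carrier_def delta_closed delta_top_delta)

lemma
  assumes "a \<in> bool_carrier"
  shows delta_top_bool: "\<delta> top a = a" and neg_in_bool: "\<sim> a \<in> bool_carrier"
    and cyl_in_bool: "\<kappa> \<in> Field \<alpha> \<Longrightarrow> \<c> \<kappa> a \<in> bool_carrier"
proof -
  show a: "\<delta> top a = a" using assms by (simp add: bool_carrier_def)
  show "\<sim> a \<in> bool_carrier"
    using assms delta_top_neg[of a] by (simp add: bool_carrier_def neg_closed a)
  show "\<c> \<kappa> a \<in> bool_carrier" if "\<kappa> \<in> Field \<alpha>"
    using assms that delta_top_cyl[of \<kappa> a] by (simp add: bool_carrier_def cyl_closed a)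
qed

lemma
  assumes "a \<in> bool_carrier" "b \<in> bool_carrier"
  shows plus_in_bool: "a \<boxplus> b \<in> bool_carrier" and times_in_bool: "a \<boxdot> b \<in> bool_carrier"
  using assms delta_top_plus[of a b] delta_top_times[of a b]
  by (simp_all add: bool_carrier_def plus_closed times_closed)

lemma top_in_bool: "\<u> top \<in> bool_carrier"
  by (simp add: bool_carrier_def const_closed delta_const_same)

lemma bot_in_bool: "\<u> bot \<in> bool_carrier"
  using delta_const_same[of top] delta_const_other[of top bot]
  by (cases "(top :: 'm) = bot") (simp_all add: bool_carrier_def const_closed)

lemma diag_in_bool: "\<kappa> \<in> Field \<alpha> \<Longrightarrow> \<mu> \<in> Field \<alpha> \<Longrightarrow> \<d> \<kappa> \<mu> \<in> bool_carrier"
  by (simp add: bool_carrier_def diag_closed delta_top_diag)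

lemmas in_bool = delta_in_bool neg_in_bool cyl_in_bool plus_in_bool times_in_bool top_in_bool
  bot_in_bool diag_in_bool

text \<open>
  Complements are required only for values of \<open>\<delta> p\<close>; on fixed points of \<open>\<delta> top\<close> that is enough.
\<close>

lemma bool_boolean_algebra:
  "boolean_algebra_on bool_carrier (mplus A) (mtimes A) (mneg A) (\<u> bot) (\<u> top)"
proof
  fix a assume a: "a \<in> bool_carrier"
  show "a \<boxplus> \<sim> a = \<u> top" "a \<boxdot> \<sim> a = \<u> bot"
    using delta_compl_plus[of a top] delta_compl_times[of a top] a
    by (simp_all add: delta_top_bool bool_in_carrier)
qed (auto intro: in_bool bool_in_carrier plus_comm times_comm plus_assoc times_assoc
    times_plus_distrib plus_times_distrib plus_zero times_one)

lemma plus_comm_monoid: "comm_monoid \<lparr>carrier = carrier A, monoid.mult = mplus A, one = \<u> bot\<rparr>"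
proof (rule comm_monoidI)
  fix a assume "a \<in> carrier \<lparr>carrier = carrier A, monoid.mult = mplus A, one = \<u> bot\<rparr>"
  then show "\<one>\<^bsub>\<lparr>carrier = carrier A, monoid.mult = mplus A, one = \<u> bot\<rparr>\<^esub>
      \<otimes>\<^bsub>\<lparr>carrier = carrier A, monoid.mult = mplus A, one = \<u> bot\<rparr>\<^esub> a = a"
    using plus_comm[of "\<u> bot" a] by (simp add: const_closed plus_zero)
qed (simp_all add: plus_closed const_closed plus_assoc, simp add: plus_comm)

lemma times_comm_monoid: "comm_monoid \<lparr>carrier = carrier A, monoid.mult = mtimes A, one = \<u> top\<rparr>"
proof (rule comm_monoidI)
  fix a assume "a \<in> carrier \<lparr>carrier = carrier A, monoid.mult = mtimes A, one = \<u> top\<rparr>"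
  then show "\<one>\<^bsub>\<lparr>carrier = carrier A, monoid.mult = mtimes A, one = \<u> top\<rparr>\<^esub>
      \<otimes>\<^bsub>\<lparr>carrier = carrier A, monoid.mult = mtimes A, one = \<u> top\<rparr>\<^esub> a = a"
    using times_comm[of "\<u> top" a] by (simp add: const_closed times_one)
qed (simp_all add: times_closed const_closed times_assoc, simp add: times_comm)

lemma msum_empty: "msum A f {} = \<u> bot" and mprod_empty: "mprod A f {} = \<u> top"
  using comm_monoid.finprod_empty[OF plus_comm_monoid] comm_monoid.finprod_empty[OF times_comm_monoid]
  by (simp_all add: msum_def mprod_def iter_op_def)

lemma
  assumes "finite S" "\<And>k. k \<in> S \<Longrightarrow> f k \<in> carrier A" "k \<notin> S" "f k \<in> carrier A"
  shows msum_insert: "msum A f (insert k S) = f k \<boxplus> msum A f S"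
    and mprod_insert: "mprod A f (insert k S) = f k \<boxdot> mprod A f S"
  using assms comm_monoid.finprod_insert[OF plus_comm_monoid, of S k f]
    comm_monoid.finprod_insert[OF times_comm_monoid, of S k f]
  by (simp_all add: msum_def mprod_def iter_op_def Pi_def)

text \<open>
  A homomorphism from the Boolean elements to a full cylindric set algebra, with regularity
  measured against the dimension sets of the abstract elements.
\<close>

definition bool_representation :: "'u set \<Rightarrow> ('a \<Rightarrow> ('i \<Rightarrow> 'u) set) \<Rightarrow> bool" where
  "bool_representation U g \<longleftrightarrow>
     (\<forall>b \<in> bool_carrier. g b \<subseteq> seqs \<alpha> U \<and> g (\<sim> b) = seqs \<alpha> U - g b \<and>
        depends_on \<alpha> U (g b) {\<kappa> \<in> Field \<alpha>. \<c> \<kappa> b \<noteq> b} \<and>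
        (\<forall>\<kappa> \<in> Field \<alpha>. g (\<c> \<kappa> b) = {s \<in> seqs \<alpha> U. \<exists>x \<in> U. s(\<kappa> := x) \<in> g b})) \<and>
     (\<forall>a \<in> bool_carrier. \<forall>b \<in> bool_carrier. g (a \<boxplus> b) = g a \<union> g b \<and> g (a \<boxdot> b) = g a \<inter> g b) \<and>
     (\<forall>\<kappa> \<in> Field \<alpha>. \<forall>\<mu> \<in> Field \<alpha>. g (\<d> \<kappa> \<mu>) = {s \<in> seqs \<alpha> U. s \<kappa> = s \<mu>}) \<and>
     g (\<u> bot) = {} \<and> g (\<u> top) = seqs \<alpha> U"

end

subsection \<open>Representing the Boolean elements by sets\<close>

text \<open>
  The operations are transported along an embedding of the Boolean elements into a power set, which
  turns them into a cylindric field.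
\<close>

locale stone_image = m_ca_core \<alpha> A
  for \<alpha> :: "'i rel" and A :: "('a, 'i, 'm::{de_morgan_algebra, finite}) mcyl_algebra" (structure) +
  fixes st :: "'a \<Rightarrow> 'p set"
  assumes inj_st: "inj_on st bool_carrier"
    and st_plus: "a \<in> bool_carrier \<Longrightarrow> b \<in> bool_carrier \<Longrightarrow> st (a \<boxplus> b) = st a \<union> st b"
    and st_times: "a \<in> bool_carrier \<Longrightarrow> b \<in> bool_carrier \<Longrightarrow> st (a \<boxdot> b) = st a \<inter> st b"
    and st_neg: "a \<in> bool_carrier \<Longrightarrow> st (\<sim> a) = - st a"
    and st_bot: "st (\<u> bot) = {}" and st_top: "st (\<u> top) = UNIV"
begin

definition st_cyl :: "'i \<Rightarrow> 'p set \<Rightarrow> 'p set" where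
  "st_cyl \<kappa> Y = st (\<c> \<kappa> (inv_into bool_carrier st Y))"

definition st_diag :: "'i \<Rightarrow> 'i \<Rightarrow> 'p set" where
  "st_diag \<kappa> \<mu> = st (\<d> \<kappa> \<mu>)"

lemma st_cyl: "b \<in> bool_carrier \<Longrightarrow> st_cyl \<kappa> (st b) = st (\<c> \<kappa> b)"
  by (simp add: st_cyl_def inj_st)

lemma cylindric_field: "cylindric_field \<alpha> (st ` bool_carrier) st_cyl st_diag"
proof
  show "UNIV \<in> st ` bool_carrier" using st_top top_in_bool by blast
  fix a assume "a \<in> st ` bool_carrier"
  then obtain a' where a: "a' \<in> bool_carrier" "a = st a'" by blast
  then have aA: "a' \<in> carrier A" by (simp add: bool_in_carrier)
  show "- a \<in> st ` bool_carrier" using a by (simp add: neg_in_bool flip: st_neg)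
  show "a \<inter> b \<in> st ` bool_carrier" if b: "b \<in> st ` bool_carrier" for b
    using b a by (auto simp: times_in_bool simp flip: st_times)
  fix \<kappa> assume \<kappa>: "\<kappa> \<in> Field \<alpha>"
  show "st_cyl \<kappa> a \<in> st ` bool_carrier" using a \<kappa> by (simp add: st_cyl cyl_in_bool)
  have "st (\<c> \<kappa> a') = st a' \<union> st (\<c> \<kappa> a')"
    using a \<kappa> st_plus[of a' "\<c> \<kappa> a'"] cyl_increasing[of \<kappa> a'] aA by (simp add: cyl_in_bool)
  then show "a \<subseteq> st_cyl \<kappa> a" using a by (auto simp: st_cyl)
  show "st_cyl \<kappa> (a \<inter> st_cyl \<kappa> b) = st_cyl \<kappa> a \<inter> st_cyl \<kappa> b" if b: "b \<in> st ` bool_carrier" for b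
  proof -
    obtain b' where b': "b' \<in> bool_carrier" "b = st b'" using b by blast
    have "a \<inter> st_cyl \<kappa> b = st (a' \<boxdot> \<c> \<kappa> b')" using a b' \<kappa> by (simp add: st_cyl st_times cyl_in_bool)
    then have "st_cyl \<kappa> (a \<inter> st_cyl \<kappa> b) = st (\<c> \<kappa> (a' \<boxdot> \<c> \<kappa> b'))"
      using a b' \<kappa> by (simp add: st_cyl in_bool)
    also have "\<dots> = st (\<c> \<kappa> a') \<inter> st (\<c> \<kappa> b')"
      using a b' \<kappa> by (simp add: cyl_times_cyl bool_in_carrier st_times in_bool)
    finally show ?thesis using a b' by (simp add: st_cyl)
  qed
  show "st_cyl \<kappa> (st_cyl \<mu> a) = st_cyl \<mu> (st_cyl \<kappa> a)" if "\<mu> \<in> Field \<alpha>" for \<mu>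
    using a \<kappa> that cyl_comm[of \<kappa> \<mu> a'] aA by (simp add: st_cyl cyl_in_bool)
  show "st_cyl \<kappa> (st_diag \<kappa> \<mu> \<inter> a) \<inter> st_cyl \<kappa> (st_diag \<kappa> \<mu> \<inter> - a) = {}"
    if \<mu>: "\<mu> \<in> Field \<alpha>" "\<kappa> \<noteq> \<mu>" for \<mu>
  proof -
    have "st_cyl \<kappa> (st_diag \<kappa> \<mu> \<inter> a) = st (\<c> \<kappa> (\<d> \<kappa> \<mu> \<boxdot> a'))"
      "st_cyl \<kappa> (st_diag \<kappa> \<mu> \<inter> - a) = st (\<c> \<kappa> (\<d> \<kappa> \<mu> \<boxdot> \<sim> a'))"
      using a \<kappa> \<mu> by (simp_all add: st_diag_def in_bool flip: st_times st_neg st_cyl)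
    then have "st_cyl \<kappa> (st_diag \<kappa> \<mu> \<inter> a) \<inter> st_cyl \<kappa> (st_diag \<kappa> \<mu> \<inter> - a) =
        st (\<c> \<kappa> (\<d> \<kappa> \<mu> \<boxdot> \<delta> top a') \<boxdot> \<c> \<kappa> (\<d> \<kappa> \<mu> \<boxdot> \<sim> (\<delta> top a')))"
      using a \<kappa> \<mu> by (simp add: delta_top_bool st_times in_bool)
    then show ?thesis using cyl_diag_compl[OF \<kappa> \<mu> aA] by (simp add: st_bot)
  qed
next
  fix \<kappa> assume \<kappa>: "\<kappa> \<in> Field \<alpha>"
  show "st_cyl \<kappa> {} = {}" using st_cyl[OF bot_in_bool, of \<kappa>] by (simp add: st_bot cyl_zero \<kappa>)
  show "st_diag \<kappa> \<kappa> = UNIV" by (simp add: st_diag_def diag_refl \<kappa> st_top)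
  show "st_diag \<kappa> \<mu> \<in> st ` bool_carrier" if "\<mu> \<in> Field \<alpha>" for \<mu>
    using \<kappa> that by (simp add: st_diag_def diag_in_bool)
qed

sublocale field: cylindric_field \<alpha> "st ` bool_carrier" st_cyl st_diag
  by (rule cylindric_field)

lemma dims_st: "b \<in> bool_carrier \<Longrightarrow> field.dims (st b) = {\<kappa> \<in> Field \<alpha>. \<c> \<kappa> b \<noteq> b}"
proof -
  assume b: "b \<in> bool_carrier"
  have "st (\<c> \<kappa> b) = st b \<longleftrightarrow> \<c> \<kappa> b = b" if "\<kappa> \<in> Field \<alpha>" for \<kappa>
    using inj_on_eq_iff[OF inj_st cyl_in_bool[OF b that] b] .
  then show ?thesis using b by (simp add: field.dims_def st_cyl cong: conj_cong)
qed

lemma bool_representation_st: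
  assumes "field.set_representation U h"
  shows "bool_representation U (\<lambda>b. h (st b))"
proof -
  have Compl: "h (- st b) = seqs \<alpha> U - h (st b)" if "b \<in> bool_carrier" for b
    using field.set_representation_Compl[OF assms] that by blast
  have sub: "h (st b) \<subseteq> seqs \<alpha> U" if "b \<in> bool_carrier" for b
    using field.set_representation_subset[OF assms] that by blast
  have Int: "h (st a \<inter> st b) = h (st a) \<inter> h (st b)" if "a \<in> bool_carrier" "b \<in> bool_carrier" for a b
    using field.set_representation_Int[OF assms] that by blast
  have Un: "h (st a \<union> st b) = h (st a) \<union> h (st b)"
    if ab: "a \<in> bool_carrier" "b \<in> bool_carrier" for a b
  proof -
    have "h (- st (\<sim> a \<boxdot> \<sim> b)) = seqs \<alpha> U - h (st (\<sim> a) \<inter> st (\<sim> b))"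
      using ab Compl[of "\<sim> a \<boxdot> \<sim> b"] by (simp add: st_times in_bool)
    also have "\<dots> = seqs \<alpha> U - h (st (\<sim> a)) \<inter> h (st (\<sim> b))"
      using ab Int[of "\<sim> a" "\<sim> b"] by (simp add: in_bool)
    also have "\<dots> = h (st a) \<union> h (st b)"
      using ab sub[of a] sub[of b] by (auto simp: st_neg Compl)
    finally show ?thesis using ab by (simp add: st_neg st_times in_bool)
  qed
  have bot: "h (st (\<u> bot)) = {}"
  proof -
    have "h (st (\<u> top) \<inter> st (\<sim> (\<u> top))) = h (st (\<u> top)) \<inter> (seqs \<alpha> U - h (st (\<u> top)))"
      using Int[OF top_in_bool neg_in_bool[OF top_in_bool]] Compl[OF top_in_bool]
      by (simp add: st_neg top_in_bool)
    moreover have "st (\<u> top) \<inter> st (\<sim> (\<u> top)) = st (\<u> bot)" by (simp add: st_neg st_bot in_bool)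
    ultimately have "h (st (\<u> bot)) = h (st (\<u> top)) \<inter> (seqs \<alpha> U - h (st (\<u> top)))" by simp
    then show ?thesis by blast
  qed
  have "st (\<u> top) = - st (\<u> bot)" by (simp add: st_top st_bot)
  then have top: "h (st (\<u> top)) = seqs \<alpha> U" using Compl[OF bot_in_bool] bot by simp
  have dep: "depends_on \<alpha> U (h (st b)) {\<kappa> \<in> Field \<alpha>. \<c> \<kappa> b \<noteq> b}" if b: "b \<in> bool_carrier" for b
    using field.set_representation_depends[OF assms, of "st b"] b by (simp add: dims_st)
  have cyl: "h (st (\<c> \<kappa> b)) = {s \<in> seqs \<alpha> U. \<exists>x \<in> U. s(\<kappa> := x) \<in> h (st b)}"
    if "b \<in> bool_carrier" "\<kappa> \<in> Field \<alpha>" for b \<kappa>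
    using field.set_representation_cyl[OF assms that(2), of "st b"] that by (simp add: st_cyl)
  have diag: "h (st (\<d> \<kappa> \<mu>)) = {s \<in> seqs \<alpha> U. s \<kappa> = s \<mu>}"
    if "\<kappa> \<in> Field \<alpha>" "\<mu> \<in> Field \<alpha>" for \<kappa> \<mu>
    using field.set_representation_diag[OF assms that] by (simp add: st_diag_def)
  show ?thesis
    unfolding bool_representation_def
    by (simp add: st_plus st_times st_neg Compl sub Int Un bot top dep cyl diag)
qed

text \<open>
  Under the unrestricted diagonal axiom the cylindrifications are trivial unless the dimension is
  one; the restricted axiom comes with infinite dimension.
\<close>

lemma set_representation_exists:
  assumes ax: "m_ca \<alpha> A \<or> (m_ca_distinct \<alpha> A \<and> infinite (Field \<alpha>))"
    and lf: "locally_finite \<alpha> A"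
    and compact: "\<And>K. K \<subseteq> st ` bool_carrier \<Longrightarrow> (\<And>T. T \<subseteq> K \<Longrightarrow> finite T \<Longrightarrow> \<Inter>T \<noteq> {}) \<Longrightarrow> \<Inter>K \<noteq> {}"
    and emb: "inj (emb :: 'p \<Rightarrow> 'u)" and emb': "inj (emb' :: 'i + 'a + nat \<Rightarrow> 'u)"
    and x: "x \<in> bool_carrier" "st x \<noteq> {}"
  shows "\<exists>(U :: 'u set) h. field.set_representation U h \<and> h (st x) \<noteq> {}"
  using ax
proof
  assume "m_ca \<alpha> A"
  then interpret m_ca \<alpha> A .
  have all: "st_diag \<mu> \<nu> = st_cyl \<kappa> (st_diag \<mu> \<kappa> \<inter> st_diag \<kappa> \<nu>)"
    if "\<kappa> \<in> Field \<alpha>" "\<mu> \<in> Field \<alpha>" "\<nu> \<in> Field \<alpha>" for \<kappa> \<mu> \<nu>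
    using that diag_cyl[OF that] by (simp add: st_diag_def in_bool flip: st_times st_cyl)
  show ?thesis
  proof (cases "\<exists>\<kappa>. Field \<alpha> = {\<kappa>}")
    case True
    then obtain \<kappa> where "Field \<alpha> = {\<kappa>}" ..
    then show ?thesis using field.monadic_representation[OF _ emb x(2) compact] by blast
  next
    case False
    have diag: "st_diag \<kappa> \<mu> = UNIV" if "\<kappa> \<in> Field \<alpha>" "\<mu> \<in> Field \<alpha>" for \<kappa> \<mu>
      using field.degenerate_diag[OF all that] by blast
    have "st_cyl \<kappa> b = b" if \<kappa>: "\<kappa> \<in> Field \<alpha>" and b: "b \<in> st ` bool_carrier" for \<kappa> b
    proof -
      obtain \<mu> where "\<mu> \<in> Field \<alpha>" "\<kappa> \<noteq> \<mu>" using False \<kappa> by blast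
      then show ?thesis using field.degenerate_cyl[OF diag] \<kappa> b by blast
    qed
    then show ?thesis using field.trivial_representation[OF _ diag x(2)] by blast
  qed
next
  assume inf: "m_ca_distinct \<alpha> A \<and> infinite (Field \<alpha>)"
  then interpret m_ca_distinct \<alpha> A by blast
  interpret infinite_cylindric_field \<alpha> "st ` bool_carrier" st_cyl st_diag
  proof
    show "infinite (Field \<alpha>)" using inf by blast
    show "st_diag \<mu> \<nu> = st_cyl \<kappa> (st_diag \<mu> \<kappa> \<inter> st_diag \<kappa> \<nu>)"
      if "\<kappa> \<in> Field \<alpha>" "\<mu> \<in> Field \<alpha>" "\<nu> \<in> Field \<alpha>" "\<kappa> \<noteq> \<mu>" "\<kappa> \<noteq> \<nu>" for \<kappa> \<mu> \<nu>
      using that diag_cyl_distinct[OF that] by (simp add: st_diag_def in_bool flip: st_times st_cyl)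
    fix b assume "b \<in> st ` bool_carrier"
    then obtain b' where b': "b' \<in> bool_carrier" "b = st b'" by blast
    have "field.dims b \<subseteq> dim_set \<alpha> A b'"
      using b' delta_top_bool[OF b'(1)] by (auto simp: dims_st dim_set_def intro!: exI[of _ top])
    then show "finite (field.dims b)"
      using lf b' by (auto simp: locally_finite_def bool_in_carrier intro: finite_subset)
  qed
  \<comment> \<open>The elements that the sets stand for label them injectively, as the codes of requests demand.\<close>
  have "inj_on (inv_into bool_carrier st) (st ` bool_carrier)" by (simp add: inj_on_inv_into)
  then show ?thesis using infinite_representation[OF _ emb'] x by blast
qed

end

context m_ca_core
begin

text \<open>
  The Stone points are sets of elements, and the names are elements of \<open>'i + 'a + nat\<close>; both
  inject into the type prescribed for base points.
\<close>

lemma bool_representation_exists: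
  assumes "m_ca \<alpha> A \<or> (m_ca_distinct \<alpha> A \<and> infinite (Field \<alpha>))" "locally_finite \<alpha> A"
    and x: "x \<in> bool_carrier" "x \<noteq> \<u> bot"
  shows "\<exists>(U :: ('a, 'i) base_point set) g. bool_representation U g \<and> g x \<noteq> {}"
proof -
  interpret bool: boolean_algebra_on bool_carrier "mplus A" "mtimes A" "mneg A" "\<u> bot" "\<u> top"
    by (rule bool_boolean_algebra)
  have "\<u> bot \<noteq> \<u> top" using x bool.meet_zero[of x] bool.meet_one[of x] by auto
  then obtain st :: "'a \<Rightarrow> 'a set set" where st: "inj_on st bool_carrier"
    "\<forall>a \<in> bool_carrier. \<forall>b \<in> bool_carrier. st (a \<boxplus> b) = st a \<union> st b \<and> st (a \<boxdot> b) = st a \<inter> st b"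
    "\<forall>a \<in> bool_carrier. st (\<sim> a) = - st a" "st (\<u> bot) = {}" "st (\<u> top) = UNIV"
    and compact: "\<forall>K \<subseteq> st ` bool_carrier. (\<forall>T \<subseteq> K. finite T \<longrightarrow> \<Inter>T \<noteq> {}) \<longrightarrow> \<Inter>K \<noteq> {}"
    using bool.stone_representation by blast
  interpret stone_image \<alpha> A st by unfold_locales (use st in auto)
  have "st x \<noteq> {}" using x st(1,4) bot_in_bool by (metis inj_onD)
  moreover have "inj (\<lambda>F :: 'a set. (Inr ` Inl ` F :: ('a, 'i) base_point))"
    by (auto simp: inj_on_def inj_image_eq_iff)
  moreover have "inj (\<lambda>n :: 'i + 'a + nat. {n})" by (auto simp: inj_on_def)
  ultimately obtain U :: "('a, 'i) base_point set" and h where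
    "field.set_representation U h" "h (st x) \<noteq> {}"
    using set_representation_exists[OF assms(1,2)] compact x(1) by metis
  then show ?thesis using bool_representation_st by blast
qed

end

section \<open>From the Boolean elements to the whole algebra\<close>

definition m_hom ::
  "'i rel \<Rightarrow> ('a, 'i, 'm) mcyl_algebra \<Rightarrow> ('b, 'i, 'm) mcyl_algebra \<Rightarrow> ('a \<Rightarrow> 'b) \<Rightarrow> bool" where
  "m_hom \<alpha> A B h \<longleftrightarrow>
     (\<forall>a \<in> carrier A. h a \<in> carrier B) \<and>
     (\<forall>a \<in> carrier A. \<forall>b \<in> carrier A. h (mplus A a b) = mplus B (h a) (h b) \<and>
                                     h (mtimes A a b) = mtimes B (h a) (h b)) \<and>
     (\<forall>a \<in> carrier A. h (mneg A a) = mneg B (h a)) \<and>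
     (\<forall>p. h (mconst A p) = mconst B p) \<and>
     (\<forall>\<kappa> \<in> Field \<alpha>. \<forall>a \<in> carrier A. h (mcyl A \<kappa> a) = mcyl B \<kappa> (h a)) \<and>
     (\<forall>\<kappa> \<in> Field \<alpha>. \<forall>\<mu> \<in> Field \<alpha>. h (mdiag A \<kappa> \<mu>) = mdiag B \<kappa> \<mu>) \<and>
     (\<forall>p. \<forall>a \<in> carrier A. h (mdelta A p a) = mdelta B p (h a))"

definition hom_image ::
  "('a, 'i, 'm) mcyl_algebra \<Rightarrow> ('b, 'i, 'm) mcyl_algebra \<Rightarrow> ('a \<Rightarrow> 'b) \<Rightarrow> ('b, 'i, 'm) mcyl_algebra"
where
  "hom_image A B h = B\<lparr>carrier := h ` carrier A\<rparr>"

lemma hom_image_simps [simp]: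
  "carrier (hom_image A B h) = h ` carrier A" "mplus (hom_image A B h) = mplus B"
  "mtimes (hom_image A B h) = mtimes B" "mneg (hom_image A B h) = mneg B"
  "mconst (hom_image A B h) = mconst B" "mcyl (hom_image A B h) = mcyl B"
  "mdiag (hom_image A B h) = mdiag B" "mdelta (hom_image A B h) = mdelta B"
  by (simp_all add: hom_image_def)

lemma m_hom_hom_image: "m_hom \<alpha> A B h \<Longrightarrow> m_hom \<alpha> A (hom_image A B h) h"
  by (simp add: m_hom_def)

lemma m_hom_product:
  assumes "\<And>j. j \<in> J \<Longrightarrow> m_hom \<alpha> A (C j) (h j)"
  shows "m_hom \<alpha> A (m_product J C) (\<lambda>a. \<lambda>j\<in>J. h j a)"
  using assms unfolding m_hom_def m_product_def by (auto intro!: restrict_ext)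

lemma m_iso_hom_image: "m_hom \<alpha> A B h \<Longrightarrow> inj_on h (carrier A) \<Longrightarrow> m_iso \<alpha> A (hom_image A B h) h"
  by (simp add: m_hom_def m_iso_def bij_betw_def)

context m_ca_core
begin

lemma m_subalgebra_hom_image:
  assumes "m_hom \<alpha> A B h"
  shows "m_subalgebra \<alpha> (hom_image A B h) B"
proof -
  have "hom_image A B h = B\<lparr>carrier := carrier (hom_image A B h)\<rparr>" by (simp add: hom_image_def)
  moreover have h: "h a \<in> carrier B" "mneg B (h a) = h (\<sim> a)" "mdelta B p (h a) = h (\<delta> p a)"
    "mplus B (h a) (h b) = h (a \<boxplus> b)" "mtimes B (h a) (h b) = h (a \<boxdot> b)"
    "\<kappa> \<in> Field \<alpha> \<Longrightarrow> mcyl B \<kappa> (h a) = h (\<c> \<kappa> a)" if "a \<in> carrier A" "b \<in> carrier A" for a b p \<kappa>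
    using assms that by (simp_all add: m_hom_def)
  moreover have "mconst B p = h (\<u> p)" for p using assms by (simp add: m_hom_def)
  moreover have "mdiag B \<kappa> \<mu> = h (\<d> \<kappa> \<mu>)" if "\<kappa> \<in> Field \<alpha>" "\<mu> \<in> Field \<alpha>" for \<kappa> \<mu>
    using assms that by (simp add: m_hom_def)
  ultimately show ?thesis
    unfolding m_subalgebra_def
    by (auto simp: plus_closed times_closed neg_closed const_closed cyl_closed diag_closed delta_closed)
qed

end

lemma csa_full_csa: "csa \<alpha> U (full_csa \<alpha> U)"
  by (auto simp: csa_def full_csa_def)

text \<open>
  A set that depends on finitely many indices and is closed under cylindrification along some of
  them depends only on the others: these indices can be changed one at a time.
\<close>

lemma depends_on_reduce:
  assumes X: "X \<subseteq> seqs \<alpha> U" and dep: "depends_on \<alpha> U X D" and D: "finite D" "D \<subseteq> Field \<alpha>"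
    and closed: "\<And>\<kappa>. \<kappa> \<in> D - \<Delta> \<Longrightarrow> {s \<in> seqs \<alpha> U. \<exists>x \<in> U. s(\<kappa> := x) \<in> X} = X"
  shows "depends_on \<alpha> U X \<Delta>"
proof -
  have change: "s \<in> X \<longleftrightarrow> s(\<kappa> := x) \<in> X"
    if s: "s \<in> seqs \<alpha> U" and \<kappa>: "\<kappa> \<in> D - \<Delta>" and x: "x \<in> U" for s \<kappa> x
  proof
    have upd: "s(\<kappa> := x) \<in> seqs \<alpha> U" using s x \<kappa> D by (auto simp: PiE_iff extensional_def)
    have "s \<kappa> \<in> U" using s \<kappa> D by (auto simp: PiE_iff)
    then show "s(\<kappa> := x) \<in> X" if "s \<in> X"
      using closed[OF \<kappa>] that upd by (force intro: bexI[of _ "s \<kappa>"])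
    show "s \<in> X" if "s(\<kappa> := x) \<in> X" using closed[OF \<kappa>] that s x by blast
  qed
  have mixed: "override_on s t E \<in> seqs \<alpha> U"
    if "s \<in> seqs \<alpha> U" "t \<in> seqs \<alpha> U" "E \<subseteq> D" for s t E
    using that D by (auto simp: PiE_iff extensional_def override_on_def)
  have many: "s \<in> X \<longleftrightarrow> override_on s t E \<in> X"
    if s: "s \<in> seqs \<alpha> U" and t: "t \<in> seqs \<alpha> U" and E: "finite E" "E \<subseteq> D - \<Delta>" for s t E
    using E
  proof (induction rule: finite_induct)
    case (insert \<kappa> E)
    have "override_on s t (insert \<kappa> E) = (override_on s t E)(\<kappa> := t \<kappa>)"
      by (auto simp: override_on_def)
    moreover have "t \<kappa> \<in> U" using insert.prems t D by (auto simp: PiE_iff)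
    moreover have "override_on s t E \<in> seqs \<alpha> U" using insert.prems by (intro mixed[OF s t]) auto
    moreover have "\<kappa> \<in> D - \<Delta>" "E \<subseteq> D - \<Delta>" using insert.prems by auto
    ultimately show ?case using insert.IH change[of "override_on s t E" \<kappa> "t \<kappa>"] by metis
  qed (use s in simp)
  show ?thesis
    unfolding depends_on_def
  proof (intro ballI impI)
    fix s t assume s: "s \<in> seqs \<alpha> U" and t: "t \<in> seqs \<alpha> U" and agree: "\<forall>\<kappa> \<in> \<Delta>. s \<kappa> = t \<kappa>"
    let ?u = "override_on s t (D - \<Delta>)"
    have u: "?u \<in> seqs \<alpha> U" by (rule mixed[OF s t]) auto
    have "s \<in> X \<longleftrightarrow> ?u \<in> X" using many[OF s t, of "D - \<Delta>"] D u by blast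
    also have "\<dots> \<longleftrightarrow> t \<in> X"
    proof -
      have "\<forall>\<kappa> \<in> D. ?u \<kappa> = t \<kappa>" using agree by (simp add: override_on_def)
      then show ?thesis using dep u t unfolding depends_on_def by blast
    qed
    finally show "s \<in> X \<longleftrightarrow> t \<in> X" .
  qed
qed

context m_ca_core
begin

context
  fixes U :: "'u set" and g :: "'a \<Rightarrow> ('i \<Rightarrow> 'u) set"
  assumes g: "bool_representation U g"
begin

lemma
  assumes "b \<in> bool_carrier"
  shows g_subset: "g b \<subseteq> seqs \<alpha> U" and g_neg: "g (\<sim> b) = seqs \<alpha> U - g b"
    and g_cyl: "\<kappa> \<in> Field \<alpha> \<Longrightarrow> g (\<c> \<kappa> b) = {s \<in> seqs \<alpha> U. \<exists>x \<in> U. s(\<kappa> := x) \<in> g b}"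
    and g_depends: "depends_on \<alpha> U (g b) {\<kappa> \<in> Field \<alpha>. \<c> \<kappa> b \<noteq> b}"
  using g assms by (simp_all add: bool_representation_def)

lemma
  assumes "a \<in> bool_carrier" "b \<in> bool_carrier"
  shows g_plus: "g (a \<boxplus> b) = g a \<union> g b" and g_times: "g (a \<boxdot> b) = g a \<inter> g b"
  using g assms by (simp_all add: bool_representation_def)

lemma g_diag: "\<kappa> \<in> Field \<alpha> \<Longrightarrow> \<mu> \<in> Field \<alpha> \<Longrightarrow> g (\<d> \<kappa> \<mu>) = {s \<in> seqs \<alpha> U. s \<kappa> = s \<mu>}"
  and g_bot: "g (\<u> bot) = {}" and g_top: "g (\<u> top) = seqs \<alpha> U"
  using g by (simp_all add: bool_representation_def)

lemma g_msum:
  assumes "finite S" "\<And>k. k \<in> S \<Longrightarrow> f k \<in> bool_carrier"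
  shows "msum A f S \<in> bool_carrier \<and> g (msum A f S) = csum (full_csa \<alpha> U) (\<lambda>k. g (f k)) S"
proof -
  have "msum A f S \<in> bool_carrier \<and> g (msum A f S) = (\<Union>k\<in>S. g (f k))"
    using assms
    by (induction rule: finite_induct)
      (simp_all add: msum_empty msum_insert bool_in_carrier in_bool g_plus g_bot)
  then show ?thesis using assms g_subset by (simp add: csum_full_csa)
qed

lemma g_mprod:
  assumes "finite S" "\<And>k. k \<in> S \<Longrightarrow> f k \<in> bool_carrier"
  shows "mprod A f S \<in> bool_carrier \<and> g (mprod A f S) = cprod (full_csa \<alpha> U) (\<lambda>k. g (f k)) S"
proof -
  have "mprod A f S \<in> bool_carrier \<and> g (mprod A f S) = seqs \<alpha> U \<inter> (\<Inter>k\<in>S. g (f k))"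
    using assms
  proof (induction rule: finite_induct)
    case (insert k S)
    then show ?case by (auto simp: mprod_insert bool_in_carrier in_bool g_times)
  qed (simp add: mprod_empty in_bool g_top)
  then show ?thesis using assms g_subset by (simp add: cprod_full_csa)
qed

text \<open>
  The axioms express every \<open>\<delta> p\<close> of a compound element by Boolean operations on values of \<open>\<delta>\<close>, in
  exactly the form in which the operations of \<open>m_of\<close> are defined; so the family of the \<open>g (\<delta> p a)\<close>
  depends homomorphically on \<open>a\<close>.
\<close>

definition spectrum :: "'a \<Rightarrow> 'm \<Rightarrow> ('i \<Rightarrow> 'u) set" where
  "spectrum a p = g (\<delta> p a)"

lemma m_hom_spectrum: "m_hom \<alpha> A (m_of (full_csa \<alpha> U)) spectrum"
  unfolding m_hom_def
proof (intro conjI ballI allI)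
  let ?F = "full_csa \<alpha> U"
  fix a assume a: "a \<in> carrier A"
  have d: "\<delta> p a \<in> bool_carrier" for p using a by (rule delta_in_bool)
  have "\<forall>p q. p \<noteq> q \<longrightarrow> g (\<delta> p a) \<inter> g (\<delta> q a) = {}"
    using d a by (simp add: delta_disjoint g_bot flip: g_times)
  moreover have "csum ?F (\<lambda>p. g (\<delta> p a)) UNIV = seqs \<alpha> U"
    using g_msum[of UNIV "\<lambda>p. \<delta> p a"] d a by (simp add: delta_sum g_top)
  moreover have "g (\<delta> p a) \<subseteq> seqs \<alpha> U" for p using d by (rule g_subset)
  ultimately show "spectrum a \<in> carrier (m_of ?F)"
    by (simp add: m_of_def spectrum_def[abs_def]) (simp add: full_csa_def)
  show "spectrum (\<sim> a) = mneg (m_of ?F) (spectrum a)"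
    using a by (simp add: m_of_def spectrum_def fun_eq_iff delta_neg)
  show "spectrum (\<delta> q a) = mdelta (m_of ?F) q (spectrum a)" for q
    using a d
    by (auto simp: m_of_def spectrum_def fun_eq_iff delta_top_delta delta_bot_delta
        delta_other_delta g_bot g_neg full_csa_def)
  fix b assume b: "b \<in> carrier A"
  have db: "\<delta> p b \<in> bool_carrier" for p using b by (rule delta_in_bool)
  have sum: "g (msum A (\<lambda>(q, r). \<delta> q a \<boxdot> \<delta> r b) S) = csum ?F (\<lambda>(q, r). g (\<delta> q a) \<inter> g (\<delta> r b)) S" for S
    using g_msum[of S "\<lambda>(q, r). \<delta> q a \<boxdot> \<delta> r b"] d db
    by (auto simp: times_in_bool g_times case_prod_unfold)
  show "spectrum (a \<boxplus> b) = mplus (m_of ?F) (spectrum a) (spectrum b)"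
    using a b sum by (simp add: m_of_def spectrum_def fun_eq_iff delta_plus) (simp add: full_csa_def)
  show "spectrum (a \<boxdot> b) = mtimes (m_of ?F) (spectrum a) (spectrum b)"
    using a b sum by (simp add: m_of_def spectrum_def fun_eq_iff delta_times) (simp add: full_csa_def)
next
  let ?F = "full_csa \<alpha> U"
  fix q
  show "spectrum (\<u> q) = mconst (m_of ?F) q"
    by (auto simp: m_of_def spectrum_def fun_eq_iff delta_const_same delta_const_other g_bot g_top
        full_csa_def)
next
  let ?F = "full_csa \<alpha> U"
  fix \<kappa> \<mu> assume "\<kappa> \<in> Field \<alpha>" "\<mu> \<in> Field \<alpha>"
  then show "spectrum (\<d> \<kappa> \<mu>) = mdiag (m_of ?F) \<kappa> \<mu>"
    by (auto simp: m_of_def spectrum_def fun_eq_iff delta_top_diag delta_bot_diag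
        delta_other_diag g_bot g_neg g_diag diag_in_bool full_csa_def)
next
  let ?F = "full_csa \<alpha> U"
  fix \<kappa> a assume \<kappa>: "\<kappa> \<in> Field \<alpha>" and a: "a \<in> carrier A"
  define c where "c q = \<c> \<kappa> (\<delta> q a)" for q
  have c: "c q \<in> bool_carrier" for q using \<kappa> a by (simp add: c_def in_bool)
  have gc: "g (c q) = ccyl ?F \<kappa> (spectrum a q)" for q
    using \<kappa> a by (simp add: c_def g_cyl delta_in_bool spectrum_def full_csa_def)
  have prod: "mprod A c P \<in> bool_carrier" "g (mprod A c P) = cprod ?F (\<lambda>q. ccyl ?F \<kappa> (spectrum a q)) P"
    for P using g_mprod[of P c] c by (simp_all add: gc)
  have sum: "msum A (mprod A c) S \<in> bool_carrier"
    "g (msum A (mprod A c) S) = csum ?F (cprod ?F (\<lambda>q. ccyl ?F \<kappa> (spectrum a q))) S" for S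
    using g_msum[of S "mprod A c"] prod by simp_all
  show "spectrum (\<c> \<kappa> a) = mcyl (m_of ?F) \<kappa> (spectrum a)"
  proof
    fix p :: 'm
    let ?S = "{P. P \<noteq> {} \<and> Sup_fin P = p}" and ?T = "{P. P \<noteq> {} \<and> p < Sup_fin P}"
    have "\<delta> p (\<c> \<kappa> a) = msum A (mprod A c) ?S \<boxdot> \<sim> (msum A (mprod A c) ?T)"
      using delta_cyl[OF \<kappa> a, of p] by (simp add: c_def[abs_def])
    then have "spectrum (\<c> \<kappa> a) p = g (msum A (mprod A c) ?S) \<inter> (seqs \<alpha> U - g (msum A (mprod A c) ?T))"
      using sum(1) by (simp add: spectrum_def g_times g_neg neg_in_bool)
    also have "\<dots> = mcyl (m_of ?F) \<kappa> (spectrum a) p"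
      unfolding sum(2) by (simp add: m_of_def) (simp add: full_csa_def)
    finally show "spectrum (\<c> \<kappa> a) p = mcyl (m_of ?F) \<kappa> (spectrum a) p" .
  qed
qed

text \<open>
  The representation need not be faithful, so the dimension set of the image can be smaller than
  that of \<open>a\<close>; but the image is closed under cylindrification along the lost indices.
\<close>

lemma regular_hom_image:
  assumes lf: "locally_finite \<alpha> A"
  shows "regular_m_csa \<alpha> U (hom_image A (m_of (full_csa \<alpha> U)) spectrum)"
    (is "regular_m_csa \<alpha> U ?C")
  unfolding regular_m_csa_def
proof (intro conjI ballI allI)
  show "m_csa \<alpha> U ?C"
    unfolding m_csa_def using csa_full_csa m_subalgebra_hom_image[OF m_hom_spectrum] by blast
  fix L p assume "L \<in> carrier ?C"
  then obtain a where a: "a \<in> carrier A" "L = spectrum a" by auto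
  define b where "b = \<delta> p a"
  have b: "b \<in> bool_carrier" using a by (simp add: b_def delta_in_bool)
  have D: "{\<kappa> \<in> Field \<alpha>. \<c> \<kappa> b \<noteq> b} \<subseteq> dim_set \<alpha> A a" by (auto simp: dim_set_def b_def)
  have hom: "m_hom \<alpha> A ?C spectrum" using m_hom_spectrum by (rule m_hom_hom_image)
  have "depends_on \<alpha> U (g b) (dim_set \<alpha> ?C L)"
  proof (rule depends_on_reduce[OF g_subset[OF b] g_depends[OF b]])
    show "finite {\<kappa> \<in> Field \<alpha>. \<c> \<kappa> b \<noteq> b}"
      using D lf a by (auto simp: locally_finite_def intro: finite_subset)
    fix \<kappa> assume "\<kappa> \<in> {\<kappa> \<in> Field \<alpha>. \<c> \<kappa> b \<noteq> b} - dim_set \<alpha> ?C L"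
    then have \<kappa>: "\<kappa> \<in> Field \<alpha>" and "mcyl ?C \<kappa> (mdelta ?C p L) = mdelta ?C p L"
      by (auto simp: dim_set_def)
    moreover have "mdelta ?C p L = spectrum b" using hom a by (simp add: m_hom_def b_def)
    moreover have "mcyl ?C \<kappa> (spectrum b) = spectrum (\<c> \<kappa> b)"
      using hom \<kappa> bool_in_carrier[OF b] by (simp add: m_hom_def)
    ultimately have "spectrum (\<c> \<kappa> b) top = spectrum b top" by simp
    then have "g (\<c> \<kappa> b) = g b" using b \<kappa> by (simp add: spectrum_def delta_top_bool cyl_in_bool)
    then show "{s \<in> seqs \<alpha> U. \<exists>x \<in> U. s(\<kappa> := x) \<in> g b} = g b" using b \<kappa> by (simp add: g_cyl)
  qed auto
  then show "depends_on \<alpha> U (L p) (dim_set \<alpha> ?C L)" by (simp add: a spectrum_def b_def)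
qed

end

text \<open>
  Distinct elements differ in some \<open>\<delta> p\<close>, and one of the two differences of these Boolean elements
  is nonzero; a representation that keeps it nonempty separates the elements.
\<close>

lemma separating_representation:
  assumes ax: "m_ca \<alpha> A \<or> (m_ca_distinct \<alpha> A \<and> infinite (Field \<alpha>))" "locally_finite \<alpha> A"
    and ab: "a \<in> carrier A" "b \<in> carrier A" "a \<noteq> b"
  shows "\<exists>(U :: ('a, 'i) base_point set) g. bool_representation U g \<and> spectrum g a \<noteq> spectrum g b"
proof -
  interpret bool: boolean_algebra_on bool_carrier "mplus A" "mtimes A" "mneg A" "\<u> bot" "\<u> top"
    by (rule bool_boolean_algebra)
  obtain p where p: "\<delta> p a \<noteq> \<delta> p b" using delta_eqI[OF ab(1,2)] ab(3) by blast
  define x y where "x = \<delta> p a" and "y = \<delta> p b"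
  have xy: "x \<in> bool_carrier" "y \<in> bool_carrier" "x \<noteq> y"
    using ab p by (simp_all add: x_def y_def delta_in_bool)
  have "x \<boxdot> \<sim> y \<noteq> \<u> bot \<or> y \<boxdot> \<sim> x \<noteq> \<u> bot"
  proof (rule ccontr)
    assume "\<not> ?thesis"
    then have z: "x \<boxdot> \<sim> y = \<u> bot" "y \<boxdot> \<sim> x = \<u> bot" by auto
    have "x = x \<boxdot> (y \<boxplus> \<sim> y)" using xy by (simp add: bool.join_compl bool.meet_one)
    also have "\<dots> = y \<boxdot> (x \<boxplus> \<sim> x)"
      using xy z by (simp add: bool.meet_join_distrib bool.closed bool.join_zero bool.meet_comm)
    finally show False using xy by (simp add: bool.join_compl bool.meet_one)
  qed
  then obtain z where z: "z = x \<boxdot> \<sim> y \<or> z = y \<boxdot> \<sim> x" "z \<noteq> \<u> bot" by blast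
  have "z \<in> bool_carrier" using z(1) xy by (auto simp: in_bool)
  then obtain U :: "('a, 'i) base_point set" and g where g: "bool_representation U g" "g z \<noteq> {}"
    using bool_representation_exists[OF ax _ z(2)] by blast
  have "g (u \<boxdot> \<sim> v) = g u - g v" if uv: "u \<in> bool_carrier" "v \<in> bool_carrier" for u v
  proof -
    have "g (u \<boxdot> \<sim> v) = g u \<inter> (seqs \<alpha> U - g v)"
      using uv by (simp add: g_times[OF g(1)] g_neg[OF g(1)] neg_in_bool)
    then show ?thesis using g_subset[OF g(1) uv(1)] by blast
  qed
  then have "g z = g x - g y \<or> g z = g y - g x" using z(1) xy by metis
  then have "g x \<noteq> g y" using g(2) by auto
  then have "spectrum g a p \<noteq> spectrum g b p"
    by (simp add: spectrum_def[OF g(1)] x_def y_def)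
  then show ?thesis using g(1) by metis
qed

text \<open>One factor for each pair of distinct elements makes the map into the product injective.\<close>

lemma locally_finite_representation:
  assumes ax: "m_ca \<alpha> A \<or> (m_ca_distinct \<alpha> A \<and> infinite (Field \<alpha>))" "locally_finite \<alpha> A"
  shows "embeds_in_product_of_regular \<alpha> A \<and> representable \<alpha> A"
proof -
  define J where "J = {(a, b). a \<in> carrier A \<and> b \<in> carrier A \<and> a \<noteq> b}"
  have "\<exists>(U :: ('a, 'i) base_point set) g. bool_representation U g \<and>
      spectrum g (fst j) \<noteq> spectrum g (snd j)" if "j \<in> J" for j
    using separating_representation[OF ax] that by (auto simp: J_def)
  then obtain U :: "'a \<times> 'a \<Rightarrow> ('a, 'i) base_point set" and g where
    g: "\<And>j. j \<in> J \<Longrightarrow> bool_representation (U j) (g j)"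
    and sep: "\<And>j. j \<in> J \<Longrightarrow> spectrum (g j) (fst j) \<noteq> spectrum (g j) (snd j)"
    by metis
  define C where "C j = hom_image A (m_of (full_csa \<alpha> (U j))) (spectrum (g j))" for j
  define \<phi> where "\<phi> a = (\<lambda>j\<in>J. spectrum (g j) a)" for a
  define S where "S = hom_image A (m_product J C) \<phi>"
  have hom: "m_hom \<alpha> A (m_product J C) \<phi>"
    unfolding \<phi>_def[abs_def] C_def
    by (intro m_hom_product m_hom_hom_image m_hom_spectrum g)
  have regular: "regular_m_csa \<alpha> (U j) (C j)" if "j \<in> J" for j
    unfolding C_def using g[OF that] ax(2) by (rule regular_hom_image)
  have "inj_on \<phi> (carrier A)"
  proof (rule inj_onI, rule ccontr)
    fix a b assume ab: "a \<in> carrier A" "b \<in> carrier A" "\<phi> a = \<phi> b" "a \<noteq> b"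
    then have j: "(a, b) \<in> J" by (simp add: J_def)
    have "\<phi> a (a, b) = \<phi> b (a, b)" by (simp add: ab(3))
    then show False using sep[OF j] j by (simp add: \<phi>_def)
  qed
  then have "m_isomorphic \<alpha> A S"
    unfolding m_isomorphic_def S_def using m_iso_hom_image[OF hom] by blast
  moreover have sub: "m_subalgebra \<alpha> S (m_product J C)"
    unfolding S_def using hom by (rule m_subalgebra_hom_image)
  moreover have "m_subdirect_product \<alpha> J C S"
    unfolding m_subdirect_product_def
  proof (intro conjI sub ballI)
    fix j assume "j \<in> J"
    then show "(\<lambda>x. x j) ` carrier S = carrier (C j)"
      by (simp add: S_def C_def \<phi>_def image_image)
  qed
  moreover have "\<forall>j \<in> J. \<exists>U. m_csa \<alpha> U (C j)"
    using regular by (auto simp: regular_m_csa_def)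
  ultimately show ?thesis
    unfolding embeds_in_product_of_regular_def representable_def using regular by blast
qed

end

section \<open>The representation theorem\<close>

theorem theorem2p46:
  fixes \<alpha> :: "'i rel"
    and A :: "('a, 'i, 'm::{de_morgan_algebra, finite}) mcyl_algebra"
  assumes "Well_order \<alpha>"
    and "m_ca \<alpha> A \<or> (m_ca_distinct \<alpha> A \<and> infinite (Field \<alpha>))"
    and "locally_finite \<alpha> A"
  shows "embeds_in_product_of_regular \<alpha> A \<and> representable \<alpha> A"
proof -
  have "m_ca_core \<alpha> A" using assms(2) m_ca.axioms(1) m_ca_distinct.axioms(1) by blast
  then show ?thesis using assms(2,3) by (rule m_ca_core.locally_finite_representation)
qed

end
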